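(* Let $d\ge2$, $s\in(0,1]$, $n\in\mathbb Z$, and let $\mathbf a$ be a coefficient field on $\square_n=(-\frac12 3^n,\frac12 3^n)^d$. Put $2_s^\ast:=\frac{2d}{d-2(1-s)}$. There exists $C=C(d)<\infty$ such that, for every $u\in H^1_{\mathbf a}(\square_n)$, $$3^{-n}\|u-(u)_{\square_n}\|_{\underline L^{2^\ast_s}(\square_n)}\le C s^{-1}\lambda_s(\square_n)^{-1/2}\,\|\mathbf a^{1/2}\nabla u\|_{\underline L^2(\square_n)} .$$
   Context: Notation: $(f)_U=\fint_Uf$ is the average; $\|f\|_{\underline L^p(U)}=(\fint_U|f|^p)^{1/p}$. Coefficient field: a measurable map $\mathbf a$ from a bounded Lipschitz domain $U$ to symmetric positive semi-definite $d\times d$ matrices, invertible a.e., with $\mathbf a,\mathbf a^{-1}\in L^1(U)$. $H^1_{\mathbf a}(U)$ is the completion of $C^\infty(\overline U)$ in the norm $(\|u\|_{L^2(U)}^2+\int_U\nabla u\cdot\mathbf a\nabla u)^{1/2}$. $\mathcal A(U)$ is the set of $u\in H^1_{\mathbf a}(U)$ with $\int_U\nabla\psi\cdot\mathbf a\nabla u=0$ for all $\psi\in C_c^\infty(U)$. The symmetric positive matrix $\mathbf a_*^{-1}(U)$ is defined by $q\cdot\mathbf a_*^{-1}(U)q=\sup_{u\in\mathcal A(U)}\fint_U(-\nabla u\cdot\mathbf a\nabla u+2q\cdot\nabla u)$ for $q\in\mathbb R^d$ (the supremum over all of $H^1_{\mathbf a}(U)$ has the same value); $|\cdot|$ is the spectral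 norm. With $\mathfrak c_s=1-3^{-s}$, $$\lambda_s(\square_n)=\Bigl(\mathfrak c_s\sum_{k=-\infty}^n3^{-s(n-k)}\max_{z\in3^k\mathbb Z^d\cap\square_n}|\mathbf a_*^{-1}(z+\square_k)|^{1/2}\Bigr)^{-2}$$ (the estimate is trivial if $\lambda_s(\square_n)=0$). *)

theory Defs
  imports "HOL-Analysis.Analysis"
begin

section \<open>Averages and normalized Lebesgue norms\<close>

definition avg :: "(real^'n) set \<Rightarrow> (real^'n \<Rightarrow> real) \<Rightarrow> real" where
  "avg U f = (LINT x|lebesgue_on U. f x) / measure lebesgue U"

text \<open>Powers of extended nonnegative reals, meant for positive exponents only (so that the
  value at infinity is infinity). Negative powers are written with \<^const>\<open>inverse\<close>, which
  maps 0 to infinity and infinity to 0.\<close>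

definition epowr :: "ennreal \<Rightarrow> real \<Rightarrow> ennreal" where
  "epowr x p = (if x = \<infinity> then \<infinity> else ennreal (enn2real x powr p))"

definition avg_Lp_norm :: "real \<Rightarrow> (real^'n) set \<Rightarrow> (real^'n \<Rightarrow> 'b::real_normed_vector) \<Rightarrow> ennreal" where
  "avg_Lp_norm p U f =
     epowr ((\<integral>\<^sup>+x. ennreal (norm (f x) powr p) \<partial>lebesgue_on U) / emeasure lebesgue U) (1 / p)"

section \<open>Smooth functions\<close>

definition partial_deriv :: "'n \<Rightarrow> (real^'n \<Rightarrow> real) \<Rightarrow> real^'n \<Rightarrow> real" where
  "partial_deriv i f x = frechet_derivative f (at x) (axis i 1)"

definition grad :: "(real^'n \<Rightarrow> real) \<Rightarrow> real^'n \<Rightarrow> real^'n" where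
  "grad f x = (\<chi> i. partial_deriv i f x)"

primrec times_differentiable :: "nat \<Rightarrow> (real^'n \<Rightarrow> real) \<Rightarrow> bool" where
  "times_differentiable 0 f \<longleftrightarrow> continuous_on UNIV f"
| "times_differentiable (Suc k) f \<longleftrightarrow>
     (\<forall>x. f differentiable (at x)) \<and> (\<forall>i. times_differentiable k (partial_deriv i f))"

text \<open>Functions that are smooth up to the boundary of \<open>U\<close> are represented by the smooth
  functions on the whole space of which they are the restrictions.\<close>

definition smooth :: "(real^'n \<Rightarrow> real) \<Rightarrow> bool" where
  "smooth f \<longleftrightarrow> (\<forall>k. times_differentiable k f)"

definition test_function :: "(real^'n) set \<Rightarrow> (real^'n \<Rightarrow> real) \<Rightarrow> bool" where
  "test_function U f \<longleftrightarrow>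
     smooth f \<and> compact (closure {x. f x \<noteq> 0}) \<and> closure {x. f x \<noteq> 0} \<subseteq> U"

section \<open>Coefficient fields and the weighted Sobolev space\<close>

definition psd_matrix :: "real^'n^'n \<Rightarrow> bool" where
  "psd_matrix A \<longleftrightarrow> transpose A = A \<and> (\<forall>v. 0 \<le> v \<bullet> (A *v v))"

definition matrix_sqrt :: "real^'n^'n \<Rightarrow> real^'n^'n" where
  "matrix_sqrt A = (SOME S. psd_matrix S \<and> S ** S = A)"

definition coefficient_field :: "(real^'n) set \<Rightarrow> (real^'n \<Rightarrow> real^'n^'n) \<Rightarrow> bool" where
  "coefficient_field U a \<longleftrightarrow>
     a \<in> borel_measurable (lebesgue_on U) \<and>
     (\<forall>x\<in>U. psd_matrix (a x)) \<and>
     (AE x in lebesgue_on U. invertible (a x)) \<and>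
     integrable (lebesgue_on U) a \<and>
     integrable (lebesgue_on U) (\<lambda>x. matrix_inv (a x))"

text \<open>The completion of the smooth functions in the weighted norm, realized as the closure of
  the pairs of a smooth function and its gradient in the product of the Lebesgue space of
  square integrable functions and the space of vector fields \<open>g\<close> with
  \<open>\<integral> g \<bullet> a g < \<infinity>\<close>, both of which are complete. An element is thus a pair of
  representatives \<open>(u, g)\<close>, where \<open>g\<close> plays the role of the gradient of \<open>u\<close>; as the
  inverse of \<open>a\<close> is integrable, \<open>g\<close> is the weak gradient of \<open>u\<close> and is almost everywhere
  determined by \<open>u\<close>. Finiteness of the norm of \<open>(u, g)\<close> follows from the convergence.\<close>

definition H1 :: "(real^'n \<Rightarrow> real^'n^'n) \<Rightarrow> (real^'n) set \<Rightarrow>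
    ((real^'n \<Rightarrow> real) \<times> (real^'n \<Rightarrow> real^'n)) set" where
  "H1 a U = {(u, g). u \<in> borel_measurable (lebesgue_on U) \<and> g \<in> borel_measurable (lebesgue_on U) \<and>
     (\<exists>\<phi> :: nat \<Rightarrow> real^'n \<Rightarrow> real. (\<forall>j. smooth (\<phi> j)) \<and>
       ((\<lambda>j. (\<integral>\<^sup>+x. ennreal ((\<phi> j x - u x)\<^sup>2) \<partial>lebesgue_on U) +
             (\<integral>\<^sup>+x. ennreal ((grad (\<phi> j) x - g x) \<bullet> (a x *v (grad (\<phi> j) x - g x)))
                \<partial>lebesgue_on U)) \<longlonglongrightarrow> 0))}"

definition solutions :: "(real^'n \<Rightarrow> real^'n^'n) \<Rightarrow> (real^'n) set \<Rightarrow>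
    ((real^'n \<Rightarrow> real) \<times> (real^'n \<Rightarrow> real^'n)) set" where
  "solutions a U = {(u, g) \<in> H1 a U.
     \<forall>\<psi>. test_function U \<psi> \<longrightarrow> (LINT x|lebesgue_on U. grad \<psi> x \<bullet> (a x *v g x)) = 0}"

section \<open>The coarse-grained matrix and the coarse-grained ellipticity constant\<close>

text \<open>This is the matrix written as the inverse of \<open>a\<^sub>*(U)\<close>; a symmetric matrix is determined
  by its quadratic form.\<close>

definition a_star_inv :: "(real^'n \<Rightarrow> real^'n^'n) \<Rightarrow> (real^'n) set \<Rightarrow> real^'n^'n" where
  "a_star_inv a U = (THE B. transpose B = B \<and>
     (\<forall>q. q \<bullet> (B *v q) =
        (SUP (u, g) \<in> solutions a U. avg U (\<lambda>x. - (g x \<bullet> (a x *v g x)) + 2 * (q \<bullet> g x)))))"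

definition spectral_norm :: "real^'n^'n \<Rightarrow> real" where
  "spectral_norm B = onorm (\<lambda>v. B *v v)"

definition cube :: "int \<Rightarrow> (real^'n) set" where
  "cube n = {x. \<forall>i. - (1/2) * 3 powi n < x $ i \<and> x $ i < 1/2 * 3 powi n}"

definition scaled_lattice :: "int \<Rightarrow> (real^'n) set" where
  "scaled_lattice k = {z. \<forall>i. \<exists>m::int. z $ i = 3 powi k * of_int m}"

definition lambda_s :: "(real^'n \<Rightarrow> real^'n^'n) \<Rightarrow> real \<Rightarrow> int \<Rightarrow> ennreal" where
  "lambda_s a s n = inverse
     ((ennreal (1 - 3 powr (- s)) *
       (\<Sum>\<^sub>\<infinity>k\<in>{..n}. ennreal (3 powr (- s * of_int (n - k)) *
          (MAX z \<in> scaled_lattice k \<inter> cube n.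
             sqrt (spectral_norm (a_star_inv a ((\<lambda>x. z + x) ` cube k)))))))\<^sup>2)"

definition sobolev_exponent :: "real \<Rightarrow> real \<Rightarrow> real" where
  "sobolev_exponent d s = 2 * d / (d - 2 * (1 - s))"

end

theory Submission
  imports Defs
begin

text \<open>By density it suffices to treat a smooth function \<open>u\<close>. Two facts are combined.

  First, if \<open>u\<close> is replaced on a cube \<open>Q\<close> by the solution with the same boundary values, then
  the mean of the gradient is preserved and the energy decreases. Testing the variational definition of
  \<open>a\<^sub>*\<^sup>-\<^sup>1(Q)\<close> with multiples of this solution bounds the squared mean gradient of \<open>u\<close> on
  \<open>Q\<close> by \<open>\<bar>a\<^sub>*\<^sup>-\<^sup>1(Q)\<bar>\<close> times the mean energy of \<open>u\<close> on \<open>Q\<close>.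

  Second, oscillations are recovered from mean gradients over triadic cubes. A cube is trisected in one
  coordinate direction after another, and the mean of \<open>u\<close> over a box is replaced by the mean over its two
  faces orthogonal to the direction of the next trisection: the difference of these face means for two
  adjacent boxes is exactly half the side length times the sum of the mean partial derivatives over the two.
  The martingale differences so obtained, summed over all trisections down to the scale \<open>3\<^sup>k\<close>, define step
  functions which converge to \<open>u\<close> minus its mean. Passing to the next scale changes the step function by an
  amount whose \<open>L\<^sup>2\<close> norm is controlled, by orthogonality of martingale differences, by the mean gradients at
  that scale. For step functions on cubes of that size the inverse inequality from \<open>L\<^sup>2\<close> to \<open>L\<^sup>p\<close>
  costs the factor \<open>3\<close> to the power \<open>(n - k) d (1/2 - 1/p) = (n - k) (1 - s)\<close>; against the cube size
  \<open>3\<^sup>k\<close> this leaves the weight \<open>3\<close> to the power \<open>- s (n - k)\<close>, and the sum over \<open>k\<close> is the one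
  that defines \<open>\<lambda>\<^sub>s\<close>.\<close>

subsection \<open>Square roots of positive semi-definite matrices\<close>

text \<open>Plain averages over adjacent boxes would not do: their difference is an integral of the
  partial derivative against a tent-shaped weight, and the coarse-grained matrices control only
  unweighted means. Face means remove the weight at two prices. They depend on the direction, so
  every trisection takes its increment from the face means of its own direction. And the face mean
  of a box is not the average of those of its children; this defect is summed over all earlier
  trisections, and only orthogonality keeps the sum from growing with the number of scales.
  Gradients are a priori only in \<open>L^1\<close>, through the integrability of the inverse of
  \<open>a\<close>, so limits are controlled by an additive Cauchy-Schwarz inequality with a free
  parameter between \<open>L^1\<close> norm and energy. The constant is twice
  \<open>2 + 4 d 3^d\<close>; the factor \<open>2 / s\<close> comes from
  \<open>1 - 3 powr (-s) \<ge> s / 2\<close>. If the sum in \<open>lambda_s\<close> diverges and the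
  energy vanishes, the right-hand side is 0 by the convention \<open>\<infinity> * 0 = 0\<close>, so
  \<open>u\<close> must be shown to be constant; the \<open>L^1\<close> Poincare inequality on a
  cube serves this case alone.\<close>

lemma quadratic_nonneg_imp_zero:
  fixes b K :: real
  assumes "\<And>t. 2 * t * b \<le> t\<^sup>2 * K"
  shows "b = 0"
proof (rule ccontr)
  assume "b \<noteq> 0"
  \<comment> \<open>For \<open>t\<close> this small and of the sign of \<open>b\<close>, the linear
    term beats the quadratic one.\<close>
  define t where "t = b / (\<bar>K\<bar> + 1)"
  have "2 * t * b * (\<bar>K\<bar> + 1) = 2 * b\<^sup>2"
    by (simp add: t_def power2_eq_square divide_simps)
  moreover have "t\<^sup>2 * K * (\<bar>K\<bar> + 1) \<le> t\<^sup>2 * (\<bar>K\<bar> + 1) * (\<bar>K\<bar> + 1)"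
    by (intro mult_right_mono mult_left_mono) auto
  moreover have "t\<^sup>2 * (\<bar>K\<bar> + 1) * (\<bar>K\<bar> + 1) = b\<^sup>2"
    by (simp add: t_def power2_eq_square divide_simps)
  moreover have "2 * t * b * (\<bar>K\<bar> + 1) \<le> t\<^sup>2 * K * (\<bar>K\<bar> + 1)"
    by (intro mult_right_mono assms) auto
  ultimately have "2 * b\<^sup>2 \<le> b\<^sup>2" by linarith
  then show False using \<open>b \<noteq> 0\<close> by simp
qed

lemma inner_matrix_sym:
  fixes A :: "real^'n^'n"
  assumes "transpose A = A"
  shows "x \<bullet> (A *v y) = (A *v x) \<bullet> y"
  using dot_lmul_matrix[of x A y] assms transpose_matrix_vector[of A x] by simp

lemma transpose_eq_selfI:
  fixes A :: "real^'n^'n"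
  assumes "\<And>x y. x \<bullet> (A *v y) = (A *v x) \<bullet> y"
  shows "transpose A = A"
proof -
  have "A $ i $ j = A $ j $ i" for i j
    using assms[of "axis i 1" "axis j 1"]
    by (simp add: inner_axis inner_axis' matrix_vector_mul_component)
  then show ?thesis by (simp add: transpose_def vec_eq_iff)
qed

text \<open>A maximizer \<open>v\<close> of the quadratic form on the unit sphere of
  \<open>V\<close> is an eigenvector: moving it to \<open>v + t w\<close> with \<open>w\<close>
  orthogonal to \<open>v\<close> shows that \<open>A v\<close> is orthogonal to every such
  \<open>w\<close>, and \<open>A v - (v \<bullet> A v) v\<close> is one of them.\<close>

lemma symmetric_eigenvector_in_subspace:
  fixes A :: "real^'n^'n"
  assumes sym: "transpose A = A" and V: "subspace V" "V \<noteq> {0}"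
    and inv: "\<And>x. x \<in> V \<Longrightarrow> A *v x \<in> V"
  obtains v l where "v \<in> V" "norm v = 1" "A *v v = l *\<^sub>R v"
proof -
  let ?S = "V \<inter> sphere 0 1" and ?f = "\<lambda>v. v \<bullet> (A *v v)"
  have "compact ?S"
    using closed_Int_compact[OF closed_subspace[OF V(1)] compact_sphere] by blast
  moreover have "?S \<noteq> {}"
  proof -
    from V obtain x where "x \<in> V" "x \<noteq> 0" using subspace_0 by blast
    then have "x /\<^sub>R norm x \<in> ?S" using V(1) by (simp add: subspace_scale)
    then show ?thesis by blast
  qed
  moreover have "continuous_on ?S ?f"
    by (intro continuous_on_inner continuous_on_id linear_continuous_on matrix_vector_mul_bounded_linear)
  ultimately have "\<exists>v\<in>?S. \<forall>y\<in>?S. ?f y \<le> ?f v"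
    by (rule continuous_attains_sup)
  then obtain v where v: "v \<in> ?S" and max: "\<And>y. y \<in> ?S \<Longrightarrow> ?f y \<le> ?f v"
    by blast
  have vn: "norm v = 1" and vV: "v \<in> V" using v by auto
  then have vv: "v \<bullet> v = 1" by (simp add: norm_eq_1)
  have max': "?f y \<le> ?f v * (y \<bullet> y)" if "y \<in> V" for y
  proof (cases "y = 0")
    case False
    then have "y /\<^sub>R norm y \<in> ?S" using that V(1) by (simp add: subspace_scale)
    from max[OF this] have "?f y / (norm y)\<^sup>2 \<le> ?f v"
      by (simp add: matrix_vector_mult_scaleR power2_eq_square divide_simps)
    with False show ?thesis by (simp add: divide_simps power2_norm_eq_inner mult.commute split: if_splits)
  qed simp
  have orth: "w \<bullet> (A *v v) = 0" if "w \<in> V" "w \<bullet> v = 0" for w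
  proof (rule quadratic_nonneg_imp_zero)
    fix t :: real
    have "v + t *\<^sub>R w \<in> V" using vV that V(1) by (simp add: subspace_add subspace_scale)
    from max'[OF this] have "?f v + 2 * t * (w \<bullet> (A *v v)) + t\<^sup>2 * ?f w \<le> ?f v * (1 + t\<^sup>2 * (w \<bullet> w))"
      using that vv inner_matrix_sym[OF sym, of v w]
      by (simp add: matrix_vector_right_distrib matrix_vector_mult_scaleR inner_simps
            inner_commute power2_eq_square algebra_simps)
    then show "2 * t * (w \<bullet> (A *v v)) \<le> t\<^sup>2 * (?f v * (w \<bullet> w) - ?f w)"
      by (simp add: algebra_simps)
  qed
  define w where "w = A *v v - ?f v *\<^sub>R v"
  have "w \<in> V" using vV inv V(1) by (simp add: w_def subspace_diff subspace_scale)
  moreover have "w \<bullet> v = 0" using vv by (simp add: w_def inner_simps inner_commute)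
  ultimately have "w \<bullet> (A *v v) = 0" by (rule orth)
  with \<open>w \<bullet> v = 0\<close> have "w \<bullet> w = 0" by (simp add: w_def inner_simps)
  then have "A *v v = ?f v *\<^sub>R v" by (simp add: w_def)
  with that vV vn show thesis by blast
qed

text \<open>An orthonormal set of eigenvectors of largest cardinality spans the space: otherwise its
  orthogonal complement is nonzero and invariant under the symmetric matrix, and contains one more
  eigenvector.\<close>

lemma symmetric_orthonormal_eigenbasis:
  fixes A :: "real^'n^'n"
  assumes sym: "transpose A = A"
  obtains B where "finite B" "pairwise orthogonal B" "span B = UNIV" "\<And>b. b \<in> B \<Longrightarrow> norm b = 1"
    "\<And>b. b \<in> B \<Longrightarrow> \<exists>l. A *v b = l *\<^sub>R b"
proof -
  define P where "P = (\<lambda>B. pairwise orthogonal B \<and> (\<forall>b\<in>B. norm b = 1 \<and> (\<exists>l. A *v b = l *\<^sub>R b)))"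
  have ind: "independent B" if "P B" for B
    using that unfolding P_def by (intro pairwise_orthogonal_independent) auto
  have "\<exists>B. P B \<and> (\<forall>B'. P B' \<longrightarrow> card B' \<le> card B)"
  proof (rule ex_has_greatest_nat[of P "{}" card "Suc CARD('n)"])
    show "P {}" by (simp add: P_def)
    show "\<forall>B. P B \<longrightarrow> card B < Suc CARD('n)" using independent_bound[OF ind] by (auto simp: less_Suc_eq_le)
  qed
  then obtain B where B: "P B" and mx: "\<And>B'. P B' \<Longrightarrow> card B' \<le> card B" by blast
  have fin: "finite B" using ind[OF B] independent_bound by blast
  have "span B = UNIV"
  proof (rule ccontr)
    assume "span B \<noteq> UNIV"
    then have "dim B < DIM(real^'n)" using dim_eq_full nat_less_le dim_subset_UNIV by metis
    from orthogonal_to_subspace_exists[OF this] obtain x where x: "x \<noteq> 0"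
      "\<And>y. y \<in> span B \<Longrightarrow> orthogonal x y" by blast
    define V where "V = {x. \<forall>b\<in>B. orthogonal b x}"
    have "subspace V" by (auto simp: V_def subspace_def orthogonal_def inner_simps)
    moreover have "x \<in> V" using x(2) span_base by (auto simp: V_def orthogonal_commute)
    then have "V \<noteq> {0}" using x(1) by blast
    moreover have "A *v y \<in> V" if "y \<in> V" for y
      using that B by (fastforce simp: V_def P_def orthogonal_def inner_matrix_sym[OF sym])
    ultimately obtain v l where v: "v \<in> V" "norm v = 1" "A *v v = l *\<^sub>R v"
      using symmetric_eigenvector_in_subspace[OF sym] by metis
    have "v \<notin> B" using v by (auto simp: V_def orthogonal_def norm_eq_1)
    moreover have "P (insert v B)"
      using B v by (auto simp: P_def pairwise_insert V_def orthogonal_commute)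
    ultimately show False using mx[of "insert v B"] fin by simp
  qed
  with that B fin show thesis by (auto simp: P_def)
qed

text \<open>The root multiplies each eigenvector by the square root of its eigenvalue.\<close>

lemma psd_matrix_sqrt_exists:
  fixes A :: "real^'n^'n"
  assumes "psd_matrix A"
  shows "\<exists>S. psd_matrix S \<and> S ** S = A"
proof -
  have sym: "transpose A = A" and pos: "\<And>v. 0 \<le> v \<bullet> (A *v v)"
    using assms by (auto simp: psd_matrix_def)
  obtain B where B: "finite B" "pairwise orthogonal B" "span B = UNIV" "\<And>b. b \<in> B \<Longrightarrow> norm b = 1"
    and "\<And>b. b \<in> B \<Longrightarrow> \<exists>l. A *v b = l *\<^sub>R b"
    using symmetric_orthonormal_eigenbasis[OF sym] by blast
  then obtain l where l: "\<And>b. b \<in> B \<Longrightarrow> A *v b = l b *\<^sub>R b" by metis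
  have bb: "b \<bullet> b = 1" if "b \<in> B" for b using B(4)[OF that] by (simp add: norm_eq_1)
  have bb': "b \<bullet> b' = (if b = b' then 1 else 0)" if "b \<in> B" "b' \<in> B" for b b'
    using that bb B(2) by (auto simp: pairwise_def orthogonal_def)
  have lpos: "0 \<le> l b" if "b \<in> B" for b
    using pos[of b] l[OF that] bb[OF that] by simp
  have expand: "(\<Sum>b\<in>B. (b \<bullet> x) *\<^sub>R b) = x" for x
    using orthonormal_basis_expand[OF B(2) B(4), of x] B(1,3) by (simp add: inner_commute)
  define f where "f = (\<lambda>x::real^'n. \<Sum>b\<in>B. (sqrt (l b) * (b \<bullet> x)) *\<^sub>R b)"
  have lin: "linear f"
    by (rule linearI) (simp_all add: f_def inner_simps algebra_simps sum.distrib scaleR_sum_right)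
  define S where "S = matrix f"
  have S: "S *v x = f x" for x by (simp add: S_def lin)
  have bf: "b \<bullet> f x = sqrt (l b) * (b \<bullet> x)" if "b \<in> B" for b x
    using that B(1) by (simp add: f_def inner_sum_right bb' if_distrib sum.delta cong: if_cong)
  have "transpose S = S"
    by (rule transpose_eq_selfI)
       (simp add: S f_def inner_sum_right inner_sum_left inner_commute mult.assoc mult.left_commute mult.commute)
  moreover have "0 \<le> x \<bullet> (S *v x)" for x
  proof -
    have "x \<bullet> (S *v x) = (\<Sum>b\<in>B. sqrt (l b) * (b \<bullet> x)\<^sup>2)"
      by (simp add: S f_def inner_sum_right inner_commute power2_eq_square mult.assoc)
    also have "\<dots> \<ge> 0" using lpos by (intro sum_nonneg) auto
    finally show ?thesis .
  qed
  moreover have "S ** S = A"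
  proof -
    have "(S ** S) *v x = A *v x" for x
    proof -
      have "(S ** S) *v x = (\<Sum>b\<in>B. (b \<bullet> x) *\<^sub>R (l b *\<^sub>R b))"
        unfolding matrix_vector_mul_assoc[symmetric] S
        by (subst f_def, rule sum.cong) (auto simp: bf lpos)
      also have "\<dots> = (\<Sum>b\<in>B. A *v ((b \<bullet> x) *\<^sub>R b))"
        by (rule sum.cong) (auto simp: l matrix_vector_mult_scaleR)
      also have "\<dots> = A *v (\<Sum>b\<in>B. (b \<bullet> x) *\<^sub>R b)"
        by (simp add: linear_sum[OF matrix_vector_mul_linear])
      finally show ?thesis by (simp add: expand)
    qed
    then show ?thesis by (simp add: matrix_eq)
  qed
  ultimately show ?thesis by (auto simp: psd_matrix_def)
qed

text \<open>\<open>matrix_sqrt\<close> is a choice among all roots; every symmetric root gives the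
  same quadratic form, so the existence of one settles the matter.\<close>

lemma norm_matrix_sqrt_squared:
  fixes A :: "real^'n^'n"
  assumes "psd_matrix A"
  shows "(norm (matrix_sqrt A *v g))\<^sup>2 = g \<bullet> (A *v g)"
proof -
  have "psd_matrix (matrix_sqrt A) \<and> matrix_sqrt A ** matrix_sqrt A = A"
    unfolding matrix_sqrt_def using psd_matrix_sqrt_exists[OF assms] by (rule someI_ex)
  then show ?thesis
    by (metis inner_matrix_sym matrix_vector_mul_assoc power2_norm_eq_inner psd_matrix_def)
qed

lemma psd_matrix_energy_add:
  assumes "psd_matrix A"
  shows "(g + h) \<bullet> (A *v (g + h)) = g \<bullet> (A *v g) + 2 * (g \<bullet> (A *v h)) + h \<bullet> (A *v h)"
  using inner_matrix_sym[of A h g] assms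
  by (simp add: psd_matrix_def matrix_vector_right_distrib inner_simps inner_commute)

lemma psd_matrix_energy_scale:
  "(c *\<^sub>R g) \<bullet> (A *v (c *\<^sub>R g)) = c\<^sup>2 * (g \<bullet> (A *v g))" for A :: "real^'n^'n"
  by (simp add: matrix_vector_mult_scaleR power2_eq_square)

text \<open>Completing the square: the form of \<open>A\<close> is nonnegative at
  \<open>w - h\<close>, where \<open>A w = q\<close>.\<close>

lemma psd_matrix_energy_dual:
  fixes A :: "real^'n^'n"
  assumes "psd_matrix A" "invertible A"
  shows "2 * (q \<bullet> h) \<le> q \<bullet> (matrix_inv A *v q) + h \<bullet> (A *v h)"
proof -
  define w where "w = matrix_inv A *v q"
  have "A ** matrix_inv A = mat 1"
    using assms(2) unfolding invertible_def matrix_inv_def by (metis (mono_tags, lifting) someI_ex)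
  then have w: "A *v w = q" by (simp add: w_def matrix_vector_mul_assoc)
  have "0 \<le> (w + -1 *\<^sub>R h) \<bullet> (A *v (w + -1 *\<^sub>R h))" using assms(1) by (simp add: psd_matrix_def)
  also have "\<dots> = w \<bullet> q - 2 * (h \<bullet> (A *v w)) + h \<bullet> (A *v h)"
    unfolding psd_matrix_energy_add[OF assms(1)] psd_matrix_energy_scale
    using inner_matrix_sym[of A w h] assms(1)
    by (simp add: w psd_matrix_def matrix_vector_mult_scaleR[of A "-1", simplified] inner_commute)
  finally show ?thesis using w by (simp add: w_def inner_commute)
qed

lemma norm_matrix_vector_le:
  fixes A :: "real^'n^'m"
  shows "norm (A *v x) \<le> norm A * norm x"
proof -
  have "norm (A *v x) = L2_set (\<lambda>i. \<bar>(A $ i) \<bullet> x\<bar>) UNIV"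
    by (simp add: norm_vec_def matrix_vector_mul_component)
  also have "\<dots> \<le> L2_set (\<lambda>i. norm (A $ i) * norm x) UNIV"
    by (intro L2_set_mono Cauchy_Schwarz_ineq2) auto
  also have "\<dots> = norm A * norm x"
    by (simp add: norm_vec_def L2_set_left_distrib[symmetric])
  finally show ?thesis .
qed

text \<open>The dual inequality for \<open>sgn h\<close> and \<open>h / t\<close>, multiplied by
  \<open>t\<close>. The parameter stays free: after integration it takes the place of the
  optimization in the Cauchy-Schwarz inequality.\<close>

lemma norm_le_energy:
  fixes A :: "real^'n^'n"
  assumes "psd_matrix A" "invertible A" "t > 0"
  shows "2 * norm h \<le> t * norm (matrix_inv A) + (h \<bullet> (A *v h)) / t"
proof -
  define q where "q = sgn h"
  have q: "norm q \<le> 1" "q \<bullet> h = norm h"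
    by (cases "h = 0"; auto simp: q_def norm_sgn sgn_div_norm power2_norm_eq_inner[symmetric] power2_eq_square)+
  have "2 * (q \<bullet> ((1 / t) *\<^sub>R h)) \<le> q \<bullet> (matrix_inv A *v q) + ((1 / t) *\<^sub>R h) \<bullet> (A *v ((1 / t) *\<^sub>R h))"
    by (rule psd_matrix_energy_dual[OF assms(1,2)])
  also have "q \<bullet> (matrix_inv A *v q) \<le> norm q * (norm (matrix_inv A) * norm q)"
    by (rule order.trans[OF norm_cauchy_schwarz]) (intro mult_left_mono norm_matrix_vector_le, simp)
  also have "\<dots> \<le> norm (matrix_inv A)"
    using q(1) by (metis (no_types, opaque_lifting) mult.commute mult_left_le mult_le_one mult.left_commute norm_ge_zero)
  finally show ?thesis using assms(3) q(2)
    by (simp add: matrix_vector_mult_scaleR field_simps power2_eq_square)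
qed

subsection \<open>Smooth truncation of real values\<close>

text \<open>The scalar counterpart of \<open>times_differentiable\<close>, with the same recursion
  on the order, so that a scalar function can be composed with a smooth one by induction.\<close>

primrec real_times_differentiable :: "nat \<Rightarrow> (real \<Rightarrow> real) \<Rightarrow> bool" where
  "real_times_differentiable 0 f \<longleftrightarrow> continuous_on UNIV f"
| "real_times_differentiable (Suc k) f \<longleftrightarrow>
     (\<exists>f'. (\<forall>x. (f has_real_derivative f' x) (at x)) \<and> real_times_differentiable k f')"

lemma real_times_differentiable_Suc_imp:
  "real_times_differentiable (Suc k) f \<Longrightarrow> real_times_differentiable k f"
proof (induction k arbitrary: f)
  case 0
  then show ?case
    by (metis DERIV_isCont continuous_at_imp_continuous_on real_times_differentiable.simps)
next
  case (Suc k)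
  then obtain f' where "\<forall>x. (f has_real_derivative f' x) (at x)" "real_times_differentiable (Suc k) f'"
    using real_times_differentiable.simps(2)[of "Suc k" f] by blast
  with Suc.IH show ?case unfolding real_times_differentiable.simps(2)[of k f] by blast
qed

lemma real_times_differentiable_const: "real_times_differentiable k (\<lambda>x. c)"
proof (induction k arbitrary: c)
  case (Suc k)
  then show ?case by (auto intro!: exI[of _ "\<lambda>x. 0"])
qed auto

lemma real_times_differentiable_add:
  "real_times_differentiable k f \<Longrightarrow> real_times_differentiable k g \<Longrightarrow>
    real_times_differentiable k (\<lambda>x. f x + g x)"
proof (induction k arbitrary: f g)
  case (Suc k)
  then obtain f' g' where "\<forall>x. (f has_real_derivative f' x) (at x)" "real_times_differentiable k f'"
    "\<forall>x. (g has_real_derivative g' x) (at x)" "real_times_differentiable k g'" by auto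
  with Suc.IH show ?case
    by (auto intro!: exI[of _ "\<lambda>x. f' x + g' x"] derivative_intros)
qed (auto intro!: continuous_intros)

lemma real_times_differentiable_mult:
  "real_times_differentiable k f \<Longrightarrow> real_times_differentiable k g \<Longrightarrow>
    real_times_differentiable k (\<lambda>x. f x * g x)"
proof (induction k arbitrary: f g)
  case (Suc k)
  then obtain f' g' where *: "\<forall>x. (f has_real_derivative f' x) (at x)" "real_times_differentiable k f'"
    "\<forall>x. (g has_real_derivative g' x) (at x)" "real_times_differentiable k g'" by auto
  have "real_times_differentiable k f" "real_times_differentiable k g"
    using Suc.prems real_times_differentiable_Suc_imp by blast+
  then have "real_times_differentiable k (\<lambda>x. f' x * g x + g' x * f x)"
    using * Suc.IH by (intro real_times_differentiable_add) auto
  moreover have "((\<lambda>x. f x * g x) has_real_derivative f' x * g x + g' x * f x) (at x)" for x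
    using * by (intro DERIV_mult) auto
  ultimately show ?case
    by (auto intro!: exI[of _ "\<lambda>x. f' x * g x + g' x * f x"])
qed (auto intro!: continuous_intros)

lemma real_times_differentiable_inverse:
  "real_times_differentiable k f \<Longrightarrow> (\<And>x. f x \<noteq> 0) \<Longrightarrow>
    real_times_differentiable k (\<lambda>x. inverse (f x))"
proof (induction k arbitrary: f)
  case (Suc k)
  then obtain f' where *: "\<forall>x. (f has_real_derivative f' x) (at x)" "real_times_differentiable k f'"
    by auto
  have "real_times_differentiable k f"
    using Suc.prems real_times_differentiable_Suc_imp by blast
  then have "real_times_differentiable k (\<lambda>x. inverse (f x))" using Suc by blast
  then have "real_times_differentiable k (\<lambda>x. -1 * (inverse (f x) * f' x * inverse (f x)))"
    using * by (intro real_times_differentiable_mult real_times_differentiable_const) auto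
  moreover have "((\<lambda>x. inverse (f x)) has_real_derivative -1 * (inverse (f x) * f' x * inverse (f x))) (at x)" for x
    using DERIV_inverse'[of f "f' x" x UNIV] * Suc.prems by auto
  ultimately show ?case
    by (auto intro!: exI[of _ "\<lambda>x. -1 * (inverse (f x) * f' x * inverse (f x))"])
qed (auto intro!: continuous_intros)

lemma real_times_differentiable_compose_affine:
  "real_times_differentiable k f \<Longrightarrow> real_times_differentiable k (\<lambda>x. f (c + d * x))"
proof (induction k arbitrary: f)
  case 0
  then show ?case by (auto intro!: continuous_on_compose2[of UNIV f] continuous_intros)
next
  case (Suc k)
  then obtain f' where *: "\<forall>x. (f has_real_derivative f' x) (at x)" "real_times_differentiable k f'"
    by auto
  have "real_times_differentiable k (\<lambda>x. f' (c + d * x) * d)"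
    using * Suc.IH by (intro real_times_differentiable_mult real_times_differentiable_const) auto
  moreover have "((\<lambda>x. f (c + d * x)) has_real_derivative f' (c + d * x) * d) (at x)" for x
    using * by (auto intro!: DERIV_chain2[of f] derivative_eq_intros)
  ultimately show ?case by (auto intro!: exI[of _ "\<lambda>x. f' (c + d * x) * d"])
qed

text \<open>The classical functions \<open>p(1/t) exp(-1/t)\<close>, extended by zero. Over all
  polynomials they form a family closed under differentiation, so smoothness follows by one
  induction.\<close>

definition flat :: "real poly \<Rightarrow> real \<Rightarrow> real" where
  "flat P t = (if t > 0 then poly P (1 / t) * exp (- (1 / t)) else 0)"

text \<open>After the substitution \<open>x = 1 / t\<close> the exponential beats every
  polynomial.\<close>

lemma flat_tendsto_0: "(flat P \<longlongrightarrow> 0) (at 0)"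
proof -
  have "((\<lambda>x. \<Sum>i\<le>degree P. coeff P i * (x ^ i / exp x)) \<longlongrightarrow> (\<Sum>i\<le>degree P. coeff P i * 0)) (at_top :: real filter)"
    by (intro tendsto_sum tendsto_mult tendsto_const tendsto_power_div_exp_0)
  then have "((\<lambda>x. poly P x * exp (- x)) \<longlongrightarrow> 0) (at_top :: real filter)"
    by (simp add: poly_altdef sum_divide_distrib exp_minus field_simps)
  then have "((\<lambda>t. poly P (1 / t) * exp (- (1 / t))) \<longlongrightarrow> 0) (at_right (0::real))"
    by (rule filterlim_compose) (use filterlim_inverse_at_top_right in \<open>simp add: inverse_eq_divide\<close>)
  then have "(flat P \<longlongrightarrow> 0) (at_right 0)"
    by (rule Lim_transform_eventually)
       (simp add: flat_def eventually_at_filter)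
  moreover have "(flat P \<longlongrightarrow> 0) (at_left 0)"
    by (rule tendsto_eventually) (simp add: flat_def eventually_at_filter)
  ultimately show ?thesis by (rule filterlim_split_at[rotated])
qed

text \<open>Differentiation replaces the polynomial \<open>P\<close> by
  \<open>X\<^sup>2 (P - P')\<close>.\<close>

lemma flat_has_derivative:
  "(flat P has_real_derivative flat ([:0, 0, 1:] * (P - pderiv P)) t) (at t)"
proof -
  consider "t > 0" | "t < 0" | "t = 0" by linarith
  then show ?thesis
  proof cases
    case 1
    have "((\<lambda>t. poly P (1 / t) * exp (- (1 / t))) has_real_derivative
        flat ([:0, 0, 1:] * (P - pderiv P)) t) (at t)"
    proof -
      have inv: "((\<lambda>t. 1 / t) has_real_derivative - (1 / t\<^sup>2)) (at t)"
        using DERIV_inverse[of t UNIV] 1 by (simp add: inverse_eq_divide power2_eq_square)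
      note p = DERIV_chain2[OF poly_DERIV[of P "1 / t"] inv]
      note e = DERIV_chain2[OF DERIV_exp[of "- (1 / t)"] DERIV_minus[OF inv]]
      from DERIV_mult[OF p e]
      show ?thesis using 1 by (simp add: flat_def algebra_simps power2_eq_square)
    qed
    then show ?thesis
      by (rule has_field_derivative_transform_within_open[where S = "{0<..}"])
         (use 1 in \<open>auto simp: flat_def\<close>)
  next
    case 2
    have "((\<lambda>t. 0) has_real_derivative flat ([:0, 0, 1:] * (P - pderiv P)) t) (at t)"
      using 2 by (simp add: flat_def)
    then show ?thesis
      by (rule has_field_derivative_transform_within_open[where S = "{..<0}"])
         (use 2 in \<open>auto simp: flat_def\<close>)
  next
    case 3
    \<comment> \<open>The difference quotient of \<open>flat P\<close> at 0 is
      \<open>flat (X P)\<close>, which tends to 0 as well.\<close>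
    have "((\<lambda>h. (flat P (0 + h) - flat P 0) / h) \<longlongrightarrow> 0) (at 0)"
      by (rule Lim_transform_eventually[OF flat_tendsto_0[of "[:0, 1:] * P"]])
         (auto simp: flat_def eventually_at_filter)
    then show ?thesis using 3 by (simp add: DERIV_def flat_def)
  qed
qed

lemma real_times_differentiable_flat: "real_times_differentiable k (flat P)"
proof (induction k arbitrary: P)
  case 0
  then show ?case
    using flat_has_derivative by (auto intro!: continuous_at_imp_continuous_on DERIV_isCont)
next
  case (Suc k)
  then show ?case using flat_has_derivative by (auto simp del: mult_pCons_left)
qed

text \<open>The quotient \<open>f(x) / (f(x) + f(1 - x))\<close> with \<open>f = flat 1\<close>; its
  denominator is positive because \<open>x\<close> or \<open>1 - x\<close> is.\<close>

lemma smooth_step_exists: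
  obtains \<theta> :: "real \<Rightarrow> real" where "\<And>k. real_times_differentiable k \<theta>"
    "\<And>x. x \<le> 0 \<Longrightarrow> \<theta> x = 0" "\<And>x. 1 \<le> x \<Longrightarrow> \<theta> x = 1" "\<And>x. 0 \<le> \<theta> x" "\<And>x. \<theta> x \<le> 1"
proof
  define f where "f = flat 1"
  define d where "d = (\<lambda>x. f x + f (1 + (-1) * x))"
  have f0: "0 \<le> f x" for x by (simp add: f_def flat_def)
  have pos: "0 < d x" for x
  proof (cases "x > 0")
    case True then show ?thesis using f0[of "1 - x"] by (simp add: d_def f_def flat_def add_pos_nonneg)
  next
    case False then show ?thesis using f0[of x] by (simp add: d_def f_def flat_def)
  qed
  let ?\<theta> = "\<lambda>x. f x * inverse (d x)"
  show "real_times_differentiable k ?\<theta>" for k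
    unfolding d_def f_def using pos[unfolded d_def f_def]
    by (intro real_times_differentiable_mult real_times_differentiable_inverse
        real_times_differentiable_add real_times_differentiable_compose_affine
        real_times_differentiable_flat) (metis less_irrefl)
  show "x \<le> 0 \<Longrightarrow> ?\<theta> x = 0" for x by (simp add: f_def flat_def)
  show "1 \<le> x \<Longrightarrow> ?\<theta> x = 1" for x
    using pos[of x] by (simp add: d_def f_def flat_def)
  show "0 \<le> ?\<theta> x" for x using f0[of x] pos[of x] by simp
  show "?\<theta> x \<le> 1" for x
    using f0[of "1 - x"] pos[of x] by (simp add: d_def divide_inverse[symmetric])
qed

text \<open>Built from its derivative, a product of two smooth steps that is 1 on
  \<open>[-M, M]\<close> and 0 outside \<open>[-M - 1, M + 1]\<close>. The bounds
  \<open>0 \<le> T' \<le> 1\<close> are what makes truncation decrease the energy.\<close>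

lemma smooth_truncation_exists:
  fixes M :: real
  assumes "0 \<le> M"
  obtains T T' :: "real \<Rightarrow> real" where "\<And>k. real_times_differentiable k T'"
    "\<And>x. (T has_real_derivative T' x) (at x)"
    "\<And>x. \<bar>x\<bar> \<le> M \<Longrightarrow> T x = x" "\<And>x. \<bar>x\<bar> \<le> M \<Longrightarrow> T' x = 1" "\<And>x. 0 \<le> T' x" "\<And>x. T' x \<le> 1" "\<And>x. \<bar>T x\<bar> \<le> M + 1"
proof -
  obtain \<theta> :: "real \<Rightarrow> real" where \<theta>: "\<And>k. real_times_differentiable k \<theta>"
    "\<And>x. x \<le> 0 \<Longrightarrow> \<theta> x = 0" "\<And>x. 1 \<le> x \<Longrightarrow> \<theta> x = 1" "\<And>x. 0 \<le> \<theta> x" "\<And>x. \<theta> x \<le> 1"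
    using smooth_step_exists by blast
  define T' where "T' = (\<lambda>x. \<theta> ((M + 1) + (-1) * x) * \<theta> ((M + 1) + 1 * x))"
  have sm: "real_times_differentiable k T'" for k
    unfolding T'_def
    by (intro real_times_differentiable_mult real_times_differentiable_compose_affine \<theta>)
  then have "continuous_on UNIV T'" using real_times_differentiable.simps(1) by blast
  have T'01: "0 \<le> T' x" "T' x \<le> 1" for x
    using \<theta>(4,5) by (auto simp: T'_def intro: mult_le_one)
  have T'1: "T' x = 1" if "\<bar>x\<bar> \<le> M" for x using that \<theta>(3) by (simp add: T'_def)
  have T'0: "T' x = 0" if "\<bar>x\<bar> \<ge> M + 1" for x using that \<theta>(2) by (auto simp: T'_def abs_if split: if_splits)
  define T where "T = (\<lambda>x. if 0 \<le> x then integral {0..x} T' else - integral {x..0} T')"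
  have cont: "continuous_on S T'" for S
    using \<open>continuous_on UNIV T'\<close> continuous_on_subset by blast
  have T: "(T has_real_derivative T' x) (at x)" for x
  proof -
    \<comment> \<open>Near \<open>x\<close> the two-sided definition of \<open>T\<close> agrees, up
      to a constant, with an integral from one fixed left endpoint, to which the fundamental theorem
      applies.\<close>
    define a where "a = min x 0 - 1"
    define b where "b = max x 0 + 1"
    have "((\<lambda>u. integral {a..u} T') has_real_derivative T' x) (at x within {a..b})"
      by (rule integral_has_real_derivative[OF cont]) (auto simp: a_def b_def)
    then have "((\<lambda>u. integral {a..u} T') has_real_derivative T' x) (at x)"
      by (subst (asm) at_within_interior) (auto simp: a_def b_def)
    then have "((\<lambda>u. integral {a..u} T' - integral {a..0} T') has_real_derivative T' x) (at x)"
      by (auto intro!: derivative_eq_intros)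
    moreover have "\<forall>\<^sub>F u in nhds x. T u = integral {a..u} T' - integral {a..0} T'"
    proof -
      have "T u = integral {a..u} T' - integral {a..0} T'" if "dist u x < 1" for u
      proof (cases "0 \<le> u")
        case True
        have "a \<le> 0" by (simp add: a_def)
        with True show ?thesis
          using Henstock_Kurzweil_Integration.integral_combine[of a 0 u T'] cont
          by (simp add: T_def integrable_continuous_interval)
      next
        case False
        then have "a \<le> u" using that by (auto simp: a_def dist_real_def)
        with False show ?thesis
          using Henstock_Kurzweil_Integration.integral_combine[of a u 0 T'] cont
          by (simp add: T_def integrable_continuous_interval)
      qed
      then show ?thesis unfolding eventually_nhds_metric by (intro exI[of _ 1]) auto
    qed
    ultimately show ?thesis
      using DERIV_cong_ev[of x x T "\<lambda>u. integral {a..u} T' - integral {a..0} T'" "T' x" "T' x"] by auto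
  qed
  have T0: "T 0 = 0" by (simp add: T_def)
  have Tid: "T x = x" if "\<bar>x\<bar> \<le> M" for x
  proof (cases "x = 0")
    case False
    have "\<exists>z. min x 0 < z \<and> z < max x 0 \<and>
        (T (max x 0) - max x 0) - (T (min x 0) - min x 0) = (max x 0 - min x 0) * (T' z - 1)"
      by (rule MVT2) (use False T in \<open>auto intro!: derivative_eq_intros\<close>)
    then obtain z where "min x 0 < z" "z < max x 0"
      "(T (max x 0) - max x 0) - (T (min x 0) - min x 0) = (max x 0 - min x 0) * (T' z - 1)" by blast
    moreover from this have "T' z = 1" using that by (intro T'1) (auto simp: min_def max_def split: if_splits)
    ultimately show ?thesis using T0 by (auto simp: min_def max_def split: if_splits)
  qed (simp add: T0)
  have lip: "\<bar>T x\<bar> \<le> \<bar>x\<bar>" for x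
  proof (cases "x = 0")
    case False
    have "\<exists>z. min x 0 < z \<and> z < max x 0 \<and>
        T (max x 0) - T (min x 0) = (max x 0 - min x 0) * T' z"
      by (rule MVT2) (use False T in \<open>auto intro!: derivative_eq_intros\<close>)
    then obtain z where "T (max x 0) - T (min x 0) = (max x 0 - min x 0) * T' z" by blast
    then have "\<bar>T x\<bar> = \<bar>x\<bar> * T' z" using T0 T'01[of z] by (auto simp: min_def max_def split: if_splits) (simp add: abs_mult)?
    then show ?thesis using T'01[of z] by (simp add: mult_left_le)
  qed (simp add: T0)
  have const: "T x = T y" if "M + 1 \<le> x \<and> M + 1 \<le> y \<or> x \<le> -(M+1) \<and> y \<le> -(M+1)" for x y
  proof (cases "x = y")
    case False
    have "\<exists>z. min x y < z \<and> z < max x y \<and>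
        T (max x y) - T (min x y) = (max x y - min x y) * T' z"
      by (rule MVT2) (use False T in \<open>auto intro!: derivative_eq_intros\<close>)
    then obtain z where z: "min x y < z" "z < max x y" "T (max x y) - T (min x y) = (max x y - min x y) * T' z" by blast
    then have "T' z = 0" using that by (intro T'0) auto
    with z show ?thesis by (auto simp: min_def max_def split: if_splits)
  qed simp
  have "\<bar>T x\<bar> \<le> M + 1" for x
  proof -
    consider "\<bar>x\<bar> \<le> M + 1" | "M + 1 \<le> x" | "x \<le> -(M + 1)" by linarith
    then show ?thesis
    proof cases
      case 1 then show ?thesis using lip[of x] by linarith
    next
      case 2 then show ?thesis using lip[of "M + 1"] const[of x "M + 1"] assms by simp
    next
      case 3 then show ?thesis using lip[of "-(M + 1)"] const[of x "-(M + 1)"] assms by simp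
    qed
  qed
  then show thesis using that[OF sm T Tid T'1 T'01] by blast
qed

subsection \<open>Calculus of smooth functions\<close>

lemma partial_deriv_eq: "(f has_derivative D) (at x) \<Longrightarrow> partial_deriv i f x = D (axis i 1)"
  unfolding partial_deriv_def by (metis frechet_derivative_at)

lemma partial_deriv_const: "partial_deriv i (\<lambda>x. c) = (\<lambda>x. 0)"
  by (rule ext, subst partial_deriv_eq[of _ "\<lambda>x. 0"]) auto

lemma partial_deriv_add:
  "f differentiable (at x) \<Longrightarrow> g differentiable (at x) \<Longrightarrow>
    partial_deriv i (\<lambda>x. f x + g x) x = partial_deriv i f x + partial_deriv i g x"
  unfolding differentiable_def
  by (auto simp: partial_deriv_eq intro!: partial_deriv_eq[THEN trans] derivative_intros)

lemma partial_deriv_mult: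
  "f differentiable (at x) \<Longrightarrow> g differentiable (at x) \<Longrightarrow>
    partial_deriv i (\<lambda>x. f x * g x) x = f x * partial_deriv i g x + partial_deriv i f x * g x"
  unfolding differentiable_def
  by (auto simp: partial_deriv_eq intro!: partial_deriv_eq[THEN trans] has_derivative_mult)

lemma partial_deriv_compose_real:
  assumes "(T has_real_derivative T') (at (f x))" "f differentiable (at x)"
  shows "(\<lambda>x. T (f x)) differentiable (at x)" "partial_deriv i (\<lambda>x. T (f x)) x = T' * partial_deriv i f x"
proof -
  obtain D where D: "(f has_derivative D) (at x)" using assms(2) by (auto simp: differentiable_def)
  have "((\<lambda>x. T (f x)) has_derivative (\<lambda>h. T' * D h)) (at x)"
    using has_derivative_compose[OF D assms(1)[unfolded has_field_derivative_def]] by simp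
  then show "(\<lambda>x. T (f x)) differentiable (at x)" "partial_deriv i (\<lambda>x. T (f x)) x = T' * partial_deriv i f x"
    using D by (auto simp: differentiable_def partial_deriv_eq)
qed

lemma times_differentiable_Suc_imp: "times_differentiable (Suc k) f \<Longrightarrow> times_differentiable k f"
proof (induction k arbitrary: f)
  case 0
  then show ?case
    by (auto intro!: continuous_at_imp_continuous_on differentiable_imp_continuous_within)
next
  case (Suc k)
  then show ?case by simp
qed

lemma times_differentiable_const: "times_differentiable k (\<lambda>x. c)"
  by (induction k arbitrary: c) (auto simp: partial_deriv_const)

lemma times_differentiable_add:
  "times_differentiable k f \<Longrightarrow> times_differentiable k g \<Longrightarrow> times_differentiable k (\<lambda>x. f x + g x)"
proof (induction k arbitrary: f g)
  case (Suc k)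
  then have "partial_deriv i (\<lambda>x. f x + g x) = (\<lambda>x. partial_deriv i f x + partial_deriv i g x)" for i
    by (auto simp: partial_deriv_add)
  with Suc show ?case by auto
qed (auto intro!: continuous_intros)

lemma times_differentiable_mult:
  "times_differentiable k f \<Longrightarrow> times_differentiable k g \<Longrightarrow> times_differentiable k (\<lambda>x. f x * g x)"
proof (induction k arbitrary: f g)
  case (Suc k)
  then have "partial_deriv i (\<lambda>x. f x * g x) = (\<lambda>x. f x * partial_deriv i g x + partial_deriv i f x * g x)" for i
    by (auto simp: partial_deriv_mult)
  moreover have "times_differentiable k f" "times_differentiable k g"
    using Suc.prems times_differentiable_Suc_imp by blast+
  ultimately show ?case using Suc by (auto intro!: times_differentiable_add)
qed (auto intro!: continuous_intros)

lemma times_differentiable_compose_real: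
  "real_times_differentiable k T \<Longrightarrow> times_differentiable k f \<Longrightarrow> times_differentiable k (\<lambda>x. T (f x))"
proof (induction k arbitrary: T)
  case 0
  then show ?case by (auto intro!: continuous_on_compose2[of UNIV T])
next
  case (Suc k)
  then obtain T' where T': "\<And>x. (T has_real_derivative T' x) (at x)" "real_times_differentiable k T'"
    by auto
  have "partial_deriv i (\<lambda>x. T (f x)) = (\<lambda>x. T' (f x) * partial_deriv i f x)" for i
    using Suc.prems(2) by (auto simp: partial_deriv_compose_real(2)[OF T'(1)])
  moreover have "times_differentiable k f" using Suc.prems(2) times_differentiable_Suc_imp by blast
  moreover have "(\<lambda>x. T (f x)) differentiable (at x)" for x
    by (rule partial_deriv_compose_real(1)[OF T'(1)]) (use Suc.prems(2) in simp)
  ultimately show ?case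
    using Suc.IH[OF T'(2)] Suc.prems(2) by (auto intro!: times_differentiable_mult)
qed

lemma smooth_const: "smooth (\<lambda>x. c)"
  by (simp add: smooth_def times_differentiable_const)

lemma smooth_add: "smooth f \<Longrightarrow> smooth g \<Longrightarrow> smooth (\<lambda>x. f x + g x)"
  by (simp add: smooth_def times_differentiable_add)

lemma smooth_mult: "smooth f \<Longrightarrow> smooth g \<Longrightarrow> smooth (\<lambda>x. f x * g x)"
  by (simp add: smooth_def times_differentiable_mult)

lemma smooth_cmult: "smooth f \<Longrightarrow> smooth (\<lambda>x. c * f x)"
  by (intro smooth_mult smooth_const)

lemma smooth_diff: "smooth f \<Longrightarrow> smooth g \<Longrightarrow> smooth (\<lambda>x. f x - g x)"
  using smooth_add[OF _ smooth_cmult[of g "-1"]] by simp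

lemma smooth_differentiable: "smooth f \<Longrightarrow> f differentiable (at x)"
  unfolding smooth_def by (metis times_differentiable.simps(2))

lemma smooth_continuous: "smooth f \<Longrightarrow> continuous_on S f"
  unfolding smooth_def by (metis continuous_on_subset subset_UNIV times_differentiable.simps(1))

lemma smooth_partial_deriv: "smooth f \<Longrightarrow> smooth (partial_deriv i f)"
  unfolding smooth_def by (metis times_differentiable.simps(2))

lemma grad_component: "grad f x $ i = partial_deriv i f x"
  by (simp add: grad_def)

lemma smooth_continuous_grad: "smooth f \<Longrightarrow> continuous_on S (grad f)"
  unfolding grad_def by (intro continuous_on_vec_lambda smooth_continuous smooth_partial_deriv)

lemma smooth_has_derivative:
  assumes "smooth f"
  shows "(f has_derivative (\<lambda>h. grad f x \<bullet> h)) (at x)"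
proof -
  obtain D where D: "(f has_derivative D) (at x)"
    using smooth_differentiable[OF assms] by (auto simp: differentiable_def)
  have "D h = grad f x \<bullet> h" for h
  proof -
    have lin: "linear D" using D has_derivative_linear by blast
    have "D h = D (\<Sum>i\<in>UNIV. h $ i *\<^sub>R axis i 1)"
      by (simp add: basis_expansion scalar_mult_eq_scaleR[symmetric])
    also have "\<dots> = (\<Sum>i\<in>UNIV. h $ i * D (axis i 1))"
      by (simp add: linear_sum[OF lin] linear_cmul[OF lin])
    also have "\<dots> = grad f x \<bullet> h"
      by (simp add: inner_vec_def grad_def partial_deriv_eq[OF D] mult.commute)
    finally show ?thesis .
  qed
  then have "D = (\<lambda>h. grad f x \<bullet> h)" by auto
  with D show ?thesis by simp
qed

lemma grad_add:
  "smooth f \<Longrightarrow> smooth g \<Longrightarrow> grad (\<lambda>x. f x + g x) x = grad f x + grad g x"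
  by (simp add: grad_def vec_eq_iff partial_deriv_add smooth_differentiable)

lemma grad_cmult: "smooth f \<Longrightarrow> grad (\<lambda>x. c * f x) x = c *\<^sub>R grad f x"
  by (simp add: grad_def vec_eq_iff partial_deriv_mult partial_deriv_const smooth_differentiable)

lemma grad_diff:
  "smooth f \<Longrightarrow> smooth g \<Longrightarrow> grad (\<lambda>x. f x - g x) x = grad f x - grad g x"
  using grad_add[OF _ smooth_cmult[of g "-1"]] grad_cmult[of g "-1"] by simp

lemma test_function_lincomb:
  assumes "test_function U f" "test_function U g"
  shows "test_function U (\<lambda>x. c * f x + d * g x)"
proof -
  have "{x. c * f x + d * g x \<noteq> 0} \<subseteq> {x. f x \<noteq> 0} \<union> {x. g x \<noteq> 0}" by auto
  also have "\<dots> \<subseteq> closure {x. f x \<noteq> 0} \<union> closure {x. g x \<noteq> 0}"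
    by (intro Un_mono closure_subset)
  finally have supp: "closure {x. c * f x + d * g x \<noteq> 0} \<subseteq> closure {x. f x \<noteq> 0} \<union> closure {x. g x \<noteq> 0}"
    by (intro closure_minimal) auto
  have f: "smooth f" "compact (closure {x. f x \<noteq> 0})" "closure {x. f x \<noteq> 0} \<subseteq> U"
    and g: "smooth g" "compact (closure {x. g x \<noteq> 0})" "closure {x. g x \<noteq> 0} \<subseteq> U"
    using assms by (simp_all add: test_function_def)
  have "compact ((closure {x. f x \<noteq> 0} \<union> closure {x. g x \<noteq> 0}) \<inter> closure {x. c * f x + d * g x \<noteq> 0})"
    using f g by (intro compact_Int_closed compact_Un closed_closure)
  then have "compact (closure {x. c * f x + d * g x \<noteq> 0})" using supp by (simp add: inf.absorb2)
  moreover have "closure {x. c * f x + d * g x \<noteq> 0} \<subseteq> U" using supp f g by blast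
  moreover have "smooth (\<lambda>x. c * f x + d * g x)" using f g by (intro smooth_add smooth_cmult)
  ultimately show ?thesis by (simp add: test_function_def)
qed

lemma test_function_zero: "test_function U (\<lambda>x. 0)"
  by (simp add: test_function_def smooth_const)

lemma smooth_compose_real:
  "(\<And>k. real_times_differentiable k T) \<Longrightarrow> smooth f \<Longrightarrow> smooth (\<lambda>x. T (f x))"
  by (simp add: smooth_def times_differentiable_compose_real)

lemma grad_compose_real:
  assumes "(T has_real_derivative T') (at (f x))" "smooth f"
  shows "grad (\<lambda>x. T (f x)) x = T' *\<^sub>R grad f x"
  using partial_deriv_compose_real(2)[of T T' f x] assms smooth_differentiable[of f x]
  by (simp add: grad_def vec_eq_iff)

text \<open>The difference vanishes wherever \<open>\<psi>\<close> does. Truncating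
  \<open>\<phi> + \<psi>\<close> and \<open>\<phi>\<close> alike thus keeps the boundary
  values.\<close>

lemma test_function_compose_diff:
  assumes "\<And>k. real_times_differentiable k T" "smooth \<phi>" "test_function U \<psi>"
  shows "test_function U (\<lambda>x. T (\<phi> x + \<psi> x) - T (\<phi> x))"
proof -
  have \<psi>: "smooth \<psi>" "compact (closure {x. \<psi> x \<noteq> 0})" "closure {x. \<psi> x \<noteq> 0} \<subseteq> U"
    using assms(3) by (simp_all add: test_function_def)
  have supp: "closure {x. T (\<phi> x + \<psi> x) - T (\<phi> x) \<noteq> 0} \<subseteq> closure {x. \<psi> x \<noteq> 0}"
    by (intro closure_mono) auto
  have "compact (closure {x. \<psi> x \<noteq> 0} \<inter> closure {x. T (\<phi> x + \<psi> x) - T (\<phi> x) \<noteq> 0})"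
    using \<psi> by (intro compact_Int_closed closed_closure)
  then have "compact (closure {x. T (\<phi> x + \<psi> x) - T (\<phi> x) \<noteq> 0})"
    using supp by (simp add: inf.absorb2)
  moreover have "closure {x. T (\<phi> x + \<psi> x) - T (\<phi> x) \<noteq> 0} \<subseteq> U" using supp \<psi> by blast
  moreover have "smooth (\<lambda>x. T (\<phi> x + \<psi> x) - T (\<phi> x))"
    by (rule smooth_diff[OF smooth_compose_real[OF assms(1) smooth_add[OF assms(2) \<psi>(1)]]
          smooth_compose_real[OF assms(1,2)]])
  ultimately show ?thesis by (simp add: test_function_def)
qed

subsection \<open>Means over triadic digits and a martingale transform\<close>

text \<open>A word of digits in \<open>{-1, 0, 1}\<close> encodes a descendant box after successive trisections, the
  \<open>i\<close>-th of them in the coordinate direction given by the \<open>i\<close>-th entry of the first argument.\<close>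

primrec dmean :: "'e list \<Rightarrow> (int list \<Rightarrow> real) \<Rightarrow> real" where
  "dmean [] h = h []"
| "dmean (e # es) h =
     (dmean es (\<lambda>xs. h (-1 # xs)) + dmean es (\<lambda>xs. h (0 # xs)) + dmean es (\<lambda>xs. h (1 # xs))) / 3"

definition digits :: "nat \<Rightarrow> int list set" where
  "digits n = {ds. length ds = n \<and> set ds \<subseteq> {-1, 0, 1}}"

lemma digits_0: "digits 0 = {[]}"
  by (auto simp: digits_def)

lemma digits_Cons: "d # ds \<in> digits (Suc n) \<longleftrightarrow> d \<in> {-1, 0, 1} \<and> ds \<in> digits n"
  by (auto simp: digits_def)

lemma digits_SucE:
  assumes "ds \<in> digits (Suc n)"
  obtains d xs where "ds = d # xs" "d \<in> {-1, 0, 1}" "xs \<in> digits n"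
  using assms by (cases ds) (auto simp: digits_def)

lemma dmean_mono:
  "(\<And>ds. ds \<in> digits (length es) \<Longrightarrow> f ds \<le> g ds) \<Longrightarrow> dmean es f \<le> dmean es g"
proof (induction es arbitrary: f g)
  case (Cons e es)
  have "dmean es (\<lambda>xs. f (d # xs)) \<le> dmean es (\<lambda>xs. g (d # xs))" if "d \<in> {-1, 0, 1}" for d
    using that Cons by (simp add: digits_Cons)
  then have "dmean es (\<lambda>xs. f (-1 # xs)) \<le> dmean es (\<lambda>xs. g (-1 # xs))"
    "dmean es (\<lambda>xs. f (0 # xs)) \<le> dmean es (\<lambda>xs. g (0 # xs))"
    "dmean es (\<lambda>xs. f (1 # xs)) \<le> dmean es (\<lambda>xs. g (1 # xs))" by simp_all
  then show ?case by simp
qed (auto simp: digits_0)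

lemma dmean_cong:
  "(\<And>ds. ds \<in> digits (length es) \<Longrightarrow> f ds = g ds) \<Longrightarrow> dmean es f = dmean es g"
  by (intro antisym dmean_mono) auto

lemma dmean_const [simp]: "dmean es (\<lambda>_. c) = c"
  by (induction es) auto

lemma dmean_add: "dmean es (\<lambda>ds. f ds + g ds) = dmean es f + dmean es g"
  by (induction es arbitrary: f g) (auto simp: field_simps)

lemma dmean_cmult: "dmean es (\<lambda>ds. c * f ds) = c * dmean es f"
  by (induction es arbitrary: f) (auto simp: field_simps)

lemma dmean_diff: "dmean es (\<lambda>ds. f ds - g ds) = dmean es f - dmean es g"
  using dmean_add[of es f "\<lambda>ds. -1 * g ds"] dmean_cmult[of es "-1" g] by simp

lemma dmean_sum: "dmean es (\<lambda>ds. \<Sum>i\<in>I. f i ds) = (\<Sum>i\<in>I. dmean es (f i))"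
  by (induction I rule: infinite_finite_induct) (auto simp: dmean_add)

lemma dmean_nonneg: "(\<And>ds. ds \<in> digits (length es) \<Longrightarrow> 0 \<le> f ds) \<Longrightarrow> 0 \<le> dmean es f"
  using dmean_mono[of es "\<lambda>_. 0" f] by simp

lemma dmean_abs: "\<bar>dmean es f\<bar> \<le> dmean es (\<lambda>ds. \<bar>f ds\<bar>)"
proof -
  have "dmean es f \<le> dmean es (\<lambda>ds. \<bar>f ds\<bar>)" "dmean es (\<lambda>ds. - \<bar>f ds\<bar>) \<le> dmean es f"
    by (intro dmean_mono; simp)+
  then show ?thesis using dmean_cmult[of es "-1" "\<lambda>ds. \<bar>f ds\<bar>"] by simp
qed

lemma dmean_append:
  "dmean (es @ fs) f = dmean es (\<lambda>ds. dmean fs (\<lambda>xs. f (ds @ xs)))"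
  by (induction es arbitrary: f) auto

text \<open>A nonnegative term is at most the sum of all \<open>3 ^ length es\<close> terms. This
  elementary bound is the source of the inverse inequalities below.\<close>

lemma le_dmean:
  "ds \<in> digits (length es) \<Longrightarrow> (\<And>ds. ds \<in> digits (length es) \<Longrightarrow> 0 \<le> f ds) \<Longrightarrow>
    f ds \<le> 3 ^ length es * dmean es f"
proof (induction es arbitrary: f ds)
  case (Cons e es)
  from Cons.prems(1) obtain d xs where d: "ds = d # xs" "d \<in> {-1, 0, 1}" "xs \<in> digits (length es)"
    by (auto elim: digits_SucE)
  have pos: "0 \<le> dmean es (\<lambda>xs. f (d # xs))" if "d \<in> {-1, 0, 1}" for d
    using that Cons.prems(2) by (intro dmean_nonneg) (auto simp: digits_Cons)
  have "f ds \<le> 3 ^ length es * dmean es (\<lambda>xs. f (d # xs))"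
    using Cons.IH[OF d(3), of "\<lambda>xs. f (d # xs)"] d Cons.prems(2) by (auto simp: digits_Cons)
  also have "\<dots> \<le> 3 ^ length es * (3 * dmean (e # es) f)"
    using d(2) pos[of "-1"] pos[of 0] pos[of 1] by (intro mult_left_mono) auto
  finally show ?case by (simp del: dmean.simps add: ac_simps)
qed (simp add: digits_0)

text \<open>The variance is nonnegative.\<close>

lemma dmean_square_le: "(dmean es f)\<^sup>2 \<le> dmean es (\<lambda>ds. (f ds)\<^sup>2)"
proof -
  define m where "m = dmean es f"
  have "0 \<le> dmean es (\<lambda>ds. (f ds - m)\<^sup>2)" by (intro dmean_nonneg) simp
  also have "(\<lambda>ds. (f ds - m)\<^sup>2) = (\<lambda>ds. (f ds)\<^sup>2 + ((- 2 * m) * f ds + m\<^sup>2))"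
    by (auto simp: power2_eq_square algebra_simps)
  also have "dmean es \<dots> = dmean es (\<lambda>ds. (f ds)\<^sup>2) + ((- 2 * m) * m + m\<^sup>2)"
    by (simp only: dmean_add dmean_cmult dmean_const m_def)
  finally show ?thesis by (simp add: m_def power2_eq_square)
qed

text \<open>The increments of the martingale of \<open>h e\<close> at the trisections in direction \<open>e\<close>, summed over all
  trisections.\<close>

primrec mtrans :: "'e list \<Rightarrow> ('e \<Rightarrow> int list \<Rightarrow> real) \<Rightarrow> int list \<Rightarrow> real" where
  "mtrans [] h ds = 0"
| "mtrans (e # es) h ds =
     (dmean es (\<lambda>xs. h e (hd ds # xs)) - dmean (e # es) (h e)) +
     mtrans es (\<lambda>e' xs. h e' (hd ds # xs)) (tl ds)"

text \<open>With the same function in every direction the increments telescope.\<close>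

lemma mtrans_same: "length ds = length es \<Longrightarrow> mtrans es (\<lambda>_. p) ds = p ds - dmean es p"
proof (induction es arbitrary: p ds)
  case (Cons e es)
  then obtain d xs where "ds = d # xs" "length xs = length es" by (cases ds) auto
  with Cons.IH[of xs "\<lambda>xs. p (d # xs)"] show ?case by simp
qed simp

text \<open>The earlier trisections see the later digits only through an average, and the later ones
  act inside the box given by the earlier digits. With one round of trisections as \<open>fs\<close>
  this separates the newest scale from all coarser ones.\<close>

lemma mtrans_append:
  "length ds = length es \<Longrightarrow> mtrans (es @ fs) h (ds @ ys) =
    mtrans es (\<lambda>e xs. dmean fs (\<lambda>zs. h e (xs @ zs))) ds + mtrans fs (\<lambda>e zs. h e (ds @ zs)) ys"
proof (induction es arbitrary: h ds)
  case (Cons e es)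
  then obtain d xs where "ds = d # xs" "length xs = length es" by (cases ds) auto
  with Cons.IH[of xs "\<lambda>e' xs. h e' (d # xs)"] show ?case by (simp add: dmean_append)
qed simp

lemma mtrans_diff: "mtrans es (\<lambda>e ds. h e ds - k e ds) ds = mtrans es h ds - mtrans es k ds"
proof (induction es arbitrary: h k ds)
  case (Cons e es)
  show ?case
    using Cons.IH[of "\<lambda>e' xs. h e' (hd ds # xs)" "\<lambda>e' xs. k e' (hd ds # xs)" "tl ds"]
    by (simp add: dmean_diff diff_divide_distrib add_divide_distrib)
qed simp

lemma mtrans_cong:
  "(\<And>e ds. ds \<in> digits (length es) \<Longrightarrow> h e ds = k e ds) \<Longrightarrow> ds \<in> digits (length es) \<Longrightarrow>
    mtrans es h ds = mtrans es k ds"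
proof (induction es arbitrary: h k ds)
  case (Cons e es)
  from Cons.prems(2) obtain d xs where d: "ds = d # xs" "d \<in> {-1, 0, 1}" "xs \<in> digits (length es)"
    by (auto elim: digits_SucE)
  have "dmean es (\<lambda>xs. h e (d # xs)) = dmean es (\<lambda>xs. k e (d # xs))"
    using d Cons.prems(1) by (intro dmean_cong) (auto simp: digits_Cons)
  moreover have "dmean (e # es) (h e) = dmean (e # es) (k e)"
    using Cons.prems(1) by (intro dmean_cong) auto
  moreover have "mtrans es (\<lambda>e' xs. h e' (d # xs)) xs = mtrans es (\<lambda>e' xs. k e' (d # xs)) xs"
    using d Cons.prems(1) by (intro Cons.IH) (auto simp: digits_Cons)
  ultimately show ?case using d by simp
qed simp

lemma dmean_mtrans: "dmean es (mtrans es h) = 0"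
  by (induction es arbitrary: h) (auto simp: dmean_add dmean_diff add_divide_distrib diff_divide_distrib)

text \<open>Each increment has mean zero given the earlier digits, so the squares add up. The
  increment at a trisection in direction \<open>e\<close> belongs to the martingale of
  \<open>h e\<close>, whose squared increments sum to the variance of \<open>h e\<close>; the
  right-hand side collects these variances. The number of trisections does not appear.\<close>

lemma dmean_mtrans_square:
  fixes h :: "'e::finite \<Rightarrow> int list \<Rightarrow> real"
  shows "dmean es (\<lambda>ds. (mtrans es h ds)\<^sup>2) \<le>
    (\<Sum>e\<in>UNIV. dmean es (\<lambda>ds. (h e ds)\<^sup>2) - (dmean es (h e))\<^sup>2)"
proof (induction es arbitrary: h)
  case (Cons e es)
  define m where "m = (\<lambda>e' d. dmean es (\<lambda>xs. h e' (d # xs)))"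
  define s where "s = (\<lambda>e' d. dmean es (\<lambda>xs. (h e' (d # xs))\<^sup>2))"
  define c where "c = dmean (e # es) (h e)"
  have c: "c = (m e (-1) + m e 0 + m e 1) / 3" by (simp add: c_def m_def)
  have child: "dmean es (\<lambda>xs. (mtrans (e # es) h (d # xs))\<^sup>2) \<le>
      (m e d - c)\<^sup>2 + (\<Sum>e'\<in>UNIV. s e' d - (m e' d)\<^sup>2)" for d
  proof -
    have "dmean es (\<lambda>xs. (mtrans (e # es) h (d # xs))\<^sup>2) =
        dmean es (\<lambda>xs. (m e d - c)\<^sup>2 + 2 * (m e d - c) * mtrans es (\<lambda>e' xs. h e' (d # xs)) xs +
          (mtrans es (\<lambda>e' xs. h e' (d # xs)) xs)\<^sup>2)"
      by (rule arg_cong[where f = "dmean es"]) (auto simp: m_def c_def power2_sum)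
    \<comment> \<open>The mixed term drops out because the remaining transform has mean
      zero.\<close>
    also have "\<dots> = (m e d - c)\<^sup>2 + dmean es (\<lambda>xs. (mtrans es (\<lambda>e' xs. h e' (d # xs)) xs)\<^sup>2)"
      by (simp add: dmean_add dmean_cmult dmean_mtrans)
    also have "\<dots> \<le> (m e d - c)\<^sup>2 + (\<Sum>e'\<in>UNIV. s e' d - (m e' d)\<^sup>2)"
      using Cons.IH[of "\<lambda>e' xs. h e' (d # xs)"] by (simp add: m_def s_def)
    finally show ?thesis .
  qed
  have one: "(m e (-1) - c)\<^sup>2 + (m e 0 - c)\<^sup>2 + (m e 1 - c)\<^sup>2 =
      (m e (-1))\<^sup>2 + (m e 0)\<^sup>2 + (m e 1)\<^sup>2 - 3 * c\<^sup>2"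
    unfolding c by (simp add: power2_eq_square field_simps)
  \<comment> \<open>The variance between the three children is nonnegative in every direction, while
    only direction \<open>e\<close> uses it up at this trisection.\<close>
  have conv: "((m e' (-1) + m e' 0 + m e' 1) / 3)\<^sup>2 \<le> ((m e' (-1))\<^sup>2 + (m e' 0)\<^sup>2 + (m e' 1)\<^sup>2) / 3" for e'
    using dmean_square_le[of "[e]" "\<lambda>ds. m e' (hd ds)"] by simp
  have "3 * dmean (e # es) (\<lambda>ds. (mtrans (e # es) h ds)\<^sup>2) \<le>
     (\<Sum>d\<in>{-1,0,1}. (m e d - c)\<^sup>2 + (\<Sum>e'\<in>UNIV. s e' d - (m e' d)\<^sup>2))"
    using child[of "-1"] child[of 0] child[of 1] by simp
  also have "\<dots> = (m e (-1))\<^sup>2 + (m e 0)\<^sup>2 + (m e 1)\<^sup>2 - 3 * c\<^sup>2 +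
      (\<Sum>e'\<in>UNIV. (s e' (-1) + s e' 0 + s e' 1) - ((m e' (-1))\<^sup>2 + (m e' 0)\<^sup>2 + (m e' 1)\<^sup>2))"
    using one by (simp add: sum.distrib sum_subtractf)
  also have "\<dots> \<le> (\<Sum>e'\<in>UNIV. (s e' (-1) + s e' 0 + s e' 1) - 3 * ((m e' (-1) + m e' 0 + m e' 1) / 3)\<^sup>2)"
  proof -
    have "(m e (-1))\<^sup>2 + (m e 0)\<^sup>2 + (m e 1)\<^sup>2 - 3 * c\<^sup>2 \<le>
       (\<Sum>e'\<in>UNIV. (m e' (-1))\<^sup>2 + (m e' 0)\<^sup>2 + (m e' 1)\<^sup>2 - 3 * ((m e' (-1) + m e' 0 + m e' 1) / 3)\<^sup>2)"
      unfolding c by (rule member_le_sum) (use conv in \<open>auto simp: field_simps\<close>)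
    then show ?thesis by (simp add: sum_subtractf sum.distrib)
  qed
  also have "\<dots> = 3 * (\<Sum>e'\<in>UNIV. dmean (e # es) (\<lambda>ds. (h e' ds)\<^sup>2) - (dmean (e # es) (h e'))\<^sup>2)"
    unfolding sum_distrib_left by (rule sum.cong) (auto simp: s_def m_def)
  finally show ?case by simp
qed simp

lemma abs_diff_mean_le:
  fixes x y1 y2 y3 c :: real
  shows "\<bar>x - y1\<bar> \<le> c \<Longrightarrow> \<bar>x - y2\<bar> \<le> c \<Longrightarrow> \<bar>x - y3\<bar> \<le> c \<Longrightarrow> \<bar>x - (y1 + y2 + y3) / 3\<bar> \<le> c"
  unfolding abs_le_iff by (auto simp: field_simps)

text \<open>An increment compares the mean over one child with the mean over all three, hence is
  bounded by the effect of changing a single digit. The factor \<open>length es\<close> makes this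
  useful only within one round of trisections.\<close>

lemma mtrans_adjacent_bound:
  assumes "ds \<in> digits (length es)"
    and "\<And>i xs d d'. i < length es \<Longrightarrow> xs \<in> digits (length es) \<Longrightarrow> d \<in> {-1, 0, 1} \<Longrightarrow> d' \<in> {-1, 0, 1} \<Longrightarrow>
      \<bar>h (es ! i) (xs[i := d]) - h (es ! i) (xs[i := d'])\<bar> \<le> c"
  shows "\<bar>mtrans es h ds\<bar> \<le> real (length es) * c"
  using assms
proof (induction es arbitrary: h ds)
  case (Cons e es)
  from Cons.prems(1) obtain d xs where d: "ds = d # xs" "d \<in> {-1, 0, 1}" "xs \<in> digits (length es)"
    by (auto elim: digits_SucE)
  have *: "\<bar>dmean es (\<lambda>xs. h e (d # xs)) - dmean es (\<lambda>xs. h e (d' # xs))\<bar> \<le> c" if "d' \<in> {-1, 0, 1}" for d'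
  proof -
    have "\<bar>dmean es (\<lambda>xs. h e (d # xs)) - dmean es (\<lambda>xs. h e (d' # xs))\<bar>
        \<le> dmean es (\<lambda>xs. \<bar>h e (d # xs) - h e (d' # xs)\<bar>)"
      unfolding dmean_diff[symmetric] by (rule dmean_abs)
    also have "\<dots> \<le> dmean es (\<lambda>_. c)"
      using Cons.prems(2)[of 0 "d # _" d d'] that d by (intro dmean_mono) (auto simp: digits_Cons)
    finally show ?thesis by simp
  qed
  have "\<bar>dmean es (\<lambda>xs. h e (d # xs)) - dmean (e # es) (h e)\<bar> \<le> c"
    using *[of "-1"] *[of 0] *[of 1] unfolding dmean.simps
    by (intro abs_diff_mean_le) simp_all
  moreover have "\<bar>mtrans es (\<lambda>e' xs. h e' (d # xs)) xs\<bar> \<le> real (length es) * c"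
  proof (rule Cons.IH[OF d(3)])
    fix i ys d1 d2
    assume "i < length es" "ys \<in> digits (length es)" "d1 \<in> {-1, 0, 1::int}" "d2 \<in> {-1, 0, 1::int}"
    then show "\<bar>h (es ! i) (d # ys[i := d1]) - h (es ! i) (d # ys[i := d2])\<bar> \<le> c"
      using Cons.prems(2)[of "Suc i" "d # ys" d1 d2] d(2) by (simp add: digits_Cons)
  qed
  ultimately show ?case using d(1) by (simp add: algebra_simps)
qed simp

text \<open>Convexity of the power, with weights \<open>A / (A + B)\<close> and
  \<open>B / (A + B)\<close> at the points \<open>x / A\<close> and \<open>y / B\<close>: the usual
  proof of Minkowski's inequality before summation.\<close>

lemma powr_add_le:
  fixes x y A B p :: real
  assumes "0 \<le> x" "0 \<le> y" "0 < A" "0 < B" "1 \<le> p"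
  shows "(x + y) powr p \<le> (A + B) powr p * (A / (A + B) * (x powr p / A powr p) + B / (A + B) * (y powr p / B powr p))"
proof -
  define l where "l = A / (A + B)"
  have l: "0 < l" "l < 1" "1 - l = B / (A + B)" using assms by (auto simp: l_def field_simps)
  have conv: "(l * u + (1 - l) * v) powr p \<le> l * u powr p + (1 - l) * v powr p" if "0 \<le> u" "0 \<le> v" for u v
  proof -
    have *: "(t * w) powr p \<le> t * w powr p" if "0 < t" "t < 1" "0 \<le> w" for t w :: real
    proof -
      have "t powr p \<le> t powr 1" using that assms by (intro powr_mono') auto
      then show ?thesis using that by (simp add: powr_mult mult_right_mono)
    qed
    show ?thesis
    proof (cases "u = 0 \<or> v = 0")
      case True
      then show ?thesis using *[of l u] *[of "1 - l" v] that l assms by auto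
    next
      case False
      then show ?thesis
        using convex_onD[OF powr_convex[OF assms(5)], of "1 - l" u v] that l(1,2) by simp
    qed
  qed
  have eq: "x + y = (A + B) * (l * (x / A) + (1 - l) * (y / B))"
    using assms l(3) by (simp add: l_def distrib_left)
  have "(x + y) powr p = (A + B) powr p * (l * (x / A) + (1 - l) * (y / B)) powr p"
    unfolding eq by (rule powr_mult)
  also have "\<dots> \<le> (A + B) powr p * (l * (x / A) powr p + (1 - l) * (y / B) powr p)"
    using assms by (intro mult_left_mono conv) auto
  finally show ?thesis using assms l by (simp add: powr_divide l_def)
qed

text \<open>Minkowski's inequality with prescribed positive bounds in place of norms, which avoids
  taking \<open>p\<close>-th roots.\<close>

lemma dmean_Minkowski:
  assumes "1 \<le> p" "0 < A" "0 < B"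
    and "dmean es (\<lambda>ds. \<bar>f ds\<bar> powr p) \<le> A powr p" "dmean es (\<lambda>ds. \<bar>g ds\<bar> powr p) \<le> B powr p"
  shows "dmean es (\<lambda>ds. (\<bar>f ds\<bar> + \<bar>g ds\<bar>) powr p) \<le> (A + B) powr p"
proof -
  let ?F = "\<lambda>ds. \<bar>f ds\<bar> powr p" and ?G = "\<lambda>ds. \<bar>g ds\<bar> powr p"
  let ?a = "(A + B) powr p * (A / (A + B)) / A powr p" and ?b = "(A + B) powr p * (B / (A + B)) / B powr p"
  have "dmean es (\<lambda>ds. (\<bar>f ds\<bar> + \<bar>g ds\<bar>) powr p) \<le> dmean es (\<lambda>ds. ?a * ?F ds + ?b * ?G ds)"
    using powr_add_le[OF abs_ge_zero abs_ge_zero assms(2,3,1)]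
    by (intro dmean_mono) (simp add: algebra_simps)
  also have "\<dots> = ?a * dmean es ?F + ?b * dmean es ?G"
    by (simp only: dmean_add dmean_cmult)
  also have "\<dots> \<le> ?a * A powr p + ?b * B powr p"
    using assms by (intro add_mono mult_left_mono) auto
  also have "\<dots> = (A + B) powr p * (A / (A + B) + B / (A + B))"
    using assms by (simp add: distrib_left)
  also have "\<dots> = (A + B) powr p" using assms by (simp add: add_divide_distrib[symmetric])
  finally show ?thesis .
qed

text \<open>The inverse inequality: a mean square of at most \<open>B\<^sup>2\<close> over
  \<open>3 ^ length es\<close> words forces each value to be at most \<open>K B\<close> with
  \<open>K\<^sup>2 = 3 ^ length es\<close>; the power \<open>p - 2\<close> is estimated by this, the
  remaining square by the mean.\<close>

lemma dmean_powr_le_square: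
  assumes "2 \<le> p" "0 < B" "dmean es (\<lambda>ds. (f ds)\<^sup>2) \<le> B\<^sup>2"
  shows "dmean es (\<lambda>ds. \<bar>f ds\<bar> powr p) \<le> ((3 ^ length es) powr (1/2 - 1/p) * B) powr p"
proof -
  define K where "K = (3 ^ length es :: real) powr (1/2)"
  have K: "K > 0" "K\<^sup>2 = 3 ^ length es"
    by (auto simp: K_def powr_half_sqrt)
  have "\<bar>f ds\<bar> powr p \<le> (K * B) powr (p - 2) * (f ds)\<^sup>2" if "ds \<in> digits (length es)" for ds
  proof (cases "f ds = 0")
    case False
    have "(f ds)\<^sup>2 \<le> 3 ^ length es * dmean es (\<lambda>ds. (f ds)\<^sup>2)"
      by (rule le_dmean[OF that]) simp
    also have "\<dots> \<le> 3 ^ length es * B\<^sup>2" using assms by (intro mult_left_mono) auto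
    finally have "(f ds)\<^sup>2 \<le> (K * B)\<^sup>2" by (simp add: K power_mult_distrib)
    then have "\<bar>f ds\<bar> \<le> K * B" using K assms by (simp add: abs_le_square_iff[symmetric])
    then have "\<bar>f ds\<bar> powr (p - 2) \<le> (K * B) powr (p - 2)" using assms by (intro powr_mono2) auto
    moreover have "\<bar>f ds\<bar> powr p = \<bar>f ds\<bar> powr (p - 2) * (f ds)\<^sup>2"
      using False powr_add[of "\<bar>f ds\<bar>" "p - 2" 2] powr_numeral[of "\<bar>f ds\<bar>" "Num.Bit0 Num.One"] by simp
    ultimately show ?thesis by (simp add: mult_right_mono)
  qed simp
  then have "dmean es (\<lambda>ds. \<bar>f ds\<bar> powr p) \<le> dmean es (\<lambda>ds. (K * B) powr (p - 2) * (f ds)\<^sup>2)"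
    by (rule dmean_mono)
  also have "\<dots> \<le> (K * B) powr (p - 2) * B\<^sup>2"
    using assms by (simp add: dmean_cmult mult_left_mono)
  also have "\<dots> = K powr (p - 2) * B powr p"
    using assms K powr_add[of B "p - 2" 2] by (simp add: powr_mult)
  also have "K powr (p - 2) = ((3 ^ length es) powr (1/2 - 1/p)) powr p"
  proof -
    have "(1 / 2 - 1 / p) * p = 1 / 2 * (p - 2)" using assms by (simp add: field_simps)
    then show ?thesis by (simp only: K_def powr_powr)
  qed
  finally show ?thesis using assms by (simp add: powr_mult)
qed

subsection \<open>Boxes and their trisections\<close>

definition tbox :: "real^'n \<Rightarrow> ('n \<Rightarrow> real) \<Rightarrow> (real^'n) set" where
  "tbox c r = cbox (\<chi> i. c $ i - r i / 2) (\<chi> i. c $ i + r i / 2)"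

definition bavg :: "real^'n \<Rightarrow> ('n \<Rightarrow> real) \<Rightarrow> (real^'n \<Rightarrow> real) \<Rightarrow> real" where
  "bavg c r f = integral (tbox c r) f / (\<Prod>i\<in>UNIV. r i)"

lemma negligible_hyperplane_cart: "negligible {x::real^'n. x $ i = a}"
  by (simp add: cart_eq_inner_axis negligible_standard_hyperplane)

lemma mem_tbox: "x \<in> tbox c r \<longleftrightarrow> (\<forall>i. c $ i - r i / 2 \<le> x $ i \<and> x $ i \<le> c $ i + r i / 2)"
  by (simp add: tbox_def mem_box_cart)

lemma content_tbox: "(\<And>i. 0 < r i) \<Longrightarrow> measure lborel (tbox c r) = (\<Prod>i\<in>UNIV. r i)"
proof -
  assume r: "\<And>i. 0 < r i"
  have "c \<in> tbox c r" using r by (simp add: mem_tbox less_imp_le)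
  then have "tbox c r \<noteq> {}" by blast
  then show ?thesis unfolding tbox_def by (subst content_cbox_cart) auto
qed

lemma bavg_diff:
  "f integrable_on tbox c r \<Longrightarrow> g integrable_on tbox c r \<Longrightarrow>
    bavg c r (\<lambda>x. f x - g x) = bavg c r f - bavg c r g"
  by (simp add: bavg_def integral_diff diff_divide_distrib)

lemma bavg_add:
  "f integrable_on tbox c r \<Longrightarrow> g integrable_on tbox c r \<Longrightarrow>
    bavg c r (\<lambda>x. f x + g x) = bavg c r f + bavg c r g"
  by (simp add: bavg_def integral_add add_divide_distrib)

lemma bavg_cmult: "bavg c r (\<lambda>x. k * f x) = k * bavg c r f"
  by (simp add: bavg_def)

lemma bavg_le:
  assumes "\<And>i. 0 < r i" "f integrable_on tbox c r" "\<And>x. x \<in> tbox c r \<Longrightarrow> f x \<le> K"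
  shows "bavg c r f \<le> K"
proof -
  have "integral (tbox c r) f \<le> integral (tbox c r) (\<lambda>_. K)"
    by (rule integral_le[OF assms(2) _ assms(3)]) (auto simp: tbox_def)
  also have "\<dots> = K * (\<Prod>i\<in>UNIV. r i)"
    using content_tbox[of r c, OF assms(1)] by (simp add: tbox_def mult.commute)
  finally show ?thesis
    using prod_pos[of UNIV r] assms(1) by (simp add: bavg_def field_simps)
qed

lemma bavg_abs_le:
  assumes "\<And>i. 0 < r i" "f integrable_on tbox c r" "\<And>x. x \<in> tbox c r \<Longrightarrow> \<bar>f x\<bar> \<le> K"
  shows "\<bar>bavg c r f\<bar> \<le> K"
proof -
  have "bavg c r f \<le> K" using assms by (intro bavg_le) (auto simp: abs_le_iff)
  moreover have "bavg c r (\<lambda>x. -1 * f x) \<le> K"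
    using assms by (intro bavg_le integrable_neg) (auto simp: abs_le_iff intro!: integrable_neg)
  ultimately show ?thesis by (simp only: bavg_cmult)
qed

text \<open>Centre of the descendant box encoded by a word; a digit selects the left, middle or
  right third of the current side. The side lengths, given by \<open>subr\<close>, do not depend on
  the digits.\<close>

primrec subc :: "'n list \<Rightarrow> real^'n \<Rightarrow> ('n \<Rightarrow> real) \<Rightarrow> int list \<Rightarrow> real^'n" where
  "subc [] c r ds = c"
| "subc (e # es) c r ds =
     subc es (c + axis e (of_int (hd ds) * r e / 3)) (r(e := r e / 3)) (tl ds)"

primrec subr :: "'n list \<Rightarrow> ('n \<Rightarrow> real) \<Rightarrow> 'n \<Rightarrow> real" where
  "subr [] r = r"
| "subr (e # es) r = subr es (r(e := r e / 3))"

lemma subr_eq: "subr es r i = r i / 3 ^ count_list es i"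
  by (induction es arbitrary: r) auto

lemma subr_append: "subr (es @ fs) r = subr fs (subr es r)"
  by (induction es arbitrary: r) auto

lemma subc_append:
  "length ds = length es \<Longrightarrow>
    subc (es @ fs) c r (ds @ ys) = subc fs (subc es c r ds) (subr es r) ys"
proof (induction es arbitrary: c r ds)
  case (Cons e es)
  then obtain d xs where "ds = d # xs" "length xs = length es" by (cases ds) auto
  with Cons.IH[of xs] show ?case by simp
qed simp

lemma tbox_child_subset:
  assumes "\<And>i. 0 < r i" "d \<in> {-1, 0, 1::int}"
  shows "tbox (c + axis e (of_int d * r e / 3)) (r(e := r e / 3)) \<subseteq> tbox c r"
proof
  fix x assume x: "x \<in> tbox (c + axis e (of_int d * r e / 3)) (r(e := r e / 3))"
  have "c $ i - r i / 2 \<le> x $ i \<and> x $ i \<le> c $ i + r i / 2" for i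
  proof (cases "i = e")
    case True
    have "c $ e + of_int d * r e / 3 - r e / 3 / 2 \<le> x $ e" "x $ e \<le> c $ e + of_int d * r e / 3 + r e / 3 / 2"
      using x[unfolded mem_tbox, rule_format, of e] by (auto simp: axis_def)
    with assms(1)[of e] assms(2) True show ?thesis by auto
  next
    case False
    then show ?thesis using x[unfolded mem_tbox, rule_format, of i] by (simp add: axis_def)
  qed
  then show "x \<in> tbox c r" by (simp add: mem_tbox)
qed

lemma tbox_sub_subset:
  "(\<And>i. 0 < r i) \<Longrightarrow> ds \<in> digits (length es) \<Longrightarrow> tbox (subc es c r ds) (subr es r) \<subseteq> tbox c r"
proof (induction es arbitrary: c r ds)
  case (Cons e es)
  from Cons.prems(2) obtain d xs where d: "ds = d # xs" "d \<in> {-1, 0, 1}" "xs \<in> digits (length es)"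
    by (auto elim: digits_SucE)
  have "tbox (subc es (c + axis e (of_int d * r e / 3)) (r(e := r e / 3)) xs) (subr es (r(e := r e / 3)))
      \<subseteq> tbox (c + axis e (of_int d * r e / 3)) (r(e := r e / 3))"
    using Cons.prems(1) d(3) by (intro Cons.IH) auto
  also have "\<dots> \<subseteq> tbox c r" using Cons.prems(1) d(2) by (rule tbox_child_subset)
  finally show ?case using d(1) by simp
qed simp

text \<open>The three closed thirds overlap only in hyperplanes.\<close>

lemma bavg_trisect:
  fixes c :: "real^'n" and e :: 'n
  assumes r: "\<And>i. 0 < r i" and f: "f integrable_on tbox c r"
  defines "A \<equiv> \<lambda>d::int. bavg (c + axis e (of_int d * r e / 3)) (r(e := r e / 3)) f"
  shows "bavg c r f = (A (-1) + A 0 + A 1) / 3"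
proof -
  define B where "B = (\<lambda>d::int. tbox (c + axis e (of_int d * r e / 3)) (r(e := r e / 3)))"
  have memB: "x \<in> B d \<longleftrightarrow> (\<forall>i. i \<noteq> e \<longrightarrow> c $ i - r i / 2 \<le> x $ i \<and> x $ i \<le> c $ i + r i / 2) \<and>
      c $ e + of_int d * r e / 3 - r e / 6 \<le> x $ e \<and> x $ e \<le> c $ e + of_int d * r e / 3 + r e / 6" for x d
    unfolding B_def mem_tbox by (auto simp: axis_def)
  have memt: "x \<in> tbox c r \<longleftrightarrow> (\<forall>i. i \<noteq> e \<longrightarrow> c $ i - r i / 2 \<le> x $ i \<and> x $ i \<le> c $ i + r i / 2) \<and>
      c $ e - r e / 2 \<le> x $ e \<and> x $ e \<le> c $ e + r e / 2" for x
    unfolding mem_tbox by auto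
  have un: "tbox c r = B (-1) \<union> (B 0 \<union> B 1)"
    using r[of e] by (auto simp: memB memt set_eq_iff)
  have int: "f integrable_on B d" if "d \<in> {-1, 0, 1}" for d
    unfolding B_def using tbox_child_subset[of r d c e] r that f integrable_on_subcbox
    unfolding tbox_def by blast
  have neg: "negligible (B 0 \<inter> B 1)" "negligible (B (-1) \<inter> (B 0 \<union> B 1))"
  proof -
    have "B 0 \<inter> B 1 \<subseteq> {x. x $ e = c $ e + r e / 6}" by (auto simp: memB)
    then show "negligible (B 0 \<inter> B 1)"
      by (rule negligible_subset[OF negligible_hyperplane_cart])
    have "B (-1) \<inter> (B 0 \<union> B 1) \<subseteq> {x. x $ e = c $ e - r e / 6}" using r[of e] by (auto simp: memB)
    then show "negligible (B (-1) \<inter> (B 0 \<union> B 1))"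
      by (rule negligible_subset[OF negligible_hyperplane_cart])
  qed
  have "integral (tbox c r) f = integral (B (-1)) f + (integral (B 0) f + integral (B 1) f)"
    unfolding un using int neg
    by (simp add: integrable_Un)
  moreover
  have "(\<Prod>i\<in>UNIV. (r(e := r e / 3)) i) = (\<Prod>i\<in>UNIV. r i) / 3"
    by (simp add: prod.remove[of UNIV e])
  then have "A d = integral (B d) f / ((\<Prod>i\<in>UNIV. r i) / 3)" for d
    by (simp only: A_def B_def bavg_def)
  ultimately show ?thesis by (simp add: bavg_def add_divide_distrib)
qed

lemma bavg_subdivide:
  "(\<And>i. 0 < r i) \<Longrightarrow> f integrable_on tbox c r \<Longrightarrow>
    dmean es (\<lambda>ds. bavg (subc es c r ds) (subr es r) f) = bavg c r f"
proof (induction es arbitrary: c r)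
  case (Cons e es)
  have int: "f integrable_on tbox (c + axis e (of_int d * r e / 3)) (r(e := r e / 3))"
    if "d \<in> {-1, 0, 1}" for d :: int
    using tbox_child_subset[of r d c e] Cons.prems that integrable_on_subcbox
    unfolding tbox_def by blast
  have "dmean es (\<lambda>ds. bavg (subc es (c + axis e (of_int d * r e / 3)) (r(e := r e / 3)) ds)
        (subr es (r(e := r e / 3))) f) = bavg (c + axis e (of_int d * r e / 3)) (r(e := r e / 3)) f"
    if d: "d \<in> {-1, 0, 1}" for d :: int
  proof (rule Cons.IH)
    show "0 < (r(e := r e / 3)) i" for i using Cons.prems(1) by simp
  qed (rule int[OF d])
  from this[of "-1"] this[of 0] this[of 1] show ?case
    using bavg_trisect[OF Cons.prems, of e] by simp
qed simp

text \<open>As each direction is trisected only once, every digit moves the centre by thirds of the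
  original side, whatever the order.\<close>

lemma subc_distinct:
  "distinct es \<Longrightarrow> length ds = length es \<Longrightarrow>
    subc es c r ds = c + (\<Sum>i<length es. axis (es ! i) (of_int (ds ! i) * r (es ! i) / 3))"
proof (induction es arbitrary: c r ds)
  case (Cons e es)
  then obtain d xs where d: "ds = d # xs" "length xs = length es" by (cases ds) auto
  have "subc (e # es) c r ds = c + axis e (of_int d * r e / 3) +
      (\<Sum>i<length es. axis (es ! i) (of_int (xs ! i) * (r(e := r e / 3)) (es ! i) / 3))"
    using Cons.IH[OF _ d(2)] Cons.prems d by simp
  also have "(\<Sum>i<length es. axis (es ! i) (of_int (xs ! i) * (r(e := r e / 3)) (es ! i) / 3)) =
      (\<Sum>i<length es. axis (es ! i) (of_int (xs ! i) * r (es ! i) / 3))"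
    using Cons.prems(1) by (intro sum.cong) auto
  finally show ?case using d by (simp add: sum.lessThan_Suc_shift add.assoc del: sum.lessThan_Suc)
qed simp

lemma subc_component:
  assumes "distinct es" "length ds = length es" "i < length es"
  shows "subc es c r ds $ (es ! i) = c $ (es ! i) + of_int (ds ! i) * r (es ! i) / 3"
proof -
  have "(\<Sum>j<length es. axis (es ! j) (of_int (ds ! j) * r (es ! j) / 3)) $ (es ! i) =
      (\<Sum>j<length es. if j = i then of_int (ds ! i) * r (es ! i) / 3 else 0)"
    unfolding sum_component using assms by (intro sum.cong) (auto simp: axis_def nth_eq_iff_index_eq)
  then show ?thesis using assms by (simp add: subc_distinct)
qed

text \<open>Raising one digit by 1 moves the box by its own side length in that direction, so the
  two boxes share a face and \<open>face_mean_adjacent\<close> applies to them.\<close>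

lemma subc_update:
  assumes "distinct es" "length ds = length es" "i < length es"
  shows "subc es c r (ds[i := d]) = subc es c r (ds[i := d']) + axis (es ! i) (of_int (d - d') * r (es ! i) / 3)"
proof -
  let ?f = "\<lambda>ds j. axis (es ! j) (of_int (ds ! j) * r (es ! j) / 3)"
  have "(\<Sum>j\<in>{..<length es} - {i}. ?f (ds[i := d]) j) = (\<Sum>j\<in>{..<length es} - {i}. ?f (ds[i := d']) j)"
    by (rule sum.cong) auto
  moreover have "(\<Sum>j<length es. ?f xs j) = ?f xs i + (\<Sum>j\<in>{..<length es} - {i}. ?f xs j)" for xs
    using assms by (intro sum.remove) auto
  moreover have "?f (ds[i := d]) i = ?f (ds[i := d']) i + axis (es ! i) (of_int (d - d') * r (es ! i) / 3)"
    using assms by (auto simp: axis_def vec_eq_iff field_simps)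
  ultimately show ?thesis using assms by (simp add: subc_distinct add.assoc)
qed

subsection \<open>Averages over adjacent boxes\<close>

text \<open>Fubini and translation invariance: integrating \<open>g\<close> along the segments that
  start in \<open>Q\<close> amounts to integrating \<open>g\<close> against the time that these
  segments spend at each point. Every estimate below that recovers differences of a function from
  its gradient uses this identity, with its own bound on the weight.\<close>

lemma translation_Fubini:
  fixes g :: "'a::euclidean_space \<Rightarrow> real" and v :: 'a
  assumes g: "continuous_on UNIV g" and Q: "compact Q"
  shows "(\<integral>x. indicator Q x * (\<integral>t. indicator {0..l} t * g (x + t *\<^sub>R v) \<partial>lborel) \<partial>lborel) =
    (\<integral>x. g x * (\<integral>t. indicator {0..l} t * indicator Q (x - t *\<^sub>R v) \<partial>lborel) \<partial>lborel)"
proof -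
  have int1: "integrable (lborel \<Otimes>\<^sub>M lborel)
      (\<lambda>(t::real, x). indicator {0..l} t * indicator Q x * g (x + t *\<^sub>R v))"
  proof -
    have "integrable lborel (\<lambda>z::real \<times> 'a. indicator ({0..l} \<times> Q) z *\<^sub>R g (snd z + fst z *\<^sub>R v))"
      using Q by (intro borel_integrable_compact compact_Times continuous_on_compose2[OF g] continuous_intros) auto
    then show ?thesis
      unfolding lborel_prod by (rule Bochner_Integration.integrable_cong[THEN iffD1, rotated 2])
        (auto simp: indicator_def)
  qed
  have int2: "integrable (lborel \<Otimes>\<^sub>M lborel)
      (\<lambda>(t::real, x). indicator {0..l} t * indicator Q (x - t *\<^sub>R v) * g x)"
  proof -
    \<comment> \<open>The compact image of \<open>{0..l} \<times> Q\<close> under the shear that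
      takes \<open>(t, x)\<close> to \<open>(t, x + t v)\<close>.\<close>
    let ?S = "(\<lambda>z::real \<times> 'a. (fst z, snd z + fst z *\<^sub>R v)) ` ({0..l} \<times> Q)"
    have S: "(t, x) \<in> ?S \<longleftrightarrow> t \<in> {0..l} \<and> x - t *\<^sub>R v \<in> Q" for t x
      by (force simp: image_iff)
    have "compact ?S"
      using Q by (intro compact_continuous_image compact_Times continuous_intros) auto
    then have "integrable lborel (\<lambda>z::real \<times> 'a. indicator ?S z *\<^sub>R g (snd z))"
      by (intro borel_integrable_compact continuous_on_compose2[OF g] continuous_intros) auto
    then show ?thesis
      unfolding lborel_prod by (rule Bochner_Integration.integrable_cong[THEN iffD1, rotated 2])
        (auto simp: indicator_def S simp del: image_iff split: if_splits)
  qed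
  have "(\<integral>x. indicator Q x * (\<integral>t. indicator {0..l} t * g (x + t *\<^sub>R v) \<partial>lborel) \<partial>lborel) =
      (\<integral>x. (\<integral>t. indicator {0..l} t * indicator Q x * g (x + t *\<^sub>R v) \<partial>lborel) \<partial>lborel)"
    by (simp add: mult.left_commute mult.assoc flip: Bochner_Integration.integral_mult_right_zero)
  also have "\<dots> = (\<integral>t. (\<integral>x. indicator {0..l} t * indicator Q x * g (x + t *\<^sub>R v) \<partial>lborel) \<partial>lborel)"
    by (rule lborel_pair.Fubini_integral[OF int1])
  also have "\<dots> = (\<integral>t. (\<integral>x. indicator {0..l} t * indicator Q (x - t *\<^sub>R v) * g x \<partial>lborel) \<partial>lborel)"
  proof (rule Bochner_Integration.integral_cong[OF refl])
    fix t :: real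
    have "g \<in> borel_measurable borel" using g by (rule borel_measurable_continuous_onI)
    moreover have "Q \<in> sets borel" using Q by (rule borel_compact)
    ultimately have "(\<integral>x. indicator {0..l} t * indicator Q (x - t *\<^sub>R v) * g x \<partial>distr lborel borel ((+) (t *\<^sub>R v))) =
        (\<integral>x. indicator {0..l} t * indicator Q x * g (x + t *\<^sub>R v) \<partial>lborel)"
      by (subst integral_distr) (simp_all add: add.commute)
    then show "(\<integral>x. indicator {0..l} t * indicator Q x * g (x + t *\<^sub>R v) \<partial>lborel) =
        (\<integral>x. indicator {0..l} t * indicator Q (x - t *\<^sub>R v) * g x \<partial>lborel)"
      by (simp add: lborel_distr_plus)
  qed
  also have "\<dots> = (\<integral>x. (\<integral>t. indicator {0..l} t * indicator Q (x - t *\<^sub>R v) * g x \<partial>lborel) \<partial>lborel)"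
    by (rule lborel_pair.Fubini_integral[OF int2, symmetric])
  also have "\<dots> = (\<integral>x. g x * (\<integral>t. indicator {0..l} t * indicator Q (x - t *\<^sub>R v) \<partial>lborel) \<partial>lborel)"
    by (simp add: mult.commute[of "g _"])
  finally show ?thesis .
qed

lemma smooth_line_integral:
  assumes \<phi>: "smooth \<phi>" and l: "0 \<le> l"
  shows "(\<integral>t. indicator {0..l} t * partial_deriv e \<phi> (x + t *\<^sub>R axis e 1) \<partial>lborel) = \<phi> (x + axis e l) - \<phi> x"
proof -
  let ?F = "\<lambda>t. \<phi> (x + t *\<^sub>R axis e 1)" and ?f = "\<lambda>t. partial_deriv e \<phi> (x + t *\<^sub>R axis e 1)"
  have "(?F has_real_derivative ?f t) (at t)" for t
  proof -
    have "((\<lambda>t. \<phi> (x + t *\<^sub>R axis e 1)) has_derivative (\<lambda>h. grad \<phi> (x + t *\<^sub>R axis e 1) \<bullet> (h *\<^sub>R axis e 1))) (at t)"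
      by (rule has_derivative_compose[OF _ smooth_has_derivative[OF \<phi>]]) (auto intro!: derivative_eq_intros)
    then show ?thesis
      unfolding has_field_derivative_def
      by (rule has_derivative_eq_rhs) (auto simp: inner_axis grad_component mult.commute)
  qed
  moreover have "continuous_on UNIV ?f"
    by (intro continuous_on_compose2[OF smooth_continuous[OF smooth_partial_deriv[OF \<phi>], of UNIV]]
        continuous_intros) auto
  then have "isCont ?f t" for t by (simp add: continuous_on_eq_continuous_at)
  ultimately have "(\<integral>t. ?f t * indicator {0..l} t \<partial>lborel) = ?F l - ?F 0"
    by (intro integral_FTC_Icc_real l) auto
  moreover have "l *\<^sub>R axis e 1 = axis e l" by (simp add: axis_def vec_eq_iff)
  ultimately show ?thesis by (simp add: mult.commute)
qed

lemma integral_indicator_lborel: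
  fixes f :: "'a::euclidean_space \<Rightarrow> real"
  assumes "continuous_on Q f" "compact Q"
  shows "(\<integral>x. indicator Q x * f x \<partial>lborel) = integral Q f" "integrable lborel (\<lambda>x. indicator Q x * f x)"
proof -
  show "integrable lborel (\<lambda>x. indicator Q x * f x)"
    using borel_integrable_compact[OF assms(2,1)] by simp
  then have "set_integrable lborel Q f" by (simp add: set_integrable_def)
  from set_borel_integral_eq_integral(2)[OF this] show "(\<integral>x. indicator Q x * f x \<partial>lborel) = integral Q f"
    by (simp add: set_lebesgue_integral_def)
qed

lemma integral_tbox_shift:
  "integral (tbox (c + v) r) f = integral (tbox c r) (\<lambda>x. f (x + v))"
proof -
  have eq: "(\<chi> i. (c + v) $ i - r i / 2) - v = (\<chi> i. c $ i - r i / 2)" "(\<chi> i. (c + v) $ i + r i / 2) - v = (\<chi> i. c $ i + r i / 2)"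
    by (auto simp: vec_eq_iff)
  show ?thesis
    unfolding tbox_def using integral_shift_cbox[of "\<chi> i. (c + v) $ i - r i / 2" v "\<chi> i. (c + v) $ i + r i / 2" f]
    unfolding eq by simp
qed

text \<open>By \<open>u + (y - c)\<^sub>e \<partial>\<^sub>e u = \<partial>\<^sub>e ((y - c)\<^sub>e u)\<close> the following quantity is the mean of the averages
  of \<open>u\<close> over the two faces of the box that are orthogonal to \<open>e\<close>.\<close>

definition face_mean :: "(real^'n \<Rightarrow> real) \<Rightarrow> 'n \<Rightarrow> real^'n \<Rightarrow> ('n \<Rightarrow> real) \<Rightarrow> real" where
  "face_mean \<phi> e c r = bavg c r (\<lambda>x. \<phi> x + (x $ e - c $ e) * partial_deriv e \<phi> x)"

text \<open>The plain integrals differ by the integral of the partial derivative against a tent,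
  which rises from 0 to \<open>l\<close> across the first box and falls back across the second. The
  moment terms in \<open>face_mean\<close> remove exactly its linear part and leave the constant
  weight \<open>l / 2\<close>.\<close>

lemma face_mean_adjacent:
  fixes \<phi> :: "real^'n \<Rightarrow> real"
  assumes \<phi>: "smooth \<phi>" and r: "\<And>i. 0 < r i"
  shows "face_mean \<phi> e (c + axis e (r e)) r - face_mean \<phi> e c r =
    r e / 2 * (bavg c r (partial_deriv e \<phi>) + bavg (c + axis e (r e)) r (partial_deriv e \<phi>))"
proof -
  define l where "l = r e"
  have l: "0 < l" using r by (simp add: l_def)
  define Q where "Q = tbox c r"
  define c' where "c' = c + axis e l"
  define Q' where "Q' = tbox c' r"
  define g where "g = partial_deriv e \<phi>"
  have cg: "continuous_on S g" for S unfolding g_def by (intro smooth_continuous smooth_partial_deriv \<phi>)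
  have c\<phi>: "continuous_on S \<phi>" for S by (intro smooth_continuous \<phi>)
  have comp: "compact Q" "compact Q'" by (simp_all add: Q_def Q'_def tbox_def)
  have memQ: "x \<in> Q \<longleftrightarrow> (\<forall>i. i \<noteq> e \<longrightarrow> c $ i - r i / 2 \<le> x $ i \<and> x $ i \<le> c $ i + r i / 2) \<and>
      c $ e - l / 2 \<le> x $ e \<and> x $ e \<le> c $ e + l / 2" for x
    unfolding Q_def mem_tbox l_def by auto
  have memQ': "x \<in> Q' \<longleftrightarrow> (\<forall>i. i \<noteq> e \<longrightarrow> c $ i - r i / 2 \<le> x $ i \<and> x $ i \<le> c $ i + r i / 2) \<and>
      c $ e + l / 2 \<le> x $ e \<and> x $ e \<le> c $ e + 3 * l / 2" for x
    unfolding Q'_def mem_tbox c'_def by (auto simp: l_def axis_def)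
  \<comment> \<open>The tent weight. On the common face both indicators are 1 and the formula fails,
    hence the exclusion of that hyperplane.\<close>
  have w: "(\<integral>t. indicator {0..l} t * indicator Q (x - t *\<^sub>R axis e 1) \<partial>lborel) =
      indicator Q x * (l / 2 + (x $ e - c $ e)) + indicator Q' x * (l / 2 - (x $ e - c' $ e))"
    if "x $ e \<noteq> c $ e + l / 2" for x
  proof -
    let ?T = "{t. t \<in> {0..l} \<and> x - t *\<^sub>R axis e 1 \<in> Q}"
    have memT: "x - t *\<^sub>R axis e 1 \<in> Q \<longleftrightarrow> (\<forall>i. i \<noteq> e \<longrightarrow> c $ i - r i / 2 \<le> x $ i \<and> x $ i \<le> c $ i + r i / 2) \<and>
      c $ e - l / 2 \<le> x $ e - t \<and> x $ e - t \<le> c $ e + l / 2" for t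
      unfolding memQ by (auto simp: axis_def)
    have "(\<integral>t. (indicator {0..l} t :: real) * indicator Q (x - t *\<^sub>R axis e 1) \<partial>lborel) = (\<integral>t. (indicator ?T t :: real) \<partial>lborel)"
      by (rule Bochner_Integration.integral_cong) (auto simp: indicator_def)
    also have "\<dots> = measure lborel ?T" by simp
    also have "\<dots> = indicator Q x * (l / 2 + (x $ e - c $ e)) + indicator Q' x * (l / 2 - (x $ e - c' $ e))"
    proof (cases "\<forall>i. i \<noteq> e \<longrightarrow> c $ i - r i / 2 \<le> x $ i \<and> x $ i \<le> c $ i + r i / 2")
      case False
      then have T: "?T = {}" and "x \<notin> Q" "x \<notin> Q'" unfolding memT unfolding memQ memQ' by auto
      then show ?thesis unfolding T by simp
    next
      case True
      then have T: "?T = {max 0 (x $ e - c $ e - l / 2)..min l (x $ e - c $ e + l / 2)}"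
        unfolding memT by (auto simp: max_def min_def)
      have Q: "x \<in> Q \<longleftrightarrow> c $ e - l / 2 \<le> x $ e \<and> x $ e \<le> c $ e + l / 2"
        "x \<in> Q' \<longleftrightarrow> c $ e + l / 2 \<le> x $ e \<and> x $ e \<le> c $ e + 3 * l / 2"
        using True unfolding memQ memQ' by auto
      have c': "c' $ e = c $ e + l" by (simp add: c'_def axis_def)
      show ?thesis
        unfolding T indicator_def Q c' using that l by (auto simp: max_def min_def field_simps)
    qed
    finally show ?thesis .
  qed
  have int: "integral Q' \<phi> - integral Q \<phi> =
      integral Q (\<lambda>x. (l / 2 + (x $ e - c $ e)) * g x) + integral Q' (\<lambda>x. (l / 2 - (x $ e - c' $ e)) * g x)"
  proof -
    have "integral Q' \<phi> - integral Q \<phi> = integral Q (\<lambda>x. \<phi> (x + axis e l) - \<phi> x)"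
      unfolding Q'_def c'_def integral_tbox_shift Q_def[symmetric]
      by (subst integral_diff) (auto simp: Q_def tbox_def intro!: integrable_continuous
          continuous_on_compose2[OF c\<phi>[of UNIV]] continuous_intros c\<phi>)
    also have "\<dots> = (\<integral>x. indicator Q x * (\<phi> (x + axis e l) - \<phi> x) \<partial>lborel)"
      by (rule integral_indicator_lborel(1)[symmetric])
         (auto intro!: comp continuous_on_compose2[OF c\<phi>[of UNIV]] continuous_intros c\<phi>)
    also have "\<dots> = (\<integral>x. indicator Q x * (\<integral>t. indicator {0..l} t * g (x + t *\<^sub>R axis e 1) \<partial>lborel) \<partial>lborel)"
      using l by (simp add: smooth_line_integral[OF \<phi>] g_def)
    also have "\<dots> = (\<integral>x. g x * (\<integral>t. indicator {0..l} t * indicator Q (x - t *\<^sub>R axis e 1) \<partial>lborel) \<partial>lborel)"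
      by (rule translation_Fubini[OF cg comp(1)])
    also have "\<dots> = (\<integral>x. indicator Q x * ((l / 2 + (x $ e - c $ e)) * g x) + indicator Q' x * ((l / 2 - (x $ e - c' $ e)) * g x) \<partial>lborel)"
    proof (rule integral_cong_AE)
      have "{x::real^'n. x $ e = c $ e + l / 2} \<in> null_sets lborel"
        using negligible_hyperplane_cart[of e "c $ e + l / 2"]
        by (auto simp: null_sets_def negligible_iff_null_sets completion.complete2 null_sets_completion_iff)
      then have "AE x::real^'n in lborel. x $ e \<noteq> c $ e + l / 2"
        by (rule AE_I') auto
      then show "AE x in lborel. g x * (\<integral>t. indicator {0..l} t * indicator Q (x - t *\<^sub>R axis e 1) \<partial>lborel) =
         indicator Q x * ((l / 2 + (x $ e - c $ e)) * g x) + indicator Q' x * ((l / 2 - (x $ e - c' $ e)) * g x)"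
        by eventually_elim (simp add: w algebra_simps)
      have [measurable]: "g \<in> borel_measurable borel" "Q \<in> sets borel" "Q' \<in> sets borel"
        using cg comp by (auto intro: borel_measurable_continuous_onI borel_compact)
      show "(\<lambda>x. indicator Q x * ((l / 2 + (x $ e - c $ e)) * g x) + indicator Q' x * ((l / 2 - (x $ e - c' $ e)) * g x)) \<in> borel_measurable lborel"
        by measurable
      show "(\<lambda>x. g x * (\<integral>t. indicator {0..l} t * indicator Q (x - t *\<^sub>R axis e 1) \<partial>lborel)) \<in> borel_measurable lborel"
        by measurable
    qed
    also have "\<dots> = integral Q (\<lambda>x. (l / 2 + (x $ e - c $ e)) * g x) + integral Q' (\<lambda>x. (l / 2 - (x $ e - c' $ e)) * g x)"
    proof -
      have "continuous_on Q (\<lambda>x. (l / 2 + (x $ e - c $ e)) * g x)"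
        "continuous_on Q' (\<lambda>x. (l / 2 - (x $ e - c' $ e)) * g x)"
        by (intro continuous_intros cg)+
      then show ?thesis
        using integral_indicator_lborel[OF _ comp(1)] integral_indicator_lborel[OF _ comp(2)] by simp
    qed
    finally show ?thesis .
  qed
  have intg: "f integrable_on Q" "f integrable_on Q'" if "continuous_on UNIV f" for f :: "real^'n \<Rightarrow> real"
    using that by (auto simp: Q_def Q'_def tbox_def intro!: integrable_continuous intro: continuous_on_subset)
  have c1: "continuous_on UNIV (\<lambda>x. (x $ e - b) * g x)" for b by (intro continuous_intros cg)
  have split: "integral S (\<lambda>x. (a + s * p x) * g x) = a * integral S g + s * integral S (\<lambda>x. p x * g x)"
    if "g integrable_on S" "(\<lambda>x. p x * g x) integrable_on S" for S a s and p :: "real^'n \<Rightarrow> real"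
  proof -
    have "(\<lambda>x. (a + s * p x) * g x) = (\<lambda>x. a * g x + s * (p x * g x))" by (auto simp: algebra_simps)
    then show ?thesis
      using that by (simp add: integral_add integrable_on_cmult_left[where 'b = real, simplified])
  qed
  have "integral Q (\<lambda>x. (l / 2 + (x $ e - c $ e)) * g x) = l / 2 * integral Q g + integral Q (\<lambda>x. (x $ e - c $ e) * g x)"
    using split[OF intg(1)[OF cg] intg(1)[OF c1], of "l / 2" 1] by simp
  moreover have "integral Q' (\<lambda>x. (l / 2 - (x $ e - c' $ e)) * g x) = l / 2 * integral Q' g - integral Q' (\<lambda>x. (x $ e - c' $ e) * g x)"
  proof -
    have "(\<lambda>x. (l / 2 - (x $ e - c' $ e)) * g x) = (\<lambda>x. (l / 2 + -1 * (x $ e - c' $ e)) * g x)"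
      by (simp add: algebra_simps)
    then show ?thesis using split[OF intg(2)[OF cg] intg(2)[OF c1], of "l / 2" "-1" "c' $ e"] by simp
  qed
  ultimately have "(integral Q' \<phi> + integral Q' (\<lambda>x. (x $ e - c' $ e) * g x)) - (integral Q \<phi> + integral Q (\<lambda>x. (x $ e - c $ e) * g x)) =
      l / 2 * (integral Q g + integral Q' g)"
    using int by (simp add: algebra_simps)
  then have "integral Q' (\<lambda>x. \<phi> x + (x $ e - c' $ e) * g x) - integral Q (\<lambda>x. \<phi> x + (x $ e - c $ e) * g x) =
      l / 2 * (integral Q g + integral Q' g)"
    using intg[OF c\<phi>] intg[OF c1] by (simp add: integral_add)
  then have "integral Q' (\<lambda>x. \<phi> x + (x $ e - c' $ e) * g x) / (\<Prod>i\<in>UNIV. r i) - integral Q (\<lambda>x. \<phi> x + (x $ e - c $ e) * g x) / (\<Prod>i\<in>UNIV. r i) =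
      l / 2 * (integral Q g / (\<Prod>i\<in>UNIV. r i) + integral Q' g / (\<Prod>i\<in>UNIV. r i))"
    by (simp only: diff_divide_distrib[symmetric] add_divide_distrib[symmetric] times_divide_eq_right)
  then show ?thesis
    unfolding face_mean_def bavg_def Q_def Q'_def c'_def l_def g_def .
qed

subsection \<open>The multiscale estimate for smooth functions\<close>

text \<open>\<open>N\<close> rounds of trisections, each through all directions in
  \<open>bs\<close>, so that a round leads from cubes to cubes of a third of the size. Rounds are
  appended at the end: the word of a cube is a prefix of the words of its descendants.\<close>

primrec levels :: "'e list \<Rightarrow> nat \<Rightarrow> 'e list" where
  "levels bs 0 = []"
| "levels bs (Suc N) = levels bs N @ bs"

lemma length_levels: "length (levels bs N) = N * length bs"
  by (induction N) auto

lemma count_list_levels: "count_list (levels bs N) e = N * count_list bs e"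
  by (induction N) auto

lemma digits_update: "xs \<in> digits n \<Longrightarrow> d \<in> {-1, 0, 1} \<Longrightarrow> xs[i := d] \<in> digits n"
  unfolding digits_def using set_update_subset_insert[of xs i d] by auto

locale triadic_smooth =
  fixes \<phi> :: "real^'n \<Rightarrow> real" and bs :: "'n list" and c0 :: "real^'n" and L :: real
  assumes smooth: "smooth \<phi>" and bs: "distinct bs" "set bs = UNIV" and L: "0 < L"
begin

definition r :: "nat \<Rightarrow> 'n \<Rightarrow> real" where "r N = (\<lambda>_. L / 3 ^ N)"

definition C :: "nat \<Rightarrow> int list \<Rightarrow> real^'n" where "C N ds = subc (levels bs N) c0 (\<lambda>_. L) ds"

definition F :: "nat \<Rightarrow> 'n \<Rightarrow> int list \<Rightarrow> real" where
  "F N e ds = bavg (C N ds) (r N) (partial_deriv e \<phi>)"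

definition U :: "nat \<Rightarrow> 'n \<Rightarrow> int list \<Rightarrow> real" where
  "U N e ds = face_mean \<phi> e (C N ds) (r N)"

definition X :: "nat \<Rightarrow> 'n \<Rightarrow> int list \<Rightarrow> real" where
  "X N e ds = dmean bs (\<lambda>ys. (C (Suc N) (ds @ ys) $ e - C N ds $ e) * F (Suc N) e (ds @ ys))"

text \<open>\<open>X\<close> is the error made when the face means on one scale are averaged from those on the next, because the
  formula for them is centred at the middle of the box. It vanishes in the limit, and \<open>V\<close> tends to \<open>\<phi>\<close>
  minus its mean, since there the face means in all directions coincide with \<open>\<phi>\<close> and the sum in \<open>mtrans\<close>
  telescopes.\<close>

definition V :: "nat \<Rightarrow> int list \<Rightarrow> real" where
  "V N = mtrans (levels bs N) (U N)"

lemma length_bs: "length bs = CARD('n)"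
  using bs by (metis distinct_card)

lemma length_lev: "length (levels bs N) = N * CARD('n)"
  by (simp add: length_levels length_bs)

lemma r_pos: "0 < r N i"
  using L by (simp add: r_def)

lemma subr_levels: "subr (levels bs N) (\<lambda>_. L) = r N"
proof -
  have "distinct xs \<Longrightarrow> i \<in> set xs \<Longrightarrow> count_list xs i = 1" for i and xs :: "'n list"
    by (induction xs) (auto simp: count_list_0_iff)
  then have "count_list bs i = 1" for i using bs by simp
  then show ?thesis by (auto simp: subr_eq r_def count_list_levels)
qed

lemma subr_bs: "subr bs (r N) = r (Suc N)"
  using subr_append[of "levels bs N" bs "\<lambda>_. L"] subr_levels[of N] subr_levels[of "Suc N"] by simp

lemma C_append:
  "length ds = length (levels bs N) \<Longrightarrow> C (Suc N) (ds @ ys) = subc bs (C N ds) (r N) ys"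
  by (simp add: C_def subc_append subr_levels)

lemma integrable: "continuous_on UNIV f \<Longrightarrow> f integrable_on tbox c rr" for f :: "real^'n \<Rightarrow> real"
  unfolding tbox_def by (auto intro!: integrable_continuous intro: continuous_on_subset)

lemma continuous_partial: "continuous_on S (partial_deriv e \<phi>)"
  by (intro smooth_continuous smooth_partial_deriv smooth)

lemma C_offset:
  assumes "length ds = length (levels bs N)" "ys \<in> digits (length bs)"
  shows "\<bar>C (Suc N) (ds @ ys) $ e - C N ds $ e\<bar> \<le> L / 3 ^ Suc N"
proof -
  obtain i where i: "i < length bs" "bs ! i = e" using bs(2) by (metis in_set_conv_nth iso_tuple_UNIV_I)
  have len: "length ys = length bs" using assms(2) by (simp add: digits_def)
  have "ys ! i \<in> set ys" using i len by simp
  then have "ys ! i \<in> {-1, 0, 1}" using assms(2) unfolding digits_def by blast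
  moreover have "C (Suc N) (ds @ ys) $ e - C N ds $ e = of_int (ys ! i) * (L / 3 ^ N) / 3"
    using subc_component[OF bs(1) len i(1), of "C N ds" "r N"] i assms(1) by (simp add: C_append r_def)
  ultimately show ?thesis using L by auto
qed

lemma dmean_U:
  assumes "length ds = length (levels bs N)"
  shows "dmean bs (\<lambda>ys. U (Suc N) e (ds @ ys)) = U N e ds - X N e ds"
proof -
  let ?f = "\<lambda>c x. \<phi> x + (x $ e - c $ e) * partial_deriv e \<phi> x"
  have cont: "continuous_on UNIV (?f c)" for c
    by (intro continuous_intros smooth_continuous smooth continuous_partial)
  have "U N e ds = dmean bs (\<lambda>ys. bavg (subc bs (C N ds) (r N) ys) (subr bs (r N)) (?f (C N ds)))"
    unfolding U_def face_mean_def by (rule bavg_subdivide[symmetric]) (auto simp: r_pos intro: integrable cont)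
  also have "\<dots> = dmean bs (\<lambda>ys. U (Suc N) e (ds @ ys) + (C (Suc N) (ds @ ys) $ e - C N ds $ e) * F (Suc N) e (ds @ ys))"
  proof (rule dmean_cong)
    fix ys
    let ?c = "C N ds" and ?c' = "C (Suc N) (ds @ ys)"
    \<comment> \<open>Recentring splits the integrand of the parent into that of the child and a
      constant multiple of the partial derivative.\<close>
    have "bavg ?c' (r (Suc N)) (?f ?c) = bavg ?c' (r (Suc N)) (\<lambda>x. ?f ?c' x + (?c' $ e - ?c $ e) * partial_deriv e \<phi> x)"
      by (rule arg_cong[where f = "bavg _ _"]) (auto simp: algebra_simps)
    also have "\<dots> = bavg ?c' (r (Suc N)) (?f ?c') + bavg ?c' (r (Suc N)) (\<lambda>x. (?c' $ e - ?c $ e) * partial_deriv e \<phi> x)"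
      by (intro bavg_add integrable cont continuous_intros continuous_partial)
    finally show "bavg (subc bs ?c (r N) ys) (subr bs (r N)) (?f ?c) =
        U (Suc N) e (ds @ ys) + (?c' $ e - ?c $ e) * F (Suc N) e (ds @ ys)"
      by (simp add: C_append[OF assms, symmetric] subr_bs bavg_cmult U_def face_mean_def F_def)
  qed
  also have "\<dots> = dmean bs (\<lambda>ys. U (Suc N) e (ds @ ys)) + X N e ds"
    by (simp add: dmean_add X_def)
  finally show ?thesis by simp
qed

text \<open>Passing to the next scale has two effects: the coarse increments are recomputed from
  averages of the finer face means, which costs the transform of \<open>X\<close>, and one more
  round of increments is added inside each cube.\<close>

lemma V_Suc:
  assumes "ds \<in> digits (length (levels bs N))"
  shows "V (Suc N) (ds @ ys) = V N ds - mtrans (levels bs N) (X N) ds +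
    mtrans bs (\<lambda>e ys. U (Suc N) e (ds @ ys)) ys"
proof -
  have len: "length ds = length (levels bs N)" using assms by (simp add: digits_def)
  have "mtrans (levels bs N) (\<lambda>e xs. dmean bs (\<lambda>zs. U (Suc N) e (xs @ zs))) ds =
      mtrans (levels bs N) (\<lambda>e xs. U N e xs - X N e xs) ds"
    by (rule mtrans_cong[OF _ assms]) (simp add: dmean_U digits_def)
  then show ?thesis
    unfolding V_def by (simp add: mtrans_append[OF len] mtrans_diff)
qed

section \<open>Size of the increment from one scale to the next\<close>

lemma X_square_le:
  assumes "length ds = length (levels bs N)"
  shows "(X N e ds)\<^sup>2 \<le> (L / 3 ^ Suc N)\<^sup>2 * dmean bs (\<lambda>ys. (F (Suc N) e (ds @ ys))\<^sup>2)"
proof -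
  have "(X N e ds)\<^sup>2 \<le> dmean bs (\<lambda>ys. ((C (Suc N) (ds @ ys) $ e - C N ds $ e) * F (Suc N) e (ds @ ys))\<^sup>2)"
    unfolding X_def by (rule dmean_square_le)
  also have "\<dots> \<le> dmean bs (\<lambda>ys. (L / 3 ^ Suc N)\<^sup>2 * (F (Suc N) e (ds @ ys))\<^sup>2)"
  proof (rule dmean_mono)
    fix ys assume "ys \<in> digits (length bs)"
    from C_offset[OF assms this, of e] have "(C (Suc N) (ds @ ys) $ e - C N ds $ e)\<^sup>2 \<le> (L / 3 ^ Suc N)\<^sup>2"
      using power_mono[of "\<bar>C (Suc N) (ds @ ys) $ e - C N ds $ e\<bar>" "L / 3 ^ Suc N" 2] by simp
    then show "((C (Suc N) (ds @ ys) $ e - C N ds $ e) * F (Suc N) e (ds @ ys))\<^sup>2 \<le> (L / 3 ^ Suc N)\<^sup>2 * (F (Suc N) e (ds @ ys))\<^sup>2"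
      unfolding power_mult_distrib by (rule mult_right_mono) simp
  qed
  finally show ?thesis by (simp only: dmean_cmult)
qed

text \<open>Inside one round there are only \<open>CARD('n)\<close> increments, so they may be
  estimated one by one: through differences of adjacent face means by mean derivatives, and these by
  their mean square over the block.\<close>

lemma block_square_le:
  assumes "length ds = length (levels bs N)" "ys \<in> digits (length bs)"
  shows "(mtrans bs (\<lambda>e ys. U (Suc N) e (ds @ ys)) ys)\<^sup>2 \<le>
    (2 * CARD('n) * 3 ^ CARD('n) * (L / 3 ^ Suc N))\<^sup>2 * dmean bs (\<lambda>ys. \<Sum>e\<in>UNIV. (F (Suc N) e (ds @ ys))\<^sup>2)"
proof -
  define l where "l = L / 3 ^ Suc N"
  have l: "0 < l" using L by (simp add: l_def)
  define D where "D = dmean bs (\<lambda>ys. \<Sum>e\<in>UNIV. (F (Suc N) e (ds @ ys))\<^sup>2)"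
  have D0: "0 \<le> D" unfolding D_def by (intro dmean_nonneg sum_nonneg) simp
  \<comment> \<open>\<open>le_dmean\<close> gives the factor \<open>3 ^ CARD('n)\<close> for the
    squares; enlarging it to \<open>(3 ^ CARD('n))\<^sup>2\<close> keeps \<open>g\<close> free of
    half-integer powers of 3.\<close>
  define g where "g = 3 ^ CARD('n) * sqrt D"
  have Fg: "\<bar>F (Suc N) e (ds @ zs)\<bar> \<le> g" if "zs \<in> digits (length bs)" for e zs
  proof -
    have "(F (Suc N) e (ds @ zs))\<^sup>2 \<le> (\<Sum>e\<in>UNIV. (F (Suc N) e (ds @ zs))\<^sup>2)"
      by (rule member_le_sum) auto
    also have "\<dots> \<le> 3 ^ length bs * D"
      unfolding D_def by (rule le_dmean[OF that]) (intro sum_nonneg, simp)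
    also have "\<dots> \<le> (3 ^ CARD('n))\<^sup>2 * D"
      unfolding length_bs using D0 by (intro mult_right_mono self_le_power) auto
    also have "\<dots> = g\<^sup>2" using D0 by (simp add: g_def power_mult_distrib)
    finally show ?thesis using D0 by (simp add: abs_le_square_iff[symmetric] g_def)
  qed
  have g0: "0 \<le> g" using D0 by (simp add: g_def)
  have "\<bar>mtrans bs (\<lambda>e ys. U (Suc N) e (ds @ ys)) ys\<bar> \<le> real (length bs) * (2 * l * g)"
  proof (rule mtrans_adjacent_bound[OF assms(2)])
    fix i xs and d d' :: int
    assume i: "i < length bs" and xs: "xs \<in> digits (length bs)" and d: "d \<in> {-1, 0, 1}" "d' \<in> {-1, 0, 1}"
    let ?e = "bs ! i"
    define u where "u = (\<lambda>d. U (Suc N) ?e (ds @ xs[i := d]))"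
    have step: "\<bar>u (d + 1) - u d\<bar> \<le> l * g" if dd: "d \<in> {-1, 0, 1}" "d + 1 \<in> {-1, 0, 1}" for d
    proof -
      let ?c = "C (Suc N) (ds @ xs[i := d])"
      have len: "length xs = length bs" using xs by (simp add: digits_def)
      have c: "C (Suc N) (ds @ xs[i := d + 1]) = ?c + axis ?e (r (Suc N) ?e)"
        using subc_update[OF bs(1) len i, of "C N ds" "r N" "d + 1" d]
        by (simp add: C_append[OF assms(1)] r_def mult.commute)
      have "u (d + 1) - u d = r (Suc N) ?e / 2 * (F (Suc N) ?e (ds @ xs[i := d]) + F (Suc N) ?e (ds @ xs[i := d + 1]))"
        unfolding u_def U_def F_def c by (rule face_mean_adjacent[OF smooth r_pos])
      moreover have "r (Suc N) ?e = l" by (simp add: r_def l_def)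
      ultimately have "\<bar>u (d + 1) - u d\<bar> = l / 2 * \<bar>F (Suc N) ?e (ds @ xs[i := d]) + F (Suc N) ?e (ds @ xs[i := d + 1])\<bar>"
        using l by (simp only: abs_mult)
      also have "\<dots> \<le> l / 2 * (g + g)"
        using Fg[OF digits_update[OF xs dd(1), where i = i], where e = ?e]
          Fg[OF digits_update[OF xs dd(2), where i = i], where e = ?e] l
        by (intro mult_left_mono) auto
      finally show ?thesis by simp
    qed
    have "0 \<le> l * g" using l g0 by simp
    \<comment> \<open>Two digits are at most two unit steps apart.\<close>
    then have "\<bar>u d - u d'\<bar> \<le> 2 * l * g"
      using step[of "-1"] step[of 0] d by (auto simp: mult.commute[of g l])
    then show "\<bar>U (Suc N) ?e (ds @ xs[i := d]) - U (Suc N) ?e (ds @ xs[i := d'])\<bar> \<le> 2 * l * g"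
      by (simp add: u_def)
  qed
  then have "\<bar>mtrans bs (\<lambda>e ys. U (Suc N) e (ds @ ys)) ys\<bar> \<le> 2 * CARD('n) * 3 ^ CARD('n) * l * sqrt D"
    by (simp add: length_bs g_def ac_simps)
  then have "\<bar>mtrans bs (\<lambda>e ys. U (Suc N) e (ds @ ys)) ys\<bar>\<^sup>2 \<le> (2 * CARD('n) * 3 ^ CARD('n) * l * sqrt D)\<^sup>2"
    by (rule power_mono) simp
  also have "\<dots> = (2 * CARD('n) * 3 ^ CARD('n) * l)\<^sup>2 * D"
    unfolding power_mult_distrib real_sqrt_pow2[OF D0] ..
  finally show ?thesis unfolding l_def D_def power2_abs .
qed

text \<open>With \<open>k = 2 * CARD('n) * 3 ^ CARD('n)\<close> from \<open>block_square_le\<close>,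
  the two contributions to an increment carry the factor \<open>2 + 2 k\<^sup>2\<close>, which is at
  most \<open>(2 + 2 k)\<^sup>2 = K0\<^sup>2\<close>.\<close>

definition K0 :: real where "K0 = 2 + 4 * CARD('n) * 3 ^ CARD('n)"

text \<open>The correction of the coarse increments runs over all earlier rounds;
  \<open>dmean_mtrans_square\<close> bounds its mean square by that of \<open>X\<close> alone,
  without a factor \<open>N\<close>. The new round is bounded cube by cube.\<close>

lemma increment_square_le:
  assumes "dmean (levels bs (Suc N)) (\<lambda>ds. \<Sum>e\<in>UNIV. (F (Suc N) e ds)\<^sup>2) \<le> B\<^sup>2"
  shows "dmean (levels bs (Suc N)) (\<lambda>zs. (V (Suc N) zs - V N (take (length (levels bs N)) zs))\<^sup>2)
    \<le> (K0 * (L / 3 ^ Suc N) * B)\<^sup>2"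
proof -
  define l where "l = L / 3 ^ Suc N"
  let ?lv = "levels bs N"
  let ?k = "2 * real CARD('n) * 3 ^ CARD('n)"
  define S where "S = (\<lambda>ds. dmean bs (\<lambda>ys. \<Sum>e\<in>UNIV. (F (Suc N) e (ds @ ys))\<^sup>2))"
  have SB: "dmean ?lv S \<le> B\<^sup>2" using assms by (simp add: S_def dmean_append)
  have "dmean (levels bs (Suc N)) (\<lambda>zs. (V (Suc N) zs - V N (take (length ?lv) zs))\<^sup>2) =
      dmean ?lv (\<lambda>ds. dmean bs (\<lambda>ys. (V (Suc N) (ds @ ys) - V N ds)\<^sup>2))"
    unfolding levels.simps dmean_append
    by (intro dmean_cong) (simp add: digits_def)
  also have "\<dots> \<le> dmean ?lv (\<lambda>ds. dmean bs (\<lambda>ys. 2 * (mtrans ?lv (X N) ds)\<^sup>2 + 2 * ((?k * l)\<^sup>2 * S ds)))"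
  proof (intro dmean_mono)
    fix ds ys assume ds: "ds \<in> digits (length ?lv)" and ys: "ys \<in> digits (length bs)"
    let ?a = "mtrans ?lv (X N) ds" and ?b = "mtrans bs (\<lambda>e ys. U (Suc N) e (ds @ ys)) ys"
    have "(V (Suc N) (ds @ ys) - V N ds)\<^sup>2 = (?b - ?a)\<^sup>2" using V_Suc[OF ds] by simp
    also have "\<dots> \<le> 2 * ?a\<^sup>2 + 2 * ?b\<^sup>2"
      using zero_le_power2[of "?b + ?a"] by (simp add: power2_sum power2_diff)
    also have "?b\<^sup>2 \<le> (?k * l)\<^sup>2 * S ds"
      using block_square_le[OF _ ys, of ds N] ds by (simp add: digits_def l_def S_def)
    finally show "(V (Suc N) (ds @ ys) - V N ds)\<^sup>2 \<le> 2 * ?a\<^sup>2 + 2 * ((?k * l)\<^sup>2 * S ds)" by simp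
  qed
  also have "\<dots> = 2 * dmean ?lv (\<lambda>ds. (mtrans ?lv (X N) ds)\<^sup>2) + 2 * ((?k * l)\<^sup>2 * dmean ?lv S)"
    by (simp only: dmean_add dmean_cmult dmean_const)
  also have "dmean ?lv (\<lambda>ds. (mtrans ?lv (X N) ds)\<^sup>2) \<le> l\<^sup>2 * B\<^sup>2"
  proof -
    have "dmean ?lv (\<lambda>ds. (mtrans ?lv (X N) ds)\<^sup>2) \<le> (\<Sum>e\<in>UNIV. dmean ?lv (\<lambda>ds. (X N e ds)\<^sup>2) - (dmean ?lv (X N e))\<^sup>2)"
      by (rule dmean_mtrans_square)
    also have "\<dots> \<le> (\<Sum>e\<in>UNIV. dmean ?lv (\<lambda>ds. l\<^sup>2 * dmean bs (\<lambda>ys. (F (Suc N) e (ds @ ys))\<^sup>2)))"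
    proof (rule sum_mono)
      fix e
      have "dmean ?lv (\<lambda>ds. (X N e ds)\<^sup>2) \<le> dmean ?lv (\<lambda>ds. l\<^sup>2 * dmean bs (\<lambda>ys. (F (Suc N) e (ds @ ys))\<^sup>2))"
        unfolding l_def by (intro dmean_mono X_square_le) (simp add: digits_def)
      then show "dmean ?lv (\<lambda>ds. (X N e ds)\<^sup>2) - (dmean ?lv (X N e))\<^sup>2 \<le> dmean ?lv (\<lambda>ds. l\<^sup>2 * dmean bs (\<lambda>ys. (F (Suc N) e (ds @ ys))\<^sup>2))"
        using zero_le_power2[of "dmean ?lv (X N e)"] by linarith
    qed
    also have "\<dots> = l\<^sup>2 * dmean ?lv S"
      by (simp only: S_def dmean_sum dmean_cmult sum_distrib_left)
    finally show ?thesis using SB mult_left_mono[OF SB, of "l\<^sup>2"] by simp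
  qed
  also have "(?k * l)\<^sup>2 * dmean ?lv S \<le> (?k * l)\<^sup>2 * B\<^sup>2"
    using SB by (intro mult_left_mono) auto
  finally have "dmean (levels bs (Suc N)) (\<lambda>zs. (V (Suc N) zs - V N (take (length ?lv) zs))\<^sup>2)
      \<le> (2 + 2 * ?k\<^sup>2) * (l * B)\<^sup>2"
    by (simp add: power_mult_distrib algebra_simps)
  also have "\<dots> \<le> K0\<^sup>2 * (l * B)\<^sup>2"
  proof (rule mult_right_mono)
    have "0 \<le> ?k" by simp
    then show "2 + 2 * ?k\<^sup>2 \<le> K0\<^sup>2" by (simp add: K0_def power2_sum power_mult_distrib)
  qed simp
  also have "\<dots> = (K0 * (L / 3 ^ Suc N) * B)\<^sup>2"
    by (simp only: l_def power_mult_distrib[symmetric] mult.assoc)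
  finally show ?thesis .
qed

text \<open>Minkowski's inequality over the scales. \<open>V 0\<close> vanishes, but
  \<open>dmean_Minkowski\<close> asks for positive bounds: hence the starting value
  \<open>\<delta>\<close> and the strict positivity of \<open>B\<close>.\<close>

lemma V_powr_le:
  assumes p: "2 \<le> p" "CARD('n) * (1/2 - 1/p) = 1 - s"
    and B: "\<And>N. 0 < B N"
      "\<And>N. dmean (levels bs (Suc N)) (\<lambda>ds. \<Sum>e\<in>UNIV. (F (Suc N) e ds)\<^sup>2) \<le> (B (Suc N))\<^sup>2"
    and "0 < \<delta>"
  shows "dmean (levels bs N) (\<lambda>ds. \<bar>V N ds\<bar> powr p) \<le>
    (\<delta> + K0 * L * (\<Sum>k=1..N. 3 powr (- s * k) * B k)) powr p"
proof (induction N)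
  case 0
  show ?case using p by (simp add: V_def)
next
  case (Suc N)
  let ?lv = "levels bs (Suc N)"
  let ?old = "\<lambda>zs. V N (take (length (levels bs N)) zs)" and ?inc = "\<lambda>zs. V (Suc N) zs - V N (take (length (levels bs N)) zs)"
  define A where "A = \<delta> + K0 * L * (\<Sum>k=1..N. 3 powr (- s * k) * B k)"
  have K0: "0 < K0" by (simp add: K0_def add_pos_nonneg)
  have A: "0 < A"
    unfolding A_def using K0 L B(1) \<open>0 < \<delta>\<close>
    by (intro add_pos_nonneg mult_nonneg_nonneg sum_nonneg) (auto intro: less_imp_le)
  define D where "D = K0 * (L / 3 ^ Suc N) * B (Suc N)"
  have D: "0 < D" using K0 L B(1) by (simp add: D_def)
  have old: "dmean ?lv (\<lambda>zs. \<bar>?old zs\<bar> powr p) \<le> A powr p"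
  proof -
    have "dmean ?lv (\<lambda>zs. \<bar>?old zs\<bar> powr p) = dmean (levels bs N) (\<lambda>ds. dmean bs (\<lambda>ys. \<bar>V N ds\<bar> powr p))"
      unfolding levels.simps dmean_append by (intro dmean_cong) (simp add: digits_def)
    then show ?thesis using Suc.IH by (simp add: A_def)
  qed
  have "(3 ^ length ?lv) powr (1/2 - 1/p) * D = 3 powr (- s * Suc N) * (K0 * L * B (Suc N))"
  proof -
    have "((3::real) ^ length ?lv) powr (1/2 - 1/p) = 3 powr (real (Suc N) * (CARD('n) * (1/2 - 1/p)))"
    proof -
      have "(3::real) ^ length ?lv = 3 powr (real (Suc N) * CARD('n))"
        using powr_realpow[of 3 "Suc N * CARD('n)"] by (simp only: length_lev of_nat_mult zero_less_numeral)
      then show ?thesis by (simp add: powr_powr mult.assoc)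
    qed
    also have "\<dots> = 3 powr (- s * Suc N) * 3 ^ Suc N"
    proof -
      have "real (Suc N) * (1 - s) = - s * Suc N + real (Suc N)" by (simp add: algebra_simps)
      then show ?thesis
        unfolding p by (simp only: powr_add powr_realpow zero_less_numeral)
    qed
    finally show ?thesis by (simp add: D_def)
  qed
  then have "dmean ?lv (\<lambda>zs. \<bar>?inc zs\<bar> powr p) \<le> (3 powr (- s * Suc N) * (K0 * L * B (Suc N))) powr p"
    using dmean_powr_le_square[OF p(1) D, of ?lv ?inc] increment_square_le[OF B(2)] by (simp add: D_def)
  then have "dmean ?lv (\<lambda>zs. (\<bar>?old zs\<bar> + \<bar>?inc zs\<bar>) powr p) \<le> (A + 3 powr (- s * Suc N) * (K0 * L * B (Suc N))) powr p"
    using K0 L B(1) A old p(1) by (intro dmean_Minkowski) auto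
  moreover have "dmean ?lv (\<lambda>zs. \<bar>V (Suc N) zs\<bar> powr p) \<le> dmean ?lv (\<lambda>zs. (\<bar>?old zs\<bar> + \<bar>?inc zs\<bar>) powr p)"
    using p(1) by (intro dmean_mono powr_mono2) auto
  ultimately show ?case by (simp add: A_def algebra_simps)
qed

text \<open>A face mean is an average plus a first moment \<open>?M\<close>. The averages are the
  same for every direction and telescope; what remains is the transform of the moments, which are of
  the order of the cube size.\<close>

lemma V_eq:
  assumes "ds \<in> digits (length (levels bs N))"
  shows "V N ds = bavg (C N ds) (r N) \<phi> - bavg c0 (\<lambda>_. L) \<phi> +
    mtrans (levels bs N) (\<lambda>e ds. bavg (C N ds) (r N) (\<lambda>x. (x $ e - C N ds $ e) * partial_deriv e \<phi> x)) ds"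
    (is "_ = ?P ds - _ + mtrans _ ?M ds")
proof -
  have len: "length ds = length (levels bs N)" using assms by (simp add: digits_def)
  have "U N e xs - ?M e xs = ?P xs" for e xs
  proof -
    have "\<phi> integrable_on tbox (C N xs) (r N)"
      "(\<lambda>x. (x $ e - C N xs $ e) * partial_deriv e \<phi> x) integrable_on tbox (C N xs) (r N)"
      by (intro integrable continuous_intros smooth_continuous[OF smooth] continuous_partial)+
    then show ?thesis by (simp add: U_def face_mean_def bavg_add)
  qed
  then have "mtrans (levels bs N) (U N) ds - mtrans (levels bs N) ?M ds = mtrans (levels bs N) (\<lambda>_. ?P) ds"
    unfolding mtrans_diff[symmetric] by simp
  also have "\<dots> = ?P ds - dmean (levels bs N) ?P" by (rule mtrans_same[OF len])
  also have "dmean (levels bs N) ?P = bavg c0 (\<lambda>_. L) \<phi>"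
    unfolding C_def subr_levels[symmetric]
    by (rule bavg_subdivide) (auto simp: L intro!: integrable smooth_continuous smooth)
  finally show ?thesis by (simp add: V_def)
qed

lemma bavg_const: "(\<And>i. 0 < rr i) \<Longrightarrow> bavg c rr (\<lambda>x. k) = k" for c :: "real^'n"
proof -
  assume rr: "\<And>i. 0 < rr i"
  then have "(\<Prod>i\<in>UNIV. rr i) \<noteq> 0" by (metis finite less_irrefl prod_zero_iff)
  then show "bavg c rr (\<lambda>x. k) = k"
    using content_tbox[of rr c] rr by (simp add: bavg_def tbox_def)
qed

lemma C_box_subset:
  assumes "ds \<in> digits (length (levels bs N))"
  shows "tbox (C N ds) (r N) \<subseteq> tbox c0 (\<lambda>_. L)"
  unfolding C_def subr_levels[symmetric] by (rule tbox_sub_subset) (use assms L in auto)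

text \<open>The starting value of \<open>V_powr_le\<close>, the transform of the first moments and
  the oscillation of \<open>\<phi>\<close> inside a small cube contribute
  \<open>\<delta> / 4\<close> each, once \<open>N\<close> is large. The regularity of
  \<open>\<phi>\<close> affects only the choice of \<open>N\<close>, not the bound.\<close>

lemma bavg_powr_le:
  assumes p: "2 \<le> p" "CARD('n) * (1/2 - 1/p) = 1 - s" and s: "0 < s"
    and B: "\<And>N. 0 < B N"
      "\<And>N. dmean (levels bs (Suc N)) (\<lambda>ds. \<Sum>e\<in>UNIV. (F (Suc N) e ds)\<^sup>2) \<le> (B (Suc N))\<^sup>2"
    and S: "\<And>N. (\<Sum>k=1..N. 3 powr (- s * real k) * B k) \<le> S"
    and \<delta>: "0 < \<delta>"
  shows "bavg c0 (\<lambda>_. L) (\<lambda>x. \<bar>\<phi> x - bavg c0 (\<lambda>_. L) \<phi>\<bar> powr p) \<le> (K0 * L * S + \<delta>) powr p"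
proof -
  let ?Q = "tbox c0 (\<lambda>_. L)"
  define m where "m = bavg c0 (\<lambda>_. L) \<phi>"
  have K0: "0 < K0" by (simp add: K0_def add_pos_nonneg)
  have compQ: "compact ?Q" by (simp add: tbox_def)
  have "continuous_on ?Q (\<lambda>x. \<Sum>e\<in>UNIV. \<bar>partial_deriv e \<phi> x\<bar>)"
    by (intro continuous_intros continuous_partial)
  then have "bounded ((\<lambda>x. \<Sum>e\<in>UNIV. \<bar>partial_deriv e \<phi> x\<bar>) ` ?Q)"
    by (intro compact_imp_bounded compact_continuous_image compQ)
  then obtain G where G: "0 < G" "\<And>x. x \<in> ?Q \<Longrightarrow> \<bar>\<Sum>e\<in>UNIV. \<bar>partial_deriv e \<phi> x\<bar>\<bar> \<le> G"
    unfolding bounded_pos by auto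
  have G': "\<bar>partial_deriv e \<phi> x\<bar> \<le> G" if "x \<in> ?Q" for e x
    using G(2)[OF that] member_le_sum[of e UNIV "\<lambda>e. \<bar>partial_deriv e \<phi> x\<bar>"] by simp
  have unif: "uniformly_continuous_on ?Q \<phi>"
    by (intro compact_uniformly_continuous smooth_continuous smooth compQ)
  have "\<exists>\<eta>>0. \<forall>x\<in>?Q. \<forall>y\<in>?Q. dist y x < \<eta> \<longrightarrow> dist (\<phi> y) (\<phi> x) < \<delta> / 4"
    by (rule unif[unfolded uniformly_continuous_on_def, rule_format]) (use \<delta> in simp)
  then obtain \<eta> where \<eta>: "0 < \<eta>" "\<And>x y. x \<in> ?Q \<Longrightarrow> y \<in> ?Q \<Longrightarrow> dist y x < \<eta> \<Longrightarrow> dist (\<phi> y) (\<phi> x) < \<delta> / 4"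
    by blast
  let ?c = "real CARD('n) * L"
  have "(\<lambda>N. ?c * (1 / 3) ^ N) \<longlonglongrightarrow> ?c * 0" by (intro tendsto_mult tendsto_const LIMSEQ_realpow_zero) auto
  moreover have "(\<lambda>N. ?c * G * (3 powr (- s)) ^ N) \<longlonglongrightarrow> ?c * G * 0"
    using powr_less_mono[of "-s" 0 3] s by (intro tendsto_mult tendsto_const LIMSEQ_realpow_zero) auto
  \<comment> \<open>The first condition makes the cubes finer than the modulus of continuity, the
    second makes the transform of the moments small in \<open>L^p\<close>: their size
    \<open>3 powr (-N)\<close> and the cost of the inverse inequality leave
    \<open>3 powr (-s N)\<close>, which decays because \<open>s > 0\<close>.\<close>
  ultimately have "\<forall>\<^sub>F N in sequentially. ?c * (1 / 3) ^ N < \<eta> \<and> ?c * G * (3 powr (- s)) ^ N < \<delta> / 4"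
    using \<eta>(1) \<delta> by (intro eventually_conj order_tendstoD(2)[where y = "?c * 0"] order_tendstoD(2)[where y = "?c * G * 0"]) auto
  from eventually_happens'[OF sequentially_bot this]
  obtain N where N: "?c * (1 / 3) ^ N < \<eta>" "?c * G * (3 powr (- s)) ^ N < \<delta> / 4"
    by blast
  let ?lv = "levels bs N"
  define M where "M = (\<lambda>e ds. bavg (C N ds) (r N) (\<lambda>x. (x $ e - C N ds $ e) * partial_deriv e \<phi> x))"
  define R where "R = mtrans ?lv M"
  have M: "\<bar>M e ds\<bar> \<le> L / 3 ^ N * G" if ds: "ds \<in> digits (length ?lv)" for e ds
    unfolding M_def
  proof (rule bavg_abs_le[OF r_pos])
    show "(\<lambda>x. (x $ e - C N ds $ e) * partial_deriv e \<phi> x) integrable_on tbox (C N ds) (r N)"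
      by (intro integrable continuous_intros continuous_partial)
    fix x assume x: "x \<in> tbox (C N ds) (r N)"
    have "C N ds $ e - L / 3 ^ N / 2 \<le> x $ e" "x $ e \<le> C N ds $ e + L / 3 ^ N / 2"
      using x[unfolded mem_tbox, rule_format, of e] by (auto simp: r_def)
    moreover have "0 < L / 3 ^ N" using L by simp
    ultimately have "\<bar>x $ e - C N ds $ e\<bar> \<le> L / 3 ^ N" by (auto simp: abs_le_iff)
    then show "\<bar>(x $ e - C N ds $ e) * partial_deriv e \<phi> x\<bar> \<le> L / 3 ^ N * G"
      unfolding abs_mult using G' x C_box_subset[OF ds] L by (intro mult_mono) auto
  qed
  \<comment> \<open>Orthogonality again prevents a factor \<open>N\<close>.\<close>
  have R2: "dmean ?lv (\<lambda>ds. (R ds)\<^sup>2) \<le> (?c * G / 3 ^ N)\<^sup>2"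
  proof -
    have "dmean ?lv (\<lambda>ds. (R ds)\<^sup>2) \<le> (\<Sum>e\<in>UNIV. dmean ?lv (\<lambda>ds. (M e ds)\<^sup>2) - (dmean ?lv (M e))\<^sup>2)"
      unfolding R_def by (rule dmean_mtrans_square)
    also have "\<dots> \<le> (\<Sum>e\<in>(UNIV :: 'n set). (L / 3 ^ N * G)\<^sup>2)"
    proof (rule sum_mono)
      fix e
      have "dmean ?lv (\<lambda>ds. (M e ds)\<^sup>2) \<le> dmean ?lv (\<lambda>ds. (L / 3 ^ N * G)\<^sup>2)"
        using M power_mono[OF M abs_ge_zero, of _ _ 2] by (intro dmean_mono) simp
      then show "dmean ?lv (\<lambda>ds. (M e ds)\<^sup>2) - (dmean ?lv (M e))\<^sup>2 \<le> (L / 3 ^ N * G)\<^sup>2"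
        using zero_le_power2[of "dmean ?lv (M e)"] unfolding dmean_const by linarith
    qed
    also have "\<dots> = real CARD('n) * (L / 3 ^ N * G)\<^sup>2" by simp
    also have "\<dots> \<le> (real CARD('n))\<^sup>2 * (L / 3 ^ N * G)\<^sup>2"
      by (intro mult_right_mono self_le_power) auto
    finally show ?thesis by (simp add: power_mult_distrib power_divide mult_ac)
  qed
  have Rp: "dmean ?lv (\<lambda>ds. \<bar>R ds\<bar> powr p) \<le> (\<delta> / 4) powr p"
  proof -
    have pos: "0 < ?c * G / 3 ^ N" using L G(1) by simp
    have "((3::real) ^ length ?lv) powr (1/2 - 1/p) = 3 powr (real N * (CARD('n) * (1/2 - 1/p)))"
    proof -
      have "(3::real) ^ length ?lv = 3 powr (real N * CARD('n))"
        using powr_realpow[of 3 "N * CARD('n)"] by (simp only: length_lev of_nat_mult zero_less_numeral)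
      then show ?thesis by (simp add: powr_powr mult.assoc)
    qed
    also have "\<dots> = (3 powr (- s)) ^ N * 3 ^ N"
    proof -
      have "real N * (1 - s) = real N * (- s) + real N" by (simp add: algebra_simps)
      moreover have "3 powr (real N * (- s)) = (3 powr (- s)) ^ N" by (simp add: powr_power mult.commute)
      ultimately show ?thesis
        unfolding p by (simp only: powr_add powr_realpow zero_less_numeral)
    qed
    finally have "((3::real) ^ length ?lv) powr (1/2 - 1/p) * (?c * G / 3 ^ N) = ?c * G * (3 powr (- s)) ^ N"
      by simp
    then have "dmean ?lv (\<lambda>ds. \<bar>R ds\<bar> powr p) \<le> (?c * G * (3 powr (- s)) ^ N) powr p"
      using dmean_powr_le_square[OF p(1) pos R2] by simp
    also have "\<dots> \<le> (\<delta> / 4) powr p"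
      using N(2) p(1) L G(1) by (intro powr_mono2) auto
    finally show ?thesis .
  qed
  define \<Sigma> where "\<Sigma> = (\<Sum>k=1..N. 3 powr (- s * real k) * B k)"
  have \<Sigma>: "0 \<le> \<Sigma>" "\<Sigma> \<le> S"
    unfolding \<Sigma>_def by (intro sum_nonneg mult_nonneg_nonneg powr_ge_zero less_imp_le[OF B(1)]) (rule S)
  have VR: "dmean ?lv (\<lambda>ds. \<bar>\<bar>V N ds\<bar> + \<bar>R ds\<bar>\<bar> powr p) \<le> (\<delta> / 4 + K0 * L * \<Sigma> + \<delta> / 4) powr p"
    using dmean_Minkowski[OF _ _ _ V_powr_le[OF p B] Rp, of "\<delta> / 4"] p(1) \<delta> K0 L \<Sigma>
    by (simp add: \<Sigma>_def add_pos_nonneg)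
  have intp: "(\<lambda>x. \<bar>\<phi> x - m\<bar> powr p) integrable_on tbox c rr" for c rr
    using p(1) by (intro integrable continuous_on_powr' continuous_intros smooth_continuous smooth) auto
  \<comment> \<open>In a small cube \<open>\<phi>\<close> is within \<open>\<delta> / 4\<close> of
    its average there, and by \<open>V_eq\<close> this average minus \<open>m\<close> is
    \<open>V N ds - R ds\<close>.\<close>
  have pt: "bavg (C N ds) (r N) (\<lambda>x. \<bar>\<phi> x - m\<bar> powr p) \<le> (\<bar>\<bar>V N ds\<bar> + \<bar>R ds\<bar>\<bar> + \<bar>\<delta> / 4\<bar>) powr p"
    if ds: "ds \<in> digits (length ?lv)" for ds
  proof (rule bavg_le[OF r_pos])
    show "(\<lambda>x. \<bar>\<phi> x - m\<bar> powr p) integrable_on tbox (C N ds) (r N)" by (rule intp)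
    fix x assume x: "x \<in> tbox (C N ds) (r N)"
    have "\<bar>bavg (C N ds) (r N) (\<lambda>y. \<phi> x - \<phi> y)\<bar> \<le> \<delta> / 4"
    proof (rule bavg_abs_le[OF r_pos])
      show "(\<lambda>y. \<phi> x - \<phi> y) integrable_on tbox (C N ds) (r N)"
        by (intro integrable continuous_intros smooth_continuous smooth)
      fix y assume y: "y \<in> tbox (C N ds) (r N)"
      have "norm (x - y) \<le> (\<Sum>i\<in>UNIV. \<bar>(x - y) $ i\<bar>)" by (rule norm_le_l1_cart)
      also have "\<dots> \<le> (\<Sum>i\<in>(UNIV::'n set). L / 3 ^ N)"
      proof (rule sum_mono)
        fix i
        show "\<bar>(x - y) $ i\<bar> \<le> L / 3 ^ N"
          using x[unfolded mem_tbox, rule_format, of i] y[unfolded mem_tbox, rule_format, of i]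
          by (auto simp: r_def abs_le_iff)
      qed
      also have "\<dots> = ?c * (1 / 3) ^ N" by (simp add: power_one_over)
      also have "\<dots> < \<eta>" by (rule N(1))
      finally have "dist x y < \<eta>" by (simp add: dist_norm)
      then show "\<bar>\<phi> x - \<phi> y\<bar> \<le> \<delta> / 4"
        using \<eta>(2)[of y x] x y C_box_subset[OF ds]
        by (metis dist_real_def less_imp_le subsetD)
    qed
    moreover have "bavg (C N ds) (r N) (\<lambda>y. \<phi> x - \<phi> y) = \<phi> x - bavg (C N ds) (r N) \<phi>"
      by (subst bavg_diff) (auto intro!: integrable smooth_continuous smooth smooth_const simp: bavg_const r_pos)
    ultimately have "\<bar>\<phi> x - m\<bar> \<le> \<bar>V N ds\<bar> + \<bar>R ds\<bar> + \<delta> / 4"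
      using V_eq[OF ds] unfolding R_def M_def m_def by linarith
    then show "\<bar>\<phi> x - m\<bar> powr p \<le> (\<bar>\<bar>V N ds\<bar> + \<bar>R ds\<bar>\<bar> + \<bar>\<delta> / 4\<bar>) powr p"
      using p(1) \<delta> by (intro powr_mono2) auto
  qed
  have "bavg c0 (\<lambda>_. L) (\<lambda>x. \<bar>\<phi> x - m\<bar> powr p) = dmean ?lv (\<lambda>ds. bavg (C N ds) (r N) (\<lambda>x. \<bar>\<phi> x - m\<bar> powr p))"
    unfolding C_def subr_levels[symmetric]
    by (rule bavg_subdivide[symmetric])
       (simp_all add: L intp)
  also have "\<dots> \<le> dmean ?lv (\<lambda>ds. (\<bar>\<bar>V N ds\<bar> + \<bar>R ds\<bar>\<bar> + \<bar>\<delta> / 4\<bar>) powr p)"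
    by (rule dmean_mono) (rule pt)
  also have "\<dots> \<le> (\<delta> / 4 + K0 * L * \<Sigma> + \<delta> / 4 + \<delta> / 4) powr p"
    by (rule dmean_Minkowski[OF _ _ _ VR]) (use p(1) \<delta> K0 L \<Sigma> in \<open>auto intro!: add_pos_nonneg\<close>)
  also have "\<dots> \<le> (K0 * L * S + \<delta>) powr p"
  proof (rule powr_mono2)
    have "K0 * L * \<Sigma> \<le> K0 * L * S" using K0 L \<Sigma> by (intro mult_left_mono) auto
    then show "\<delta> / 4 + K0 * L * \<Sigma> + \<delta> / 4 + \<delta> / 4 \<le> K0 * L * S + \<delta>" using \<delta> by linarith
    show "0 \<le> \<delta> / 4 + K0 * L * \<Sigma> + \<delta> / 4 + \<delta> / 4" using \<delta> K0 L \<Sigma> by simp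
  qed (use p in simp)
  finally show ?thesis by (simp add: m_def)
qed

end

subsection \<open>Test functions\<close>

lemma vec_nth_measurable [measurable]: "(\<lambda>v::('a::real_normed_vector)^'n. v $ i) \<in> borel_measurable borel"
  by (intro borel_measurable_continuous_onI continuous_intros)

lemma norm_axis_real: "norm (axis e x :: real^'n) = \<bar>x\<bar>"
  by (simp add: norm_eq_sqrt_inner inner_axis_axis)

lemma test_function_outside:
  assumes "test_function U \<psi>" "x \<notin> U"
  shows "\<psi> x = 0" "grad \<psi> x = 0"
proof -
  let ?S = "closure {x. \<psi> x \<noteq> 0}"
  have x: "x \<in> - ?S" using assms by (auto simp: test_function_def)
  then show "\<psi> x = 0" using closure_subset[of "{x. \<psi> x \<noteq> 0}"] by auto
  have "(\<psi> has_derivative (\<lambda>h. 0)) (at x)"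
  proof (rule has_derivative_transform_within_open[OF _ _ x])
    show "((\<lambda>x. 0) has_derivative (\<lambda>h. 0)) (at x)" by simp
    show "open (- ?S)" by (intro open_Compl closed_closure)
    show "0 = \<psi> y" if "y \<in> - ?S" for y using that closure_subset[of "{x. \<psi> x \<noteq> 0}"] by auto
  qed
  then show "grad \<psi> x = 0" by (simp add: grad_def partial_deriv_eq vec_eq_iff)
qed

lemma integral_lebesgue_on_supported:
  fixes f :: "real^'n \<Rightarrow> real"
  assumes "continuous_on UNIV f" "open U" "bounded U" "\<And>x. x \<notin> U \<Longrightarrow> f x = 0"
  shows "integrable lborel f" "integrable (lebesgue_on U) f" "(LINT x|lebesgue_on U. f x) = (\<integral>x. f x \<partial>lborel)"
proof -
  have ind: "f = (\<lambda>x. indicator (closure U) x * f x)"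
    using assms(4) closure_subset[of U] by (auto simp: indicator_def fun_eq_iff)
  have "integrable lborel (\<lambda>x. indicator (closure U) x * f x)"
    using assms by (intro integral_indicator_lborel) (auto intro: continuous_on_subset)
  then show int: "integrable lborel f" using ind by simp
  have ind': "(\<lambda>x. indicator U x * f x) = f"
    using assms(4) by (auto simp: indicator_def fun_eq_iff)
  have U: "U \<in> sets lebesgue" using assms(2) by auto
  have m: "f \<in> borel_measurable borel" using assms(1) by (rule borel_measurable_continuous_onI)
  have "integrable lebesgue f" using int m by (simp add: integrable_completion)
  then show "integrable (lebesgue_on U) f"
    using U by (simp add: integrable_restrict_space ind')
  show "(LINT x|lebesgue_on U. f x) = (\<integral>x. f x \<partial>lborel)"
    using U m by (simp add: integral_restrict_space ind' integral_completion)
qed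

text \<open>By \<open>translation_Fubini\<close> the integral equals that of
  \<open>\<psi> (x + axis e 1) - \<psi> x\<close>, which vanishes by translation invariance. The
  ball contains every backward unit segment from \<open>U\<close>, so the weight is 1 on
  \<open>U\<close>. This is why a change by a test function preserves mean gradients.\<close>

lemma test_function_integral_partial:
  assumes \<psi>: "test_function U \<psi>" and U: "open U" "bounded U"
  shows "(LINT x|lebesgue_on U. partial_deriv e \<psi> x) = 0"
proof -
  have sm: "smooth \<psi>" using \<psi> by (simp add: test_function_def)
  define g where "g = partial_deriv e \<psi>"
  have cg: "continuous_on S g" for S unfolding g_def by (intro smooth_continuous smooth_partial_deriv sm)
  have c\<psi>: "continuous_on S \<psi>" for S by (intro smooth_continuous sm)
  have g0: "g x = 0" if "x \<notin> U" for x
    using test_function_outside(2)[OF \<psi> that] by (simp add: g_def flip: grad_component)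
  obtain r where "\<forall>x\<in>U. norm x \<le> r" using U(2) unfolding bounded_iff by blast
  then have r: "U \<subseteq> cball 0 r" by auto
  define Q where "Q = cball (0::real^'a) (r + 1)"
  have Q: "x - t *\<^sub>R axis e 1 \<in> Q" if "x \<in> U" "t \<in> {0..1}" for x t
  proof -
    have "norm (x - t *\<^sub>R axis e 1) \<le> norm x + norm (t *\<^sub>R axis e (1::real) :: real^'a)" by (rule norm_triangle_ineq4)
    also have "\<dots> \<le> r + 1" using that r by (intro add_mono) (auto simp: norm_axis_real)
    finally show ?thesis by (simp add: Q_def)
  qed
  have "(\<integral>x. g x \<partial>lborel) = (\<integral>x. g x * (\<integral>t. indicator {0..1} t * indicator Q (x - t *\<^sub>R axis e 1) \<partial>lborel) \<partial>lborel)"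
  proof (rule Bochner_Integration.integral_cong[OF refl])
    fix x
    show "g x = g x * (\<integral>t. indicator {0..1} t * indicator Q (x - t *\<^sub>R axis e 1) \<partial>lborel)"
    proof (cases "x \<in> U")
      case True
      have "(\<integral>t. indicator {0..1} t * indicator Q (x - t *\<^sub>R axis e 1) \<partial>lborel) = (\<integral>t. (indicator {0..1::real} t :: real) \<partial>lborel)"
        by (rule Bochner_Integration.integral_cong[OF refl]) (use Q[OF True] in \<open>auto simp: indicator_def\<close>)
      then show ?thesis by simp
    qed (simp add: g0)
  qed
  also have "\<dots> = (\<integral>x. indicator Q x * (\<integral>t. indicator {0..1} t * g (x + t *\<^sub>R axis e 1) \<partial>lborel) \<partial>lborel)"
    by (rule translation_Fubini[OF cg, symmetric]) (simp add: Q_def)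
  also have "\<dots> = (\<integral>x. indicator Q x * (\<psi> (x + axis e 1) - \<psi> x) \<partial>lborel)"
    unfolding g_def by (simp add: smooth_line_integral[OF sm])
  also have "\<dots> = (\<integral>x. \<psi> (x + axis e 1) - \<psi> x \<partial>lborel)"
  proof (rule Bochner_Integration.integral_cong[OF refl])
    fix x
    have "x + axis e 1 \<notin> U" "x \<notin> U" if "x \<notin> Q"
      using Q[of "x + axis e 1" 1] Q[of x 0] that by auto
    then show "indicator Q x * (\<psi> (x + axis e 1) - \<psi> x) = \<psi> (x + axis e 1) - \<psi> x"
      using test_function_outside(1)[OF \<psi>] by (auto simp: indicator_def)
  qed
  also have "\<dots> = 0"
  proof -
    have int: "integrable lborel \<psi>"
      by (rule integral_lebesgue_on_supported(1)[OF c\<psi> U test_function_outside(1)[OF \<psi>]])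
    have m: "\<psi> \<in> borel_measurable borel" using c\<psi> by (rule borel_measurable_continuous_onI)
    have "(\<integral>x. \<psi> x \<partial>distr lborel borel ((+) (axis e 1))) = (\<integral>x. \<psi> (axis e 1 + x) \<partial>lborel)"
      by (rule integral_distr) (use m in simp_all)
    then have eq: "(\<integral>x. \<psi> (x + axis e 1) \<partial>lborel) = (\<integral>x. \<psi> x \<partial>lborel)"
      by (simp add: lborel_distr_plus add.commute)
    have "integrable (distr lborel borel ((+) (axis e 1))) \<psi>" using int by (simp add: lborel_distr_plus)
    then have "integrable lborel (\<lambda>x. \<psi> (axis e 1 + x))"
      by (subst (asm) integrable_distr_eq) (use m in simp_all)
    then have "integrable lborel (\<lambda>x. \<psi> (x + axis e 1))" by (simp add: add.commute)
    with int eq show ?thesis by simp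
  qed
  finally show ?thesis
    using integral_lebesgue_on_supported(3)[OF cg U g0] by (simp add: g_def)
qed

text \<open>A shift by \<open>R\<close> along one axis moves the closure of \<open>U\<close> off
  \<open>U\<close>, so \<open>\<psi>\<close> is minus the integral of its partial derivative along
  that segment. The lemma turns \<open>L^1\<close> convergence of gradients into that of functions
  with common boundary values.\<close>

lemma test_function_Poincare:
  fixes U :: "(real^'n) set"
  assumes U: "open U" "bounded U"
  obtains R where "0 \<le> R" "\<And>\<psi>. test_function U \<psi> \<Longrightarrow>
    (LINT x|lebesgue_on U. \<bar>\<psi> x\<bar>) \<le> R * (LINT x|lebesgue_on U. norm (grad \<psi> x))"
proof -
  obtain r where "0 < r" "\<forall>x\<in>U. norm x \<le> r" using U(2) unfolding bounded_pos by blast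
  then have r: "0 < r" "U \<subseteq> cball 0 r" by auto
  fix e :: 'n
  \<comment> \<open>Any length above \<open>2 r\<close>, which bounds the diameter of
    \<open>U\<close>, moves the domain off itself.\<close>
  define R where "R = 3 * r"
  have out: "x + axis e R \<notin> U" if "x \<in> closure U" for x
  proof -
    have x: "norm x \<le> r" using that r closure_minimal[OF r(2) closed_cball] by auto
    have "R = norm (axis e R :: real^'n)" using r by (simp add: norm_axis_real R_def)
    also have "\<dots> \<le> norm (x + axis e R) + norm x" using norm_triangle_ineq4[of "x + axis e R" x] by simp
    finally have "r < norm (x + axis e R)" using x r by (simp add: R_def)
    then show ?thesis using r by auto
  qed
  have "(LINT x|lebesgue_on U. \<bar>\<psi> x\<bar>) \<le> R * (LINT x|lebesgue_on U. norm (grad \<psi> x))"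
    if \<psi>: "test_function U \<psi>" for \<psi>
  proof -
    have sm: "smooth \<psi>" using \<psi> by (simp add: test_function_def)
    define g where "g = (\<lambda>x. norm (grad \<psi> x))"
    have cg: "continuous_on S g" for S
      unfolding g_def by (intro continuous_intros smooth_continuous_grad sm)
    have c\<psi>: "continuous_on S (\<lambda>x. \<bar>\<psi> x\<bar>)" for S by (intro continuous_intros smooth_continuous sm)
    have g0: "g x = 0" if "x \<notin> U" for x using test_function_outside(2)[OF \<psi> that] by (simp add: g_def)
    have \<psi>0: "\<bar>\<psi> x\<bar> = 0" if "x \<notin> U" for x using test_function_outside(1)[OF \<psi> that] by simp
    have compQ: "compact (closure U)" using U(2) by simp
    let ?G = "\<lambda>x. \<integral>t. indicator {0..R} t * g (x + t *\<^sub>R axis e 1) \<partial>lborel"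
    let ?w = "\<lambda>x. \<integral>t. (indicator {0..R} t :: real) * indicator (closure U) (x - t *\<^sub>R axis e 1) \<partial>lborel"
    have intg: "integrable lborel (\<lambda>t. indicator {0..R} t * g (x + t *\<^sub>R axis e 1))" for x
      by (intro integral_indicator_lborel continuous_on_compose2[OF cg[of UNIV]] continuous_intros) auto
    have pt: "\<bar>\<psi> x\<bar> \<le> ?G x" if "x \<in> closure U" for x
    proof -
      have "\<bar>\<psi> x\<bar> = \<bar>\<psi> (x + axis e R) - \<psi> x\<bar>"
        using test_function_outside(1)[OF \<psi> out[OF that]] by simp
      also have "\<dots> = \<bar>\<integral>t. indicator {0..R} t * partial_deriv e \<psi> (x + t *\<^sub>R axis e 1) \<partial>lborel\<bar>"
        using r by (simp add: smooth_line_integral[OF sm] R_def)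
      also have "\<dots> \<le> (\<integral>t. norm (indicator {0..R} t * partial_deriv e \<psi> (x + t *\<^sub>R axis e 1)) \<partial>lborel)"
        unfolding real_norm_def[symmetric] by (rule integral_norm_bound)
      also have "\<dots> \<le> ?G x"
      proof (rule integral_mono[OF _ intg])
        show "integrable lborel (\<lambda>t. norm (indicator {0..R} t * partial_deriv e \<psi> (x + t *\<^sub>R axis e 1)))"
          by (intro integrable_norm integral_indicator_lborel
              continuous_on_compose2[OF smooth_continuous[OF smooth_partial_deriv[OF sm], of UNIV]] continuous_intros) auto
        show "norm (indicator {0..R} t * partial_deriv e \<psi> (x + t *\<^sub>R axis e 1)) \<le> indicator {0..R} t * g (x + t *\<^sub>R axis e 1)" for t
          using component_le_norm_cart[of "grad \<psi> (x + t *\<^sub>R axis e 1)" e]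
          by (auto simp: g_def grad_component indicator_def)
      qed
      finally show ?thesis .
    qed
    have int\<psi>: "integrable lborel (\<lambda>x. \<bar>\<psi> x\<bar>)" "integrable lborel g"
      using integral_lebesgue_on_supported(1)[OF c\<psi> U \<psi>0] integral_lebesgue_on_supported(1)[OF cg U g0] by auto
    have w: "0 \<le> ?w x" "?w x \<le> R" for x
    proof -
      show "0 \<le> ?w x" by (rule integral_nonneg_AE) simp
      have "?w x \<le> (\<integral>t. (indicator {0..R} t :: real) \<partial>lborel)"
      proof (rule integral_mono')
        show "integrable lborel (indicator {0..R} :: real \<Rightarrow> real)"
          by (intro integrable_real_indicator) (auto simp: emeasure_lborel_Icc_eq)
      qed (auto simp: indicator_def)
      then show "?w x \<le> R" using r by (simp add: R_def)
    qed
    have wm: "(\<lambda>x. g x * ?w x) \<in> borel_measurable lborel"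
    proof -
      have [measurable]: "g \<in> borel_measurable borel" "closure U \<in> sets borel"
        using cg by (auto intro: borel_measurable_continuous_onI)
      show ?thesis by measurable
    qed
    have gw: "integrable lborel (\<lambda>x. g x * ?w x)"
    proof (rule Bochner_Integration.integrable_bound[OF integrable_mult_right[OF int\<psi>(2), of R] wm])
      show "AE x in lborel. norm (g x * ?w x) \<le> norm (R * g x)"
      proof (rule AE_I2)
        fix x
        have "g x * ?w x \<le> R * g x" by (subst mult.commute[of R], intro mult_left_mono w) (simp add: g_def)
        moreover have "0 \<le> g x * ?w x" by (intro mult_nonneg_nonneg w) (simp add: g_def)
        ultimately show "norm (g x * ?w x) \<le> norm (R * g x)" by simp
      qed
    qed
    have Gint: "integrable lborel (\<lambda>x. indicator (closure U) x * ?G x)"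
    proof -
      have "continuous_on (closure U) ?G"
      proof -
        have eq: "?G x = integral (cbox 0 R) (\<lambda>t. g (x + t *\<^sub>R axis e 1))" for x
          using integral_indicator_lborel(1)[of "{0..R}" "\<lambda>t. g (x + t *\<^sub>R axis e 1)"]
          by (simp add: continuous_on_compose2[OF cg[of UNIV]] continuous_intros)
        show ?thesis
          unfolding eq
          by (rule integral_continuous_on_param)
             (auto simp: split_def intro!: continuous_on_compose2[OF cg[of UNIV]] continuous_intros)
      qed
      then show ?thesis by (intro integral_indicator_lborel compQ)
    qed
    have "(\<integral>x. \<bar>\<psi> x\<bar> \<partial>lborel) \<le> (\<integral>x. indicator (closure U) x * ?G x \<partial>lborel)"
    proof (rule integral_mono[OF int\<psi>(1) Gint])
      fix x
      show "\<bar>\<psi> x\<bar> \<le> indicator (closure U) x * ?G x"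
        using pt[of x] \<psi>0[of x] closure_subset[of U] by (cases "x \<in> closure U") auto
    qed
    also have "\<dots> = (\<integral>x. g x * ?w x \<partial>lborel)"
      by (rule translation_Fubini[OF cg compQ])
    also have "\<dots> \<le> (\<integral>x. R * g x \<partial>lborel)"
      using w by (intro integral_mono[OF gw integrable_mult_right[OF int\<psi>(2)]])
        (auto simp: g_def mult.commute[of R] intro!: mult_left_mono)
    also have "\<dots> = R * (\<integral>x. g x \<partial>lborel)" by simp
    finally show ?thesis
      using integral_lebesgue_on_supported(3)[OF c\<psi> U \<psi>0] integral_lebesgue_on_supported(3)[OF cg U g0]
      by (simp add: g_def)
  qed
  then show thesis using that[of R] r by (simp add: R_def)
qed

subsection \<open>Vector fields of finite energy\<close>

lemma matrix_vector_inner_sum: "x \<bullet> (A *v y) = (\<Sum>i\<in>UNIV. \<Sum>j\<in>UNIV. x $ i * A $ i $ j * y $ j)"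
  for A :: "real^'n^'n"
  by (simp add: inner_vec_def matrix_vector_mult_def sum_distrib_left mult.assoc)

lemma borel_measurable_matrix_inner:
  fixes A :: "'b \<Rightarrow> real^'n^'n"
  assumes [measurable]: "A \<in> borel_measurable M" "g \<in> borel_measurable M" "h \<in> borel_measurable M"
  shows "(\<lambda>x. g x \<bullet> (A x *v h x)) \<in> borel_measurable M"
  unfolding matrix_vector_inner_sum by measurable

lemma nn_integral_Fatou_le:
  assumes [measurable]: "\<And>k. f k \<in> borel_measurable M"
    and lim: "AE x in M. (\<lambda>k. f k x) \<longlonglongrightarrow> g x"
    and bound: "\<And>k. (\<integral>\<^sup>+x. f k x \<partial>M) \<le> (c::ennreal)"
  shows "(\<integral>\<^sup>+x. g x \<partial>M) \<le> c"
proof -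
  have "(\<integral>\<^sup>+x. g x \<partial>M) = (\<integral>\<^sup>+x. liminf (\<lambda>k. f k x) \<partial>M)"
  proof (rule nn_integral_cong_AE)
    show "AE x in M. g x = liminf (\<lambda>k. f k x)"
      using lim by eventually_elim (simp add: lim_imp_Liminf)
  qed
  also have "\<dots> \<le> liminf (\<lambda>k. \<integral>\<^sup>+x. f k x \<partial>M)" by (rule nn_integral_liminf) measurable
  also have "\<dots> \<le> liminf (\<lambda>k::nat. c)" by (intro Liminf_mono always_eventually allI bound)
  also have "\<dots> = c" by (simp add: Liminf_const)
  finally show ?thesis .
qed

text \<open>The sum of the norms of the increments is integrable, hence finite almost everywhere,
  and there the telescoping series converges absolutely.\<close>

lemma AE_convergent_of_summable_increments:
  fixes f :: "nat \<Rightarrow> 'a \<Rightarrow> 'b::{banach, second_countable_topology}"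
  assumes int: "\<And>j. integrable M (\<lambda>x. norm (f (Suc j) x - f j x))"
    and sum: "summable (\<lambda>j. LINT x|M. norm (f (Suc j) x - f j x))"
  shows "AE x in M. convergent (\<lambda>j. f j x)"
proof -
  have [measurable]: "(\<lambda>x. norm (f (Suc j) x - f j x)) \<in> borel_measurable M" for j
    using int[of j] by (rule borel_measurable_integrable)
  have "(\<integral>\<^sup>+x. (\<Sum>j. ennreal (norm (f (Suc j) x - f j x))) \<partial>M) =
      (\<Sum>j. \<integral>\<^sup>+x. ennreal (norm (f (Suc j) x - f j x)) \<partial>M)"
    by (rule nn_integral_suminf) measurable
  also have "\<dots> = (\<Sum>j. ennreal (LINT x|M. norm (f (Suc j) x - f j x)))"
    by (intro suminf_cong nn_integral_eq_integral int AE_I2) simp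
  also have "\<dots> < \<infinity>"
    using sum by (subst suminf_ennreal2) auto
  finally have "AE x in M. (\<Sum>j. ennreal (norm (f (Suc j) x - f j x))) \<noteq> \<infinity>"
    by (intro nn_integral_PInf_AE) auto
  then show ?thesis
  proof eventually_elim
    fix x assume "(\<Sum>j. ennreal (norm (f (Suc j) x - f j x))) \<noteq> \<infinity>"
    then have "summable (\<lambda>j. norm (f (Suc j) x - f j x))"
      by (intro summable_suminf_not_top) auto
    then have "summable (\<lambda>j. f (Suc j) x - f j x)" by (rule summable_norm_cancel)
    then have "(\<lambda>n. \<Sum>j<n. f (Suc j) x - f j x) \<longlonglongrightarrow> (\<Sum>j. f (Suc j) x - f j x)"
      by (rule summable_LIMSEQ)
    then have "(\<lambda>n. f n x - f 0 x) \<longlonglongrightarrow> (\<Sum>j. f (Suc j) x - f j x)"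
      unfolding sum_lessThan_telescope[of "\<lambda>j. f j x"] .
    from tendsto_add[OF this tendsto_const[of "f 0 x"]] show "convergent (\<lambda>j. f j x)"
      by (auto simp: convergent_def)
  qed
qed

locale coefficient_domain =
  fixes U :: "(real^'n) set" and a :: "real^'n \<Rightarrow> real^'n^'n"
  assumes cf: "coefficient_field U a" and U: "open U" "bounded U" "U \<noteq> {}"
begin

abbreviation "M \<equiv> lebesgue_on U"

definition fin :: "(real^'n \<Rightarrow> real^'n) \<Rightarrow> bool" where
  "fin h \<longleftrightarrow> h \<in> borel_measurable M \<and> integrable M (\<lambda>x. h x \<bullet> (a x *v h x))"

definition ip :: "(real^'n \<Rightarrow> real^'n) \<Rightarrow> (real^'n \<Rightarrow> real^'n) \<Rightarrow> real" where
  "ip h k = (LINT x|M. h x \<bullet> (a x *v k x))"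

text \<open>Integrability of the inverse of \<open>a\<close> is used through this number, the factor
  between the squared \<open>L^1\<close> norm and the energy in
  \<open>norm_integrable\<close>.\<close>

definition W :: real where "W = (LINT x|M. norm (matrix_inv (a x)))"

lemma U_lebesgue: "U \<in> sets lebesgue" "U \<in> lmeasurable"
  using U by (auto intro: lmeasurable_open)

lemma finite_M: "finite_measure M"
  using U_lebesgue by (intro finite_measureI) (simp add: emeasure_restrict_space fmeasurableD2 del: emeasure_completion)

lemma a_measurable: "a \<in> borel_measurable M"
  using cf by (simp add: coefficient_field_def)

lemma psd: "x \<in> U \<Longrightarrow> psd_matrix (a x)"
  using cf by (simp add: coefficient_field_def)

lemma AE_invertible: "AE x in M. invertible (a x)"
  using cf by (simp add: coefficient_field_def)

lemma W_int: "integrable M (\<lambda>x. norm (matrix_inv (a x)))"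
  using cf by (auto simp: coefficient_field_def intro: integrable_norm)

lemma W_nonneg: "0 \<le> W"
  unfolding W_def by (rule integral_nonneg_AE) simp

lemma ip_measurable: "h \<in> borel_measurable M \<Longrightarrow> k \<in> borel_measurable M \<Longrightarrow>
    (\<lambda>x. h x \<bullet> (a x *v k x)) \<in> borel_measurable M"
  by (rule borel_measurable_matrix_inner[OF a_measurable])

lemma energy_nonneg: "x \<in> U \<Longrightarrow> 0 \<le> h \<bullet> (a x *v h)"
  using psd by (simp add: psd_matrix_def)

lemma fin_measurable: "fin h \<Longrightarrow> h \<in> borel_measurable M"
  by (simp add: fin_def)

lemma fin_scale: "fin h \<Longrightarrow> fin (\<lambda>x. c *\<^sub>R h x)"
  unfolding fin_def psd_matrix_energy_scale by (auto intro: borel_measurable_scaleR)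

lemma energy_scale: "ip (\<lambda>x. c *\<^sub>R h x) (\<lambda>x. c *\<^sub>R h x) = c\<^sup>2 * ip h h"
  unfolding ip_def psd_matrix_energy_scale by simp

lemma energy_polar:
  assumes "x \<in> U"
  shows "2 * (h \<bullet> (a x *v k)) \<le> h \<bullet> (a x *v h) + k \<bullet> (a x *v k)"
    "- (2 * (h \<bullet> (a x *v k))) \<le> h \<bullet> (a x *v h) + k \<bullet> (a x *v k)"
proof -
  have "0 \<le> (h + (-1) *\<^sub>R k) \<bullet> (a x *v (h + (-1) *\<^sub>R k))" "0 \<le> (h + k) \<bullet> (a x *v (h + k))"
    using energy_nonneg[OF assms] by blast+
  then show "2 * (h \<bullet> (a x *v k)) \<le> h \<bullet> (a x *v h) + k \<bullet> (a x *v k)"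
    "- (2 * (h \<bullet> (a x *v k))) \<le> h \<bullet> (a x *v h) + k \<bullet> (a x *v k)"
    unfolding psd_matrix_energy_add[OF psd[OF assms]] psd_matrix_energy_scale
    by (simp_all add: matrix_vector_mult_scaleR[of _ "-1", simplified])
qed

lemma ip_integrable:
  assumes "fin h" "fin k"
  shows "integrable M (\<lambda>x. h x \<bullet> (a x *v k x))"
proof (rule Bochner_Integration.integrable_bound)
  show "integrable M (\<lambda>x. h x \<bullet> (a x *v h x) + k x \<bullet> (a x *v k x))"
    using assms by (auto simp: fin_def)
  show "(\<lambda>x. h x \<bullet> (a x *v k x)) \<in> borel_measurable M"
    using assms by (intro ip_measurable fin_measurable)
  show "AE x in M. norm (h x \<bullet> (a x *v k x)) \<le> norm (h x \<bullet> (a x *v h x) + k x \<bullet> (a x *v k x))"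
  proof (rule AE_I2)
    fix x assume "x \<in> space M"
    then have x: "x \<in> U" by simp
    show "norm (h x \<bullet> (a x *v k x)) \<le> norm (h x \<bullet> (a x *v h x) + k x \<bullet> (a x *v k x))"
      using energy_polar[OF x, of "h x" "k x"] energy_nonneg[OF x, of "h x"] energy_nonneg[OF x, of "k x"]
      by (simp add: abs_le_iff)
  qed
qed

lemma energy_integrable: "fin h \<Longrightarrow> integrable M (\<lambda>x. h x \<bullet> (a x *v h x))"
  by (simp add: fin_def)

lemma fin_add:
  assumes "fin h" "fin k"
  shows "fin (\<lambda>x. h x + k x)"
proof -
  have "integrable M (\<lambda>x. h x \<bullet> (a x *v h x) + 2 * (h x \<bullet> (a x *v k x)) + k x \<bullet> (a x *v k x))"
    using assms ip_integrable by (auto simp: fin_def)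
  then have "integrable M (\<lambda>x. (h x + k x) \<bullet> (a x *v (h x + k x)))"
    by (rule Bochner_Integration.integrable_cong[THEN iffD1, rotated 2])
       (auto simp: psd_matrix_energy_add psd)
  then show ?thesis using assms by (auto simp: fin_def)
qed

lemma energy_add:
  assumes "fin h" "fin k"
  shows "ip (\<lambda>x. h x + k x) (\<lambda>x. h x + k x) = ip h h + 2 * ip h k + ip k k"
proof -
  have "ip (\<lambda>x. h x + k x) (\<lambda>x. h x + k x) =
      (LINT x|M. h x \<bullet> (a x *v h x) + 2 * (h x \<bullet> (a x *v k x)) + k x \<bullet> (a x *v k x))"
    unfolding ip_def by (rule Bochner_Integration.integral_cong) (auto simp: psd_matrix_energy_add psd)
  also have "\<dots> = ip h h + 2 * ip h k + ip k k"
    using assms ip_integrable by (simp add: ip_def)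
  finally show ?thesis .
qed

lemma fin_diff: "fin h \<Longrightarrow> fin k \<Longrightarrow> fin (\<lambda>x. h x - k x)"
  using fin_add[OF _ fin_scale[of k "-1"]] by simp

lemma ip_scale_right: "ip h (\<lambda>x. c *\<^sub>R k x) = c * ip h k"
  by (simp add: ip_def matrix_vector_mult_scaleR)

lemma ip_add_right: "fin h \<Longrightarrow> fin k \<Longrightarrow> fin l \<Longrightarrow> ip h (\<lambda>x. k x + l x) = ip h k + ip h l"
  by (simp add: ip_def matrix_vector_right_distrib inner_add_right ip_integrable)

lemma energy_nonneg': "0 \<le> ip h h"
  unfolding ip_def by (rule integral_nonneg_AE) (auto intro!: AE_I2 energy_nonneg)

lemma nn_energy: "fin h \<Longrightarrow> (\<integral>\<^sup>+x. ennreal (h x \<bullet> (a x *v h x)) \<partial>M) = ennreal (ip h h)"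
  unfolding ip_def by (intro nn_integral_eq_integral energy_integrable) (auto intro!: AE_I2 energy_nonneg)

lemma finI:
  assumes "h \<in> borel_measurable M" "(\<integral>\<^sup>+x. ennreal (h x \<bullet> (a x *v h x)) \<partial>M) < \<infinity>"
  shows "fin h"
  unfolding fin_def using assms
  by (auto intro!: integrableI_nonneg ip_measurable AE_I2 energy_nonneg)

text \<open>Cauchy-Schwarz in additive form: the energies of \<open>sqrt t h + k / sqrt t\<close>
  and of \<open>sqrt t h - k / sqrt t\<close> are nonnegative.\<close>

lemma ip_bound:
  assumes "fin h" "fin k" "0 < t"
  shows "2 * \<bar>ip h k\<bar> \<le> t * ip h h + ip k k / t"
proof -
  have "0 \<le> t * ip h h + 2 * s * ip h k + ip k k / t" if "\<bar>s\<bar> = 1" for s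
  proof -
    let ?c = "sqrt t"
    have "0 \<le> ip (\<lambda>x. ?c *\<^sub>R h x + (s / ?c) *\<^sub>R k x) (\<lambda>x. ?c *\<^sub>R h x + (s / ?c) *\<^sub>R k x)"
      by (rule energy_nonneg')
    also have "\<dots> = ?c\<^sup>2 * ip h h + 2 * ip (\<lambda>x. ?c *\<^sub>R h x) (\<lambda>x. (s / ?c) *\<^sub>R k x) + (s / ?c)\<^sup>2 * ip k k"
      using assms by (simp only: energy_add fin_scale energy_scale)
    also have "ip (\<lambda>x. ?c *\<^sub>R h x) (\<lambda>x. (s / ?c) *\<^sub>R k x) = s * ip h k"
      using assms(3) by (simp add: ip_scale_right) (simp add: ip_def)
    also have "?c\<^sup>2 = t" using assms(3) by simp
    also have "(s / ?c)\<^sup>2 = 1 / t"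
      using assms(3) that by (metis one_power2 power2_abs power_divide real_sqrt_pow2 less_imp_le)
    finally show ?thesis by simp
  qed
  from this[of 1] this[of "-1"] show ?thesis by (simp add: abs_if)
qed

text \<open>\<open>norm_le_energy\<close>, integrated. The best \<open>t\<close> would bound the
  squared \<open>L^1\<close> norm by \<open>W\<close> times the energy.\<close>

lemma norm_integrable:
  assumes "fin h"
  shows "integrable M (\<lambda>x. norm (h x))"
    and "0 < t \<Longrightarrow> 2 * (LINT x|M. norm (h x)) \<le> t * W + ip h h / t"
proof -
  have ae: "AE x in M. 2 * norm (h x) \<le> t * norm (matrix_inv (a x)) + h x \<bullet> (a x *v h x) / t" if "0 < t" for t
    using AE_invertible AE_space by eventually_elim (use norm_le_energy[OF psd _ that] in auto)
  have [measurable]: "h \<in> borel_measurable M" using assms by (rule fin_measurable)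
  have int: "integrable M (\<lambda>x. t * norm (matrix_inv (a x)) + h x \<bullet> (a x *v h x) / t)" for t
    using W_int assms by (auto simp: fin_def)
  show n: "integrable M (\<lambda>x. norm (h x))"
  proof (rule Bochner_Integration.integrable_bound[OF int[of 1]])
    show "AE x in M. norm (norm (h x)) \<le> norm (1 * norm (matrix_inv (a x)) + h x \<bullet> (a x *v h x) / 1)"
      using ae[OF zero_less_one] by eventually_elim (smt (verit) norm_ge_zero real_norm_def)
  qed measurable
  assume t: "0 < t"
  have "(LINT x|M. 2 * norm (h x)) \<le> (LINT x|M. t * norm (matrix_inv (a x)) + h x \<bullet> (a x *v h x) / t)"
    using n by (intro integral_mono_AE int ae[OF t]) auto
  also have "\<dots> = t * W + ip h h / t"
    using W_int assms by (simp add: W_def ip_def fin_def)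
  finally show "2 * (LINT x|M. norm (h x)) \<le> t * W + ip h h / t" using n by simp
qed

lemma fin_integrable:
  assumes "fin h"
  shows "integrable M h"
  by (rule integrable_norm_cancel[OF norm_integrable(1)[OF assms] fin_measurable[OF assms]])

lemma continuous_measurable: "continuous_on UNIV f \<Longrightarrow> f \<in> borel_measurable M"
  for f :: "real^'n \<Rightarrow> 'b::topological_space"
proof -
  assume "continuous_on UNIV f"
  then have "f \<in> borel_measurable lborel" by (simp add: borel_measurable_continuous_onI)
  then show ?thesis by (intro measurable_restrict_space1 measurable_completion)
qed

lemma continuous_bounded:
  fixes f :: "real^'n \<Rightarrow> 'b::real_normed_vector"
  assumes "continuous_on UNIV f"
  obtains B where "0 < B" "\<And>x. x \<in> U \<Longrightarrow> norm (f x) \<le> B"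
proof -
  have "compact (f ` closure U)"
    using U(2) assms by (intro compact_continuous_image) (auto intro: continuous_on_subset)
  then obtain B where "0 < B" "\<forall>y\<in>f ` closure U. norm y \<le> B"
    using compact_imp_bounded bounded_pos by metis
  with that closure_subset[of U] show thesis by (meson image_eqI subsetD)
qed

text \<open>Here the integrability of \<open>a\<close> itself enters, so that gradients of smooth
  functions have finite energy on the bounded domain.\<close>

lemma fin_bounded:
  assumes h: "h \<in> borel_measurable M" and B: "\<And>x. x \<in> U \<Longrightarrow> norm (h x) \<le> B"
  shows "fin h"
  unfolding fin_def
proof (intro conjI h)
  show "integrable M (\<lambda>x. h x \<bullet> (a x *v h x))"
  proof (rule Bochner_Integration.integrable_bound)
    show "integrable M (\<lambda>x. (B * B) * norm (a x))"
      using cf by (auto simp: coefficient_field_def)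
    show "(\<lambda>x. h x \<bullet> (a x *v h x)) \<in> borel_measurable M" by (intro ip_measurable h)
    show "AE x in M. norm (h x \<bullet> (a x *v h x)) \<le> norm ((B * B) * norm (a x))"
    proof (rule AE_I2)
      fix x assume "x \<in> space M"
      then have x: "norm (h x) \<le> B" using B by simp
      then have B0: "0 \<le> B" using norm_ge_zero order_trans by blast
      have "norm (h x \<bullet> (a x *v h x)) \<le> norm (h x) * norm (a x *v h x)"
        by (simp add: Cauchy_Schwarz_ineq2)
      also have "\<dots> \<le> norm (h x) * (norm (a x) * norm (h x))"
        by (intro mult_left_mono norm_matrix_vector_le) simp
      also have "\<dots> \<le> B * (norm (a x) * B)"
        using x B0 by (intro mult_mono) auto
      finally show "norm (h x \<bullet> (a x *v h x)) \<le> norm ((B * B) * norm (a x))"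
        using B0 by (simp add: mult_ac)
    qed
  qed
qed

lemma fin_grad:
  assumes "smooth \<phi>"
  shows "fin (grad \<phi>)"
proof -
  obtain B where "\<And>x. x \<in> U \<Longrightarrow> norm (grad \<phi> x) \<le> B"
    using continuous_bounded[OF smooth_continuous_grad[OF assms]] by metis
  then show ?thesis by (rule fin_bounded[OF continuous_measurable[OF smooth_continuous_grad[OF assms]]])
qed

end

section \<open>The Dirichlet problem with smooth boundary values\<close>

context coefficient_domain
begin

lemma real_le_of_small:
  fixes x c :: real
  assumes "\<And>j::nat. x \<le> (1/2) ^ j * c"
  shows "x \<le> 0"
proof -
  have "(\<lambda>j. (1/2) ^ j * c) \<longlonglongrightarrow> 0 * c" by (intro tendsto_mult LIMSEQ_realpow_zero tendsto_const) auto
  then show ?thesis using assms by (intro LIMSEQ_le_const[of _ 0 x]) auto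
qed

lemma fin_component_integrable:
  assumes "fin h"
  shows "integrable M (\<lambda>x. h x $ e)"
  using integrable_inner_right[OF fin_integrable[OF assms], of "axis e 1"] by (simp add: inner_axis')

text \<open>A minimizing sequence for the Dirichlet problem with boundary values \<open>\<phi>\<close> can be truncated at a
  level above \<open>\<bar>\<phi>\<bar>\<close>. Without this its limit need not be square integrable, because the integrability of the
  inverse of \<open>a\<close> only controls the gradients in \<open>L\<^sup>1\<close>.\<close>

lemma bounded_minimizing_sequence:
  assumes \<phi>: "smooth \<phi>"
  obtains v :: "nat \<Rightarrow> real^'n \<Rightarrow> real" and K where
    "\<And>j. smooth (v j)" "\<And>j. test_function U (\<lambda>x. v j x - v 0 x)"
    "\<And>j x. x \<in> U \<Longrightarrow> \<bar>v j x\<bar> \<le> K"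
    "\<And>j e. (LINT x|M. partial_deriv e (v j) x) = (LINT x|M. partial_deriv e \<phi> x)"
    "\<And>j. ip (grad (v j)) (grad (v j)) \<le> ip (grad \<phi>) (grad \<phi>) + (1/4) ^ j"
    "\<And>j \<psi>. test_function U \<psi> \<Longrightarrow>
       ip (grad (v j)) (grad (v j)) \<le> ip (grad (\<lambda>x. v j x + \<psi> x)) (grad (\<lambda>x. v j x + \<psi> x)) + (1/4) ^ j"
    "\<And>i j. ip (grad (\<lambda>x. v i x - v j x)) (grad (\<lambda>x. v i x - v j x)) \<le> 2 * ((1/4) ^ i + (1/4) ^ j)"
proof -
  let ?E = "\<lambda>f. ip (grad f) (grad f)"
  define A where "A = {?E (\<lambda>x. \<phi> x + \<psi> x) |\<psi>. test_function U \<psi>}"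
  have bdd: "bdd_below A" using energy_nonneg' by (auto simp: A_def intro!: bdd_belowI[of _ 0])
  have ne: "A \<noteq> {}" using test_function_zero[of U] by (auto simp: A_def)
  \<comment> \<open>Energy defects \<open>(1/4) ^ j\<close> become \<open>(1/2) ^ j\<close> after a
    square root, which is still summable.\<close>
  have "\<exists>\<psi>. test_function U \<psi> \<and> ?E (\<lambda>x. \<phi> x + \<psi> x) < Inf A + (1/4) ^ j" for j :: nat
  proof -
    have "Inf A < Inf A + (1/4) ^ j" by simp
    then obtain y where "y \<in> A" "y < Inf A + (1/4) ^ j" using cInf_lessD[OF ne] by blast
    then show ?thesis by (auto simp: A_def)
  qed
  then obtain \<psi> where \<psi>: "\<And>j. test_function U (\<psi> j)" "\<And>j::nat. ?E (\<lambda>x. \<phi> x + \<psi> j x) < Inf A + (1/4) ^ j"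
    by metis
  obtain B where B: "0 < B" "\<And>x. x \<in> U \<Longrightarrow> norm (\<phi> x) \<le> B"
    using continuous_bounded[OF smooth_continuous[OF \<phi>]] by metis
  obtain T T' :: "real \<Rightarrow> real" where T: "\<And>k. real_times_differentiable k T'"
    "\<And>x. (T has_real_derivative T' x) (at x)"
    "\<And>x. \<bar>x\<bar> \<le> B \<Longrightarrow> T x = x" "\<And>x. \<bar>x\<bar> \<le> B \<Longrightarrow> T' x = 1" "\<And>x. 0 \<le> T' x" "\<And>x. T' x \<le> 1" "\<And>x. \<bar>T x\<bar> \<le> B + 1"
    using smooth_truncation_exists[of B] B(1) by (metis less_imp_le)
  have Tsm: "real_times_differentiable k T" for k
    using T(1,2) real_times_differentiable_Suc_imp[of k T] by auto
  \<comment> \<open>On \<open>U\<close> the bound \<open>B\<close> gives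
    \<open>T (\<phi> x) = \<phi> x\<close>, so there \<open>\<phi> + \<xi> j\<close> is the
    truncation of \<open>\<phi> + \<psi> j\<close>, while \<open>\<xi> j\<close> is still a test
    function.\<close>
  define \<xi> where "\<xi> = (\<lambda>j x. T (\<phi> x + \<psi> j x) - T (\<phi> x))"
  define v where "v = (\<lambda>j x. \<phi> x + \<xi> j x)"
  have \<xi>: "test_function U (\<xi> j)" for j
    unfolding \<xi>_def by (rule test_function_compose_diff[OF Tsm \<phi> \<psi>(1)])
  have sm\<psi>: "smooth (\<psi> j)" and sm\<xi>: "smooth (\<xi> j)" for j
    using \<psi>(1) \<xi> by (auto simp: test_function_def)
  have smv: "smooth (v j)" for j unfolding v_def by (intro smooth_add \<phi> sm\<xi>)
  have vU: "v j x = T (\<phi> x + \<psi> j x)" if "x \<in> U" for j x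
    using T(3)[of "\<phi> x"] B(2)[OF that] by (simp add: v_def \<xi>_def)
  have gradv: "grad (v j) x = T' (\<phi> x + \<psi> j x) *\<^sub>R grad (\<lambda>x. \<phi> x + \<psi> j x) x" if "x \<in> U" for j x
  proof -
    have "grad (v j) x = grad \<phi> x + (grad (\<lambda>x. T (\<phi> x + \<psi> j x)) x - grad (\<lambda>x. T (\<phi> x)) x)"
      unfolding v_def using sm\<xi>[of j] smooth_compose_real[OF Tsm \<phi>] smooth_compose_real[OF Tsm smooth_add[OF \<phi> sm\<psi>[of j]]]
      by (simp add: grad_add \<phi>) (simp add: \<xi>_def grad_diff)
    also have "grad (\<lambda>x. T (\<phi> x)) x = grad \<phi> x"
      using grad_compose_real[OF T(2) \<phi>, of x] T(4)[of "\<phi> x"] B(2)[OF that] by simp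
    also have "grad (\<lambda>x. T (\<phi> x + \<psi> j x)) x = T' (\<phi> x + \<psi> j x) *\<^sub>R grad (\<lambda>x. \<phi> x + \<psi> j x) x"
      by (rule grad_compose_real[OF T(2) smooth_add[OF \<phi> sm\<psi>]])
    finally show ?thesis by simp
  qed
  have Ev: "?E (v j) \<le> Inf A + (1/4) ^ j" for j
  proof -
    \<comment> \<open>Pointwise the gradient is multiplied by \<open>T'\<close>, a number in
      \<open>[0, 1]\<close>.\<close>
    have "?E (v j) \<le> ?E (\<lambda>x. \<phi> x + \<psi> j x)"
      unfolding ip_def
    proof (rule integral_mono)
      show "integrable M (\<lambda>x. grad (v j) x \<bullet> (a x *v grad (v j) x))"
        by (intro energy_integrable fin_grad smv)
      show "integrable M (\<lambda>x. grad (\<lambda>x. \<phi> x + \<psi> j x) x \<bullet> (a x *v grad (\<lambda>x. \<phi> x + \<psi> j x) x))"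
        by (intro energy_integrable fin_grad smooth_add \<phi> sm\<psi>)
      fix x assume "x \<in> space M"
      then have x: "x \<in> U" by simp
      let ?g = "grad (\<lambda>x. \<phi> x + \<psi> j x) x" and ?t = "T' (\<phi> x + \<psi> j x)"
      have "?t\<^sup>2 * (?g \<bullet> (a x *v ?g)) \<le> 1 * (?g \<bullet> (a x *v ?g))"
        using T(5,6) energy_nonneg[OF x] by (intro mult_right_mono power_le_one) auto
      then show "grad (v j) x \<bullet> (a x *v grad (v j) x) \<le> ?g \<bullet> (a x *v ?g)"
        unfolding gradv[OF x] psd_matrix_energy_scale by simp
    qed
    also have "\<dots> < Inf A + (1/4) ^ j" by (rule \<psi>(2))
    finally show ?thesis by simp
  qed
  have InfA: "Inf A \<le> ?E f" if "test_function U (\<lambda>x. f x - \<phi> x)" for f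
  proof -
    have "?E (\<lambda>x. \<phi> x + (f x - \<phi> x)) \<in> A" using that unfolding A_def
      by (intro CollectI exI[of _ "\<lambda>x. f x - \<phi> x"] conjI refl)
    then show ?thesis using cInf_lower[OF _ bdd] by simp
  qed
  show thesis
  proof (rule that[of v "B + 1"])
    show "smooth (v j)" for j by (rule smv)
    show "test_function U (\<lambda>x. v j x - v 0 x)" for j
      using test_function_lincomb[OF \<xi>[of j] \<xi>[of 0], of 1 "-1"] by (simp add: v_def)
    show "\<bar>v j x\<bar> \<le> B + 1" if "x \<in> U" for j x using vU[OF that] T(7) by simp
    show "(LINT x|M. partial_deriv e (v j) x) = (LINT x|M. partial_deriv e \<phi> x)" for j e
    proof -
      have "(LINT x|M. partial_deriv e (v j) x) = (LINT x|M. partial_deriv e \<phi> x + partial_deriv e (\<xi> j) x)"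
        unfolding v_def by (simp add: partial_deriv_add smooth_differentiable \<phi> sm\<xi>)
      also have "\<dots> = (LINT x|M. partial_deriv e \<phi> x) + (LINT x|M. partial_deriv e (\<xi> j) x)"
      proof (rule Bochner_Integration.integral_add)
        have "integrable M (\<lambda>x. grad f x $ e)" if "smooth f" for f
          by (rule fin_component_integrable[OF fin_grad[OF that]])
        then show "integrable M (partial_deriv e \<phi>)" "integrable M (partial_deriv e (\<xi> j))"
          using \<phi> sm\<xi> by (auto simp: grad_component)
      qed
      finally show ?thesis using test_function_integral_partial[OF \<xi> U(1,2)] by simp
    qed
    have "Inf A \<le> ?E \<phi>" using InfA[of \<phi>] test_function_zero[of U] by simp
    then show "?E (v j) \<le> ?E \<phi> + (1/4) ^ j" for j using Ev[of j] by simp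
    show "?E (v j) \<le> ?E (\<lambda>x. v j x + \<psi> x) + (1/4) ^ j" if "test_function U \<psi>" for j \<psi>
    proof -
      have "test_function U (\<lambda>x. (v j x + \<psi> x) - \<phi> x)"
        using test_function_lincomb[OF \<xi>[of j] that, of 1 1] by (simp add: v_def)
      from InfA[OF this] Ev[of j] show ?thesis by simp
    qed
    show "?E (\<lambda>x. v i x - v j x) \<le> 2 * ((1/4) ^ i + (1/4) ^ j)" for i j
    proof -
      let ?g = "grad (v i)" and ?h = "grad (v j)"
      have fg: "fin ?g" "fin ?h" "fin (\<lambda>x. (-1) *\<^sub>R ?h x)" by (auto intro!: fin_grad smv fin_scale[of "grad (v j)" "-1", simplified])
      \<comment> \<open>The midpoint of two competitors is a competitor, so its energy is at least
        \<open>Inf A\<close>; the parallelogram law then bounds the energy of the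
        difference.\<close>
      have "test_function U (\<lambda>x. (1/2 * v i x + 1/2 * v j x) - \<phi> x)"
      proof -
        have "(\<lambda>x. (1/2 * v i x + 1/2 * v j x) - \<phi> x) = (\<lambda>x. 1/2 * \<xi> i x + 1/2 * \<xi> j x)"
          by (auto simp: v_def field_simps)
        then show ?thesis using test_function_lincomb[OF \<xi>[of i] \<xi>[of j], of "1/2" "1/2"] by (simp only:)
      qed
      then have "Inf A \<le> ?E (\<lambda>x. 1/2 * v i x + 1/2 * v j x)" by (rule InfA)
      also have "\<dots> = ip (\<lambda>x. (1/2) *\<^sub>R (?g x + ?h x)) (\<lambda>x. (1/2) *\<^sub>R (?g x + ?h x))"
      proof -
        have "grad (\<lambda>x. 1/2 * v i x + 1/2 * v j x) = (\<lambda>x. (1/2) *\<^sub>R (?g x + ?h x))"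
          by (rule ext) (simp only: grad_add[OF smooth_cmult[OF smv] smooth_cmult[OF smv]] grad_cmult[OF smv] scaleR_add_right)
        then show ?thesis by simp
      qed
      also have "\<dots> = 1/4 * (ip ?g ?g + 2 * ip ?g ?h + ip ?h ?h)"
        unfolding energy_scale energy_add[OF fg(1,2)] by (simp add: power2_eq_square)
      finally have "4 * Inf A \<le> ip ?g ?g + 2 * ip ?g ?h + ip ?h ?h" by simp
      moreover have "?E (\<lambda>x. v i x - v j x) = ip ?g ?g - 2 * ip ?g ?h + ip ?h ?h"
      proof -
        have "grad (\<lambda>x. v i x - v j x) = (\<lambda>x. ?g x + (-1) *\<^sub>R ?h x)"
          by (rule ext) (simp add: grad_diff smv)
        then have "?E (\<lambda>x. v i x - v j x) = ip (\<lambda>x. ?g x + (-1) *\<^sub>R ?h x) (\<lambda>x. ?g x + (-1) *\<^sub>R ?h x)"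
          by (simp only:)
        also have "\<dots> = ip ?g ?g - 2 * ip ?g ?h + ip ?h ?h"
          unfolding energy_add[OF fg(1,3)] energy_scale ip_scale_right by simp
        finally show ?thesis .
      qed
      ultimately show ?thesis using Ev[of i] Ev[of j] by simp
    qed
  qed
qed

text \<open>The minimizing sequence is Cauchy in energy, so its gradients have
  \<open>L^1\<close>-summable increments and converge almost everywhere; by the Poincare inequality
  for test functions so do the functions. Fatou's lemma upgrades this to convergence in energy, the
  uniform bound to convergence in \<open>L^2\<close>, and near minimality becomes the equation in
  the limit.\<close>

lemma harmonic_replacement:
  assumes \<phi>: "smooth \<phi>"
  obtains v h where "(v, h) \<in> solutions a U" "fin h"
    "\<And>q. (LINT x|M. q \<bullet> h x) = (LINT x|M. q \<bullet> grad \<phi> x)"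
    "ip h h \<le> ip (grad \<phi>) (grad \<phi>)"
proof -
  obtain v :: "nat \<Rightarrow> real^'n \<Rightarrow> real" and K where
    smv: "\<And>j. smooth (v j)" and tv: "\<And>j. test_function U (\<lambda>x. v j x - v 0 x)" and
    K: "\<And>j x. x \<in> U \<Longrightarrow> \<bar>v j x\<bar> \<le> K" and
    mean: "\<And>j e. (LINT x|M. partial_deriv e (v j) x) = (LINT x|M. partial_deriv e \<phi> x)" and
    E\<phi>: "\<And>j. ip (grad (v j)) (grad (v j)) \<le> ip (grad \<phi>) (grad \<phi>) + (1/4) ^ j" and
    min: "\<And>j \<psi>. test_function U \<psi> \<Longrightarrow>
       ip (grad (v j)) (grad (v j)) \<le> ip (grad (\<lambda>x. v j x + \<psi> x)) (grad (\<lambda>x. v j x + \<psi> x)) + (1/4) ^ j" and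
    Cauchy: "\<And>i j. ip (grad (\<lambda>x. v i x - v j x)) (grad (\<lambda>x. v i x - v j x)) \<le> 2 * ((1/4) ^ i + (1/4) ^ j)"
    using bounded_minimizing_sequence[OF \<phi>] by blast
  let ?g = "\<lambda>j. grad (v j)"
  have fing: "fin (?g j)" for j by (intro fin_grad smv)
  have [measurable]: "?g j \<in> borel_measurable M" for j by (intro fin_measurable fing)
  have [measurable]: "v j \<in> borel_measurable M" for j by (intro continuous_measurable smooth_continuous smv)
  have graddiff: "grad (\<lambda>x. v i x - v j x) = (\<lambda>x. ?g i x - ?g j x)" for i j
    by (rule ext) (simp add: grad_diff smv)
  have quarter: "4 * (1/4) ^ j / (1/2) ^ j = (1/2) ^ j * (4::real)" for j
  proof -
    have "(1/4::real) ^ j = (1/2) ^ j * (1/2) ^ j" by (simp flip: power_mult_distrib)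
    then show ?thesis by simp
  qed
  \<comment> \<open>The choice \<open>t = (1/2) ^ j\<close> balances \<open>t W\<close> against the
    energy \<open>4 (1/4) ^ j\<close> divided by \<open>t\<close>.\<close>
  have L1: "(LINT x|M. norm (?g (Suc j) x - ?g j x)) \<le> (1/2) ^ j * (W + 4)" for j
  proof -
    have "2 * (LINT x|M. norm (?g (Suc j) x - ?g j x)) \<le> (1/2) ^ j * W + ip (\<lambda>x. ?g (Suc j) x - ?g j x) (\<lambda>x. ?g (Suc j) x - ?g j x) / (1/2) ^ j"
      by (rule norm_integrable(2)) (auto intro!: fin_diff fing)
    also have "ip (\<lambda>x. ?g (Suc j) x - ?g j x) (\<lambda>x. ?g (Suc j) x - ?g j x) / (1/2) ^ j \<le> 4 * (1/4) ^ j / (1/2) ^ j"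
    proof (intro divide_right_mono)
      have "ip (\<lambda>x. ?g (Suc j) x - ?g j x) (\<lambda>x. ?g (Suc j) x - ?g j x) \<le> 2 * ((1/4) ^ Suc j + (1/4) ^ j)"
        using Cauchy[of "Suc j" j] unfolding graddiff .
      also have "(1/4::real) ^ Suc j \<le> (1/4) ^ j" by (rule power_decreasing) auto
      finally show "ip (\<lambda>x. ?g (Suc j) x - ?g j x) (\<lambda>x. ?g (Suc j) x - ?g j x) \<le> 4 * (1/4) ^ j" by simp
    qed simp
    also have "4 * (1/4) ^ j / (1/2) ^ j = (1/2) ^ j * (4::real)" by (rule quarter)
    finally have "2 * (LINT x|M. norm (?g (Suc j) x - ?g j x)) \<le> (1/2) ^ j * (W + 4)"
      by (simp add: distrib_left)
    moreover have "0 \<le> (1/2) ^ j * (W + 4)" using W_nonneg by simp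
    ultimately show ?thesis by linarith
  qed
  have summ: "summable (\<lambda>j. (1/2) ^ j * c)" for c :: real
    by (intro summable_mult2 summable_geometric) simp
  have convg: "AE x in M. convergent (\<lambda>j. ?g j x)"
  proof (rule AE_convergent_of_summable_increments)
    show "integrable M (\<lambda>x. norm (?g (Suc j) x - ?g j x))" for j
      by (intro norm_integrable(1) fin_diff fing)
    show "summable (\<lambda>j. LINT x|M. norm (?g (Suc j) x - ?g j x))"
      by (rule summable_comparison_test'[OF summ[of "W + 4"], of 0]) (simp add: L1)
  qed
  obtain R where R: "0 \<le> R" "\<And>\<psi>. test_function U \<psi> \<Longrightarrow>
      (LINT x|M. \<bar>\<psi> x\<bar>) \<le> R * (LINT x|M. norm (grad \<psi> x))"
    using test_function_Poincare[OF U(1,2)] by metis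
  have convv: "AE x in M. convergent (\<lambda>j. v j x)"
  proof (rule AE_convergent_of_summable_increments)
    have t: "test_function U (\<lambda>x. v (Suc j) x - v j x)" for j
      using test_function_lincomb[OF tv[of "Suc j"] tv[of j], of 1 "-1"] by simp
    show "integrable M (\<lambda>x. norm (v (Suc j) x - v j x))" for j
      by (rule integrable_norm, rule integral_lebesgue_on_supported(2)[OF _ U(1,2) test_function_outside(1)[OF t]])
         (intro smooth_continuous smooth_diff smv)
    have "(LINT x|M. norm (v (Suc j) x - v j x)) \<le> (1/2) ^ j * (R * (W + 4))" for j
    proof -
      have "(LINT x|M. norm (v (Suc j) x - v j x)) \<le> R * (LINT x|M. norm (?g (Suc j) x - ?g j x))"
        using R(2)[OF t, of j] by (simp add: graddiff)
      also have "\<dots> \<le> R * ((1/2) ^ j * (W + 4))" by (intro mult_left_mono L1 R)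
      finally show ?thesis by (simp add: mult_ac)
    qed
    then show "summable (\<lambda>j. LINT x|M. norm (v (Suc j) x - v j x))"
      by (intro summable_comparison_test'[OF summ[of "R * (W + 4)"], of 0]) simp
  qed
  define h where "h = (\<lambda>x. lim (\<lambda>j. ?g j x))"
  define w where "w = (\<lambda>x. lim (\<lambda>j. v j x))"
  have [measurable]: "h \<in> borel_measurable M" unfolding h_def by measurable
  have [measurable]: "w \<in> borel_measurable M" unfolding w_def by measurable
  have limg: "AE x in M. (\<lambda>j. ?g j x) \<longlonglongrightarrow> h x"
    using convg by eventually_elim (simp add: h_def convergent_LIMSEQ_iff)
  have limv: "AE x in M. (\<lambda>j. v j x) \<longlonglongrightarrow> w x"
    using convv by eventually_elim (simp add: w_def convergent_LIMSEQ_iff)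
  have "0 \<le> K" using K[of _ 0] U(3) by (metis abs_ge_zero all_not_in_conv order_trans)
  \<comment> \<open>Fatou's lemma in \<open>k\<close>, as the Cauchy estimate is uniform in
    \<open>k\<close>.\<close>
  have tail: "(\<integral>\<^sup>+x. ennreal ((?g j x - h x) \<bullet> (a x *v (?g j x - h x))) \<partial>M) \<le> ennreal (4 * (1/4) ^ j)" for j
  proof (rule nn_integral_Fatou_le)
    show "(\<lambda>x. ennreal ((?g j x - ?g (j + k) x) \<bullet> (a x *v (?g j x - ?g (j + k) x)))) \<in> borel_measurable M" for k
      by (rule measurable_compose[OF ip_measurable measurable_ennreal]) measurable
    show "AE x in M. (\<lambda>k. ennreal ((?g j x - ?g (j + k) x) \<bullet> (a x *v (?g j x - ?g (j + k) x))))
        \<longlonglongrightarrow> ennreal ((?g j x - h x) \<bullet> (a x *v (?g j x - h x)))"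
      using limg
    proof eventually_elim
      fix x assume "(\<lambda>j. ?g j x) \<longlonglongrightarrow> h x"
      then have *: "(\<lambda>k. ?g (j + k) x) \<longlonglongrightarrow> h x"
        using LIMSEQ_ignore_initial_segment[of _ _ j] by (simp add: add.commute)
      show "(\<lambda>k. ennreal ((?g j x - ?g (j + k) x) \<bullet> (a x *v (?g j x - ?g (j + k) x))))
        \<longlonglongrightarrow> ennreal ((?g j x - h x) \<bullet> (a x *v (?g j x - h x)))"
        by (intro tendsto_ennrealI tendsto_inner tendsto_diff tendsto_const *
            bounded_linear.tendsto[OF matrix_vector_mul_bounded_linear])
    qed
    fix k
    have "(\<integral>\<^sup>+x. ennreal ((?g j x - ?g (j + k) x) \<bullet> (a x *v (?g j x - ?g (j + k) x))) \<partial>M) =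
        ennreal (ip (\<lambda>x. ?g j x - ?g (j + k) x) (\<lambda>x. ?g j x - ?g (j + k) x))"
      by (rule nn_energy) (intro fin_diff fing)
    also have "\<dots> \<le> ennreal (4 * (1/4) ^ j)"
    proof (rule ennreal_leI)
      have "ip (\<lambda>x. ?g j x - ?g (j + k) x) (\<lambda>x. ?g j x - ?g (j + k) x) \<le> 2 * ((1/4) ^ j + (1/4) ^ (j + k))"
        using Cauchy[of j "j + k"] unfolding graddiff .
      also have "(1/4::real) ^ (j + k) \<le> (1/4) ^ j" by (rule power_decreasing) auto
      finally show "ip (\<lambda>x. ?g j x - ?g (j + k) x) (\<lambda>x. ?g j x - ?g (j + k) x) \<le> 4 * (1/4) ^ j" by simp
    qed
    finally show "(\<integral>\<^sup>+x. ennreal ((?g j x - ?g (j + k) x) \<bullet> (a x *v (?g j x - ?g (j + k) x))) \<partial>M) \<le> ennreal (4 * (1/4) ^ j)" .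
  qed
  have find: "fin (\<lambda>x. ?g j x - h x)" for j
    by (rule finI) (use tail[of j] in \<open>auto simp: le_less_trans[OF _ ennreal_less_top]\<close>)
  have finh: "fin h" using fin_diff[OF fing[of 0] find[of 0]] by simp
  have Ed: "ip (\<lambda>x. ?g j x - h x) (\<lambda>x. ?g j x - h x) \<le> 4 * (1/4) ^ j" for j
    using tail[of j] unfolding nn_energy[OF find] by (subst (asm) ennreal_le_iff) auto
  have Eh: "ip h h \<le> ip (grad \<phi>) (grad \<phi>)"
  proof -
    have "(\<integral>\<^sup>+x. ennreal (h x \<bullet> (a x *v h x)) \<partial>M) \<le> ennreal (ip (grad \<phi>) (grad \<phi>) + (1/4) ^ J)" for J
    proof (rule nn_integral_Fatou_le)
      show "(\<lambda>x. ennreal (?g (J + k) x \<bullet> (a x *v ?g (J + k) x))) \<in> borel_measurable M" for k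
        by (rule measurable_compose[OF ip_measurable measurable_ennreal]) measurable
      show "AE x in M. (\<lambda>k. ennreal (?g (J + k) x \<bullet> (a x *v ?g (J + k) x))) \<longlonglongrightarrow> ennreal (h x \<bullet> (a x *v h x))"
        using limg
      proof eventually_elim
        fix x assume "(\<lambda>j. ?g j x) \<longlonglongrightarrow> h x"
        then have *: "(\<lambda>k. ?g (J + k) x) \<longlonglongrightarrow> h x"
          using LIMSEQ_ignore_initial_segment[of _ _ J] by (simp add: add.commute)
        show "(\<lambda>k. ennreal (?g (J + k) x \<bullet> (a x *v ?g (J + k) x))) \<longlonglongrightarrow> ennreal (h x \<bullet> (a x *v h x))"
          by (intro tendsto_ennrealI tendsto_inner * bounded_linear.tendsto[OF matrix_vector_mul_bounded_linear])
      qed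
      fix k
      have "ip (?g (J + k)) (?g (J + k)) \<le> ip (grad \<phi>) (grad \<phi>) + (1/4) ^ (J + k)" by (rule E\<phi>)
      also have "(1/4::real) ^ (J + k) \<le> (1/4) ^ J" by (rule power_decreasing) auto
      finally show "(\<integral>\<^sup>+x. ennreal (?g (J + k) x \<bullet> (a x *v ?g (J + k) x)) \<partial>M) \<le> ennreal (ip (grad \<phi>) (grad \<phi>) + (1/4) ^ J)"
        unfolding nn_energy[OF fing] by (intro ennreal_leI) simp
    qed
    then have "ip h h \<le> ip (grad \<phi>) (grad \<phi>) + (1/4) ^ J" for J
      unfolding nn_energy[OF finh] using energy_nonneg'[of "grad \<phi>"] by (subst (asm) ennreal_le_iff) auto
    moreover have "(1/4::real) ^ J \<le> (1/2) ^ J * 1" for J by (simp add: power_mono)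
    ultimately have "ip h h - ip (grad \<phi>) (grad \<phi>) \<le> (1/2) ^ J * 1" for J
      by (smt (verit))
    from real_le_of_small[OF this] show ?thesis by simp
  qed
  have Lh: "(LINT x|M. norm (?g j x - h x)) \<le> (1/2) ^ j * (W + 4)" for j
  proof -
    have "2 * (LINT x|M. norm (?g j x - h x)) \<le> (1/2) ^ j * W + ip (\<lambda>x. ?g j x - h x) (\<lambda>x. ?g j x - h x) / (1/2) ^ j"
      by (rule norm_integrable(2)[OF find]) simp
    also have "ip (\<lambda>x. ?g j x - h x) (\<lambda>x. ?g j x - h x) / (1/2) ^ j \<le> 4 * (1/4) ^ j / (1/2) ^ j"
      by (intro divide_right_mono Ed) simp
    also have "4 * (1/4) ^ j / (1/2) ^ j = (1/2) ^ j * (4::real)" by (rule quarter)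
    finally have "2 * (LINT x|M. norm (?g j x - h x)) \<le> (1/2) ^ j * (W + 4)"
      by (simp add: distrib_left)
    moreover have "0 \<le> (1/2) ^ j * (W + 4)" using W_nonneg by simp
    ultimately show ?thesis by linarith
  qed
  \<comment> \<open>All \<open>v j\<close> have the mean gradient of \<open>\<phi>\<close>, and
    \<open>L^1\<close> convergence passes it on to the limit.\<close>
  have meanh: "(LINT x|M. q \<bullet> h x) = (LINT x|M. q \<bullet> grad \<phi> x)" for q
  proof -
    have intq: "integrable M (\<lambda>x. q \<bullet> k x)" if "fin k" for k
      using fin_integrable[OF that] by (rule integrable_inner_right)
    have qg: "(LINT x|M. q \<bullet> ?g j x) = (LINT x|M. q \<bullet> grad \<phi> x)" for j
    proof -
      have "(LINT x|M. q \<bullet> grad f x) = (\<Sum>e\<in>UNIV. q $ e * (LINT x|M. partial_deriv e f x))" if "smooth f" for f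
      proof -
        have "integrable M (\<lambda>x. grad f x $ e)" for e
          by (rule fin_component_integrable[OF fin_grad[OF that]])
        then show ?thesis by (simp add: inner_vec_def grad_component)
      qed
      then show ?thesis using smv \<phi> mean by simp
    qed
    have "\<bar>(LINT x|M. q \<bullet> grad \<phi> x) - (LINT x|M. q \<bullet> h x)\<bar> \<le> (1/2) ^ j * ((W + 4) * norm q)" for j
    proof -
      have "(LINT x|M. q \<bullet> grad \<phi> x) - (LINT x|M. q \<bullet> h x) = (LINT x|M. q \<bullet> (?g j x - h x))"
        using intq[OF fing] intq[OF finh] by (simp add: inner_diff_right qg[symmetric, of j])
      also have "\<bar>\<dots>\<bar> \<le> (LINT x|M. norm (q \<bullet> (?g j x - h x)))"
        unfolding real_norm_def[symmetric] by (rule integral_norm_bound)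
      also have "\<dots> \<le> (LINT x|M. norm q * norm (?g j x - h x))"
        by (intro integral_mono integrable_norm intq find integrable_mult_right norm_integrable(1))
           (simp add: Cauchy_Schwarz_ineq2)
      also have "\<dots> = norm q * (LINT x|M. norm (?g j x - h x))" by simp
      also have "\<dots> \<le> norm q * ((1/2) ^ j * (W + 4))" by (intro mult_left_mono Lh) simp
      finally show ?thesis by (simp add: mult_ac)
    qed
    from real_le_of_small[OF this] show ?thesis by simp
  qed
  have H1: "(w, h) \<in> H1 a U"
    unfolding H1_def
  proof (safe intro!: exI[of _ v] smv)
    \<comment> \<open>Dominated convergence with the constant \<open>(2 K)\<^sup>2\<close> on a
      domain of finite measure; this is where the truncation pays off.\<close>
    have "(\<lambda>j. \<integral>\<^sup>+x. ennreal ((v j x - w x)\<^sup>2) \<partial>M) \<longlonglongrightarrow> (\<integral>\<^sup>+x. 0 \<partial>M)"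
    proof (rule nn_integral_dominated_convergence)
      show "(\<lambda>x. ennreal ((v j x - w x)\<^sup>2)) \<in> borel_measurable M" for j by measurable
      show "(\<lambda>x. 0) \<in> borel_measurable M" "(\<lambda>x. ennreal ((2 * K)\<^sup>2)) \<in> borel_measurable M" by simp_all
      show "(\<integral>\<^sup>+x. ennreal ((2 * K)\<^sup>2) \<partial>M) < \<infinity>"
        using finite_measure.emeasure_finite[OF finite_M, of U]
        by (simp add: ennreal_mult_less_top less_top)
      have ge: "AE x in M. \<bar>w x\<bar> \<le> K"
        using limv AE_space
      proof eventually_elim
        fix x assume x: "(\<lambda>j. v j x) \<longlonglongrightarrow> w x" "x \<in> space M"
        then have "(\<lambda>j. \<bar>v j x\<bar>) \<longlonglongrightarrow> \<bar>w x\<bar>" by (intro tendsto_rabs)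
        then show "\<bar>w x\<bar> \<le> K" using K x(2) by (intro LIMSEQ_le_const2[of _ "\<bar>w x\<bar>" K]) auto
      qed
      show "AE x in M. ennreal ((v j x - w x)\<^sup>2) \<le> ennreal ((2 * K)\<^sup>2)" for j
        using ge AE_space
      proof eventually_elim
        fix x assume "\<bar>w x\<bar> \<le> K" "x \<in> space M"
        then have "\<bar>v j x - w x\<bar> \<le> 2 * K" using K[of x j] by simp
        then show "ennreal ((v j x - w x)\<^sup>2) \<le> ennreal ((2 * K)\<^sup>2)"
          using power_mono[of "\<bar>v j x - w x\<bar>" "2 * K" 2] by (intro ennreal_leI) (simp only: power2_abs abs_ge_zero simp_thms)
      qed
      show "AE x in M. (\<lambda>j. ennreal ((v j x - w x)\<^sup>2)) \<longlonglongrightarrow> 0"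
        using limv
      proof eventually_elim
        fix x assume "(\<lambda>j. v j x) \<longlonglongrightarrow> w x"
        then have "(\<lambda>j. ennreal ((v j x - w x)\<^sup>2)) \<longlonglongrightarrow> ennreal ((w x - w x)\<^sup>2)"
          by (intro tendsto_ennrealI tendsto_power tendsto_diff tendsto_const)
        then show "(\<lambda>j. ennreal ((v j x - w x)\<^sup>2)) \<longlonglongrightarrow> 0" by simp
      qed
    qed
    moreover have "(\<lambda>j. \<integral>\<^sup>+x. ennreal ((?g j x - h x) \<bullet> (a x *v (?g j x - h x))) \<partial>M) \<longlonglongrightarrow> 0"
    proof (rule tendsto_sandwich[OF _ _ tendsto_const])
      have "(\<lambda>j. 4 * (1/4) ^ j) \<longlonglongrightarrow> (4 * 0 :: real)"
        by (intro tendsto_mult tendsto_const LIMSEQ_realpow_zero) auto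
      then show "(\<lambda>j. ennreal (4 * (1/4) ^ j)) \<longlonglongrightarrow> 0" using tendsto_ennrealI by fastforce
    qed (use tail in auto)
    ultimately show "(\<lambda>j. (\<integral>\<^sup>+x. ennreal ((v j x - w x)\<^sup>2) \<partial>M) +
        (\<integral>\<^sup>+x. ennreal ((?g j x - h x) \<bullet> (a x *v (?g j x - h x))) \<partial>M)) \<longlonglongrightarrow> 0"
      using tendsto_add by fastforce
  qed measurable
  have harm: "(LINT x|M. grad \<psi> x \<bullet> (a x *v h x)) = 0" if \<psi>: "test_function U \<psi>" for \<psi>
  proof -
    have sm\<psi>: "smooth \<psi>" using \<psi> by (simp add: test_function_def)
    let ?E = "ip (grad \<psi>) (grad \<psi>)"
    have E0: "0 \<le> ?E" by (rule energy_nonneg')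
    have f\<psi>: "fin (grad \<psi>)" by (rule fin_grad[OF sm\<psi>])
    have near: "2 * \<bar>ip (grad \<psi>) (?g j)\<bar> \<le> (1/2) ^ j * (?E + 1)" for j
    proof -
      have "- (2 * s * ip (grad \<psi>) (?g j)) \<le> (1/2) ^ j * (?E + 1)" if s: "\<bar>s\<bar> = 1" for s
      proof -
        \<comment> \<open>The step is the square root of the minimality defect: after division by it
          both the defect and the second-order term are of order \<open>(1/2) ^ j\<close>. The
          number \<open>s\<close> is a sign.\<close>
        let ?t = "s * (1/2) ^ j"
        have gr: "grad (\<lambda>x. v j x + ?t * \<psi> x) = (\<lambda>x. ?t *\<^sub>R grad \<psi> x + ?g j x)"
          by (rule ext) (simp add: grad_add smv smooth_cmult sm\<psi> grad_cmult)
        have "test_function U (\<lambda>x. ?t * \<psi> x)"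
          using test_function_lincomb[OF \<psi> \<psi>, of ?t 0] by simp
        from min[OF this, of j] have "ip (?g j) (?g j) \<le> ip (\<lambda>x. ?t *\<^sub>R grad \<psi> x + ?g j x) (\<lambda>x. ?t *\<^sub>R grad \<psi> x + ?g j x) + (1/4) ^ j"
          unfolding gr .
        also have "ip (\<lambda>x. ?t *\<^sub>R grad \<psi> x + ?g j x) (\<lambda>x. ?t *\<^sub>R grad \<psi> x + ?g j x) =
            ?t\<^sup>2 * ?E + 2 * ip (\<lambda>x. ?t *\<^sub>R grad \<psi> x) (?g j) + ip (?g j) (?g j)"
          unfolding energy_add[OF fin_scale[OF f\<psi>] fing] energy_scale ..
        also have "ip (\<lambda>x. ?t *\<^sub>R grad \<psi> x) (?g j) = ?t * ip (grad \<psi>) (?g j)"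
          by (simp add: ip_def)
        also have "?t\<^sup>2 = (1/4) ^ j"
        proof -
          have "s\<^sup>2 = 1" using s by (metis one_power2 power2_abs)
          moreover have "((1/2) ^ j)\<^sup>2 = (1/4::real) ^ j"
            by (simp add: power2_eq_square flip: power_mult_distrib)
          ultimately show ?thesis by (simp only: power_mult_distrib mult_1)
        qed
        finally have "- (2 * ?t * ip (grad \<psi>) (?g j)) \<le> (1/4) ^ j * (?E + 1)" by (simp add: algebra_simps)
        also have "(1/4::real) ^ j = (1/2) ^ j * (1/2) ^ j" by (simp flip: power_mult_distrib)
        finally have "(1/2) ^ j * - (2 * s * ip (grad \<psi>) (?g j)) \<le> (1/2) ^ j * ((1/2) ^ j * (?E + 1))"
          by (simp only: mult.assoc mult_minus_right mult.left_commute)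
        then show ?thesis by (subst (asm) mult_le_cancel_left_pos) auto
      qed
      from this[of 1] this[of "-1"] show ?thesis by (simp add: abs_if)
    qed
    have "2 * \<bar>ip (grad \<psi>) h\<bar> \<le> (1/2) ^ j * (2 * ?E + 5)" for j
    proof -
      have "ip (grad \<psi>) (?g j) = ip (grad \<psi>) (\<lambda>x. (?g j x - h x) + h x)" by simp
      also have "\<dots> = ip (grad \<psi>) (\<lambda>x. ?g j x - h x) + ip (grad \<psi>) h"
        by (rule ip_add_right[OF f\<psi> find finh])
      finally have "2 * \<bar>ip (grad \<psi>) h\<bar> \<le> 2 * \<bar>ip (grad \<psi>) (?g j)\<bar> + 2 * \<bar>ip (grad \<psi>) (\<lambda>x. ?g j x - h x)\<bar>"
        by linarith
      also have "2 * \<bar>ip (grad \<psi>) (\<lambda>x. ?g j x - h x)\<bar> \<le> (1/2) ^ j * ?E + ip (\<lambda>x. ?g j x - h x) (\<lambda>x. ?g j x - h x) / (1/2) ^ j"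
        by (rule ip_bound[OF f\<psi> find]) simp
      also have "ip (\<lambda>x. ?g j x - h x) (\<lambda>x. ?g j x - h x) / (1/2) ^ j \<le> 4 * (1/4) ^ j / (1/2) ^ j"
        by (intro divide_right_mono Ed) simp
      also have "4 * (1/4) ^ j / (1/2) ^ j = (1/2) ^ j * (4::real)" by (rule quarter)
      finally show ?thesis using near[of j] by (simp add: distrib_left)
    qed
    from real_le_of_small[OF this] show ?thesis by (simp add: ip_def)
  qed
  have "(w, h) \<in> solutions a U" using H1 harm by (simp add: solutions_def)
  with that finh meanh Eh show thesis by blast
qed

end

subsection \<open>Quadratic forms\<close>

text \<open>Cauchy's functional equation: \<open>g t = f t - t f 1\<close> is additive and vanishes
  on the integers, so it is periodic and bounded; since \<open>n g(t) = g(n t)\<close>, it is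
  zero.\<close>

lemma additive_bounded_imp_linear:
  fixes f :: "real \<Rightarrow> real"
  assumes add: "\<And>x y. f (x + y) = f x + f y" and bound: "\<And>x. 0 \<le> x \<Longrightarrow> x \<le> 1 \<Longrightarrow> \<bar>f x\<bar> \<le> K"
  shows "f t = t * f 1"
proof -
  define g where "g = (\<lambda>t. f t - t * f 1)"
  have gadd: "g (x + y) = g x + g y" for x y by (simp add: g_def add algebra_simps)
  have g0: "g 0 = 0" using gadd[of 0 0] by simp
  have gnat: "g (real n * x) = real n * g x" for n x
    by (induction n) (auto simp: g0 gadd algebra_simps)
  have gint: "g (of_int k + x) = g x" for k x
  proof -
    have "g (real n) = 0" for n using gnat[of n 1] by (simp add: g_def)
    moreover have "g (- real n) = 0" for n
      using gadd[of "real n" "- real n"] calculation[of n] g0 by simp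
    ultimately have "g (of_int k) = 0" by (cases k rule: int_cases2) auto
    then show ?thesis by (simp add: gadd)
  qed
  have "\<bar>g x\<bar> \<le> K + \<bar>f 1\<bar>" for x
  proof -
    have "g x = g (frac x)" using gint[of "\<lfloor>x\<rfloor>" "frac x"] by (simp add: frac_def)
    moreover have "0 \<le> frac x" "frac x \<le> 1" using frac_lt_1[of x] by auto
    moreover from this have "\<bar>frac x * f 1\<bar> \<le> \<bar>f 1\<bar>" by (simp add: abs_mult mult_left_le_one_le)
    moreover have "\<bar>f (frac x)\<bar> \<le> K" using calculation by (intro bound) auto
    ultimately show ?thesis unfolding g_def by linarith
  qed
  then have *: "real n * \<bar>g t\<bar> \<le> K + \<bar>f 1\<bar>" for n
    using gnat[of n t] by (metis abs_mult abs_of_nat)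
  have "g t = 0"
  proof (rule ccontr)
    assume "g t \<noteq> 0"
    then obtain n :: nat where "K + \<bar>f 1\<bar> < real n * \<bar>g t\<bar>"
      using reals_Archimedean3[of "\<bar>g t\<bar>"] by auto
    with *[of n] show False by simp
  qed
  then show ?thesis by (simp add: g_def)
qed

text \<open>The Jordan-von Neumann theorem. One half of the parallelogram law implies the other when
  applied to \<open>p + q\<close> and \<open>p - q\<close>. The quadratic bound supplies the local
  boundedness by which additivity of the polar form becomes linearity.\<close>

lemma quadratic_form_matrix:
  fixes Q :: "real^'n \<Rightarrow> real"
  assumes par: "\<And>p q. 2 * Q p + 2 * Q q \<le> Q (p + q) + Q (p - q)"
    and hom: "\<And>t p. Q (t *\<^sub>R p) = t\<^sup>2 * Q p"
    and bound: "\<And>p. 0 \<le> Q p" "\<And>p. Q p \<le> c * (norm p)\<^sup>2"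
  shows "\<exists>!B. transpose B = B \<and> (\<forall>q. q \<bullet> (B *v q) = Q q)"
proof (rule ex_ex1I)
  have par': "Q (p + q) + Q (p - q) = 2 * Q p + 2 * Q q" for p q
  proof -
    have "2 * Q (p + q) + 2 * Q (p - q) \<le> Q (2 *\<^sub>R p) + Q (2 *\<^sub>R q)"
      using par[of "p + q" "p - q"] by (simp add: scaleR_2)
    then show ?thesis using par[of p q] unfolding hom by simp
  qed
  have Q0: "Q 0 = 0" using hom[of 0 0] by simp
  have Qm: "Q (- p) = Q p" for p using hom[of "-1" p] by simp
  define b where "b = (\<lambda>p q. (Q (p + q) - Q (p - q)) / 4)"
  have sym: "b p q = b q p" for p q
    using Qm[of "p - q"] by (simp add: b_def add.commute)
  \<comment> \<open>The parallelogram law at \<open>p + q, p' + q\<close> and at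
    \<open>p - q, p' - q\<close>, subtracted. The special case \<open>p' = 0\<close> reads
    \<open>b p q = b p (2 q) / 2\<close>; used at \<open>p + p'\<close>, it turns this identity into
    additivity.\<close>
  have double: "b p q + b p' q = b (p + p') (2 *\<^sub>R q) / 2" for p p' q
  proof -
    have "(p + q) + (p' + q) = (p + p') + 2 *\<^sub>R q" "(p + q) - (p' + q) = p - p'"
      "(p - q) + (p' - q) = (p + p') - 2 *\<^sub>R q" "(p - q) - (p' - q) = p - p'"
      by (simp_all add: scaleR_2)
    then have "Q ((p + p') + 2 *\<^sub>R q) + Q (p - p') = 2 * Q (p + q) + 2 * Q (p' + q)"
      "Q ((p + p') - 2 *\<^sub>R q) + Q (p - p') = 2 * Q (p - q) + 2 * Q (p' - q)"
      using par'[of "p + q" "p' + q"] par'[of "p - q" "p' - q"] by (simp_all only:)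
    moreover have b4: "4 * b x y = Q (x + y) - Q (x - y)" for x y by (simp add: b_def)
    ultimately have "4 * b p q + 4 * b p' q = 2 * b (p + p') (2 *\<^sub>R q)"
      using b4[of p q] b4[of p' q] b4[of "p + p'" "2 *\<^sub>R q"] by linarith
    then show ?thesis by simp
  qed
  have b0: "b 0 q = 0" for q using Qm[of q] by (simp add: b_def)
  have add: "b (p + p') q = b p q + b p' q" for p p' q
    using double[of p q p'] double[of "p + p'" q 0] b0 by simp
  have bb: "\<bar>b p q\<bar> \<le> c * (norm p)\<^sup>2 + c * (norm q)\<^sup>2" for p q
  proof -
    have "\<bar>b p q\<bar> \<le> (Q (p + q) + Q (p - q)) / 4"
      using bound(1)[of "p + q"] bound(1)[of "p - q"] by (simp add: b_def abs_le_iff)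
    also have "\<dots> = (Q p + Q q) / 2" by (simp add: par')
    also have "\<dots> \<le> Q p + Q q" using bound(1)[of p] bound(1)[of q] by simp
    also have "\<dots> \<le> c * (norm p)\<^sup>2 + c * (norm q)\<^sup>2" by (intro add_mono bound)
    finally show ?thesis .
  qed
  have c0: "0 \<le> c" using order.trans[OF bound(1)[of "axis undefined 1"] bound(2)] by (simp add: norm_axis_real)
  have scale: "b (t *\<^sub>R p) q = t * b p q" for t p q
  proof -
    have "b (t *\<^sub>R p) q = t * b (1 *\<^sub>R p) q"
    proof (rule additive_bounded_imp_linear[where K = "c * (norm p)\<^sup>2 + c * (norm q)\<^sup>2"])
      show "b ((x + y) *\<^sub>R p) q = b (x *\<^sub>R p) q + b (y *\<^sub>R p) q" for x y
        by (simp add: scaleR_add_left add)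
      fix x :: real assume x: "0 \<le> x" "x \<le> 1"
      have "x\<^sup>2 * (norm p)\<^sup>2 \<le> 1 * (norm p)\<^sup>2" using x by (intro mult_right_mono power_le_one) auto
      then have "c * (norm (x *\<^sub>R p))\<^sup>2 \<le> c * (norm p)\<^sup>2"
        using c0 by (intro mult_left_mono) (auto simp: power_mult_distrib)
      then show "\<bar>b (x *\<^sub>R p) q\<bar> \<le> c * (norm p)\<^sup>2 + c * (norm q)\<^sup>2" using bb[of "x *\<^sub>R p" q] by simp
    qed
    then show ?thesis by simp
  qed
  have lin: "linear (\<lambda>p. b p q)" for q by (rule linearI) (simp_all add: add scale)
  define f where "f = (\<lambda>q. \<chi> i. b (axis i 1) q)"
  have linf: "linear f"
    by (rule linearI) (simp_all add: f_def vec_eq_iff sym[of "axis _ _"] add scale)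
  have f: "p \<bullet> f q = b p q" for p q
  proof -
    have "b p q = b (\<Sum>i\<in>UNIV. p $ i *\<^sub>R axis i 1) q"
      by (simp add: basis_expansion scalar_mult_eq_scaleR[symmetric])
    also have "\<dots> = (\<Sum>i\<in>UNIV. p $ i * b (axis i 1) q)"
      by (simp add: linear_sum[OF lin] linear_cmul[OF lin])
    finally show ?thesis by (simp add: f_def inner_vec_def)
  qed
  have mf: "matrix f *v q = f q" for q by (simp add: linf)
  have "transpose (matrix f) = matrix f"
    by (rule transpose_eq_selfI) (simp add: mf f sym inner_commute[of "f _"])
  moreover have "q \<bullet> (matrix f *v q) = Q q" for q
    using hom[of 2 q] by (simp add: mf f b_def scaleR_2 Q0)
  ultimately show "\<exists>B. transpose B = B \<and> (\<forall>q. q \<bullet> (B *v q) = Q q)" by blast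
next
  fix B B' :: "real^'n^'n"
  assume B: "transpose B = B \<and> (\<forall>q. q \<bullet> (B *v q) = Q q)"
    and B': "transpose B' = B' \<and> (\<forall>q. q \<bullet> (B' *v q) = Q q)"
  have polar: "4 * (p \<bullet> (D *v q)) = Q (p + q) - Q (p - q)"
    if "transpose D = D \<and> (\<forall>q. q \<bullet> (D *v q) = Q q)" for D :: "real^'n^'n" and p q
  proof -
    have "Q (p + q) = (p + q) \<bullet> (D *v (p + q))" "Q (p - q) = (p - q) \<bullet> (D *v (p - q))"
      using that by auto
    then show ?thesis
      using inner_matrix_sym[of D p q] that
      by (simp add: matrix_vector_right_distrib matrix_vector_mult_diff_distrib inner_simps inner_commute)
  qed
  have "p \<bullet> (B *v q) = p \<bullet> (B' *v q)" for p q
    using polar[OF B, of p q] polar[OF B', of p q] by simp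
  then have "B *v q = B' *v q" for q by (metis vector_eq_ldot)
  then show "B = B'" by (simp add: matrix_eq)
qed

subsection \<open>The coarse-grained matrix\<close>

context coefficient_domain
begin

lemma nn_energy_measurable:
  "h \<in> borel_measurable M \<Longrightarrow> (\<lambda>x. ennreal (h x \<bullet> (a x *v h x))) \<in> borel_measurable M"
  by (rule measurable_compose[OF ip_measurable measurable_ennreal])

lemma smooth_measurable: "smooth \<phi> \<Longrightarrow> \<phi> \<in> borel_measurable M" "smooth \<phi> \<Longrightarrow> grad \<phi> \<in> borel_measurable M"
  by (auto intro: continuous_measurable smooth_continuous smooth_continuous_grad)

lemma H1_fin:
  assumes "(u, g) \<in> H1 a U"
  shows "fin g"
proof -
  have g: "g \<in> borel_measurable M" using assms by (simp add: H1_def)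
  obtain \<phi> where \<phi>: "\<And>j. smooth (\<phi> j)" and lim: "(\<lambda>j. (\<integral>\<^sup>+x. ennreal ((\<phi> j x - u x)\<^sup>2) \<partial>M) +
      (\<integral>\<^sup>+x. ennreal ((grad (\<phi> j) x - g x) \<bullet> (a x *v (grad (\<phi> j) x - g x))) \<partial>M)) \<longlonglongrightarrow> 0"
    using assms by (auto simp: H1_def)
  have "eventually (\<lambda>j. (\<integral>\<^sup>+x. ennreal ((\<phi> j x - u x)\<^sup>2) \<partial>M) +
      (\<integral>\<^sup>+x. ennreal ((grad (\<phi> j) x - g x) \<bullet> (a x *v (grad (\<phi> j) x - g x))) \<partial>M) < \<infinity>) sequentially"
    using order_tendstoD(2)[OF lim, of \<infinity>] by simp
  from eventually_happens'[OF sequentially_bot this] obtain j where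
    "(\<integral>\<^sup>+x. ennreal ((grad (\<phi> j) x - g x) \<bullet> (a x *v (grad (\<phi> j) x - g x))) \<partial>M) < \<infinity>"
    by auto
  then have "fin (\<lambda>x. grad (\<phi> j) x - g x)"
    using g smooth_measurable[OF \<phi>] by (intro finI borel_measurable_diff)
  from fin_diff[OF fin_grad[OF \<phi>[of j]] this] show ?thesis by simp
qed

text \<open>Together with \<open>H1_scale\<close> this makes the solutions a linear space, on which
  homogeneity and the parallelogram law of \<open>Qfun\<close> rest.\<close>

lemma H1_add:
  assumes "(u, g) \<in> H1 a U" "(u', g') \<in> H1 a U"
  shows "(\<lambda>x. u x + u' x, \<lambda>x. g x + g' x) \<in> H1 a U"
proof -
  have m: "u \<in> borel_measurable M" "g \<in> borel_measurable M" "u' \<in> borel_measurable M" "g' \<in> borel_measurable M"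
    using assms by (auto simp: H1_def)
  let ?D = "\<lambda>\<phi> u g. (\<integral>\<^sup>+x. ennreal ((\<phi> x - u x)\<^sup>2) \<partial>M) +
      (\<integral>\<^sup>+x. ennreal ((grad \<phi> x - g x) \<bullet> (a x *v (grad \<phi> x - g x))) \<partial>M)"
  obtain \<phi> where \<phi>: "\<And>j. smooth (\<phi> j)" and lim: "(\<lambda>j. ?D (\<phi> j) u g) \<longlonglongrightarrow> 0"
    using assms(1) by (auto simp: H1_def)
  obtain \<phi>' where \<phi>': "\<And>j. smooth (\<phi>' j)" and lim': "(\<lambda>j. ?D (\<phi>' j) u' g') \<longlonglongrightarrow> 0"
    using assms(2) by (auto simp: H1_def)
  have le: "?D (\<lambda>x. \<phi> j x + \<phi>' j x) (\<lambda>x. u x + u' x) (\<lambda>x. g x + g' x) \<le> 2 * (?D (\<phi> j) u g + ?D (\<phi>' j) u' g')" for j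
  proof -
    have m1: "(\<lambda>x. ennreal ((\<phi> j x - u x)\<^sup>2)) \<in> borel_measurable M"
      "(\<lambda>x. ennreal ((\<phi>' j x - u' x)\<^sup>2)) \<in> borel_measurable M"
      by (intro measurable_compose[OF _ measurable_ennreal] borel_measurable_power borel_measurable_diff m smooth_measurable(1) \<phi> \<phi>')+
    have m2: "(\<lambda>x. ennreal ((grad (\<phi> j) x - g x) \<bullet> (a x *v (grad (\<phi> j) x - g x)))) \<in> borel_measurable M"
      "(\<lambda>x. ennreal ((grad (\<phi>' j) x - g' x) \<bullet> (a x *v (grad (\<phi>' j) x - g' x)))) \<in> borel_measurable M"
      by (intro nn_energy_measurable borel_measurable_diff m smooth_measurable(2) \<phi> \<phi>')+
    have "(\<integral>\<^sup>+x. ennreal (((\<phi> j x + \<phi>' j x) - (u x + u' x))\<^sup>2) \<partial>M) \<le>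
        (\<integral>\<^sup>+x. 2 * (ennreal ((\<phi> j x - u x)\<^sup>2) + ennreal ((\<phi>' j x - u' x)\<^sup>2)) \<partial>M)"
    proof (intro nn_integral_mono)
      fix x
      let ?s = "\<phi> j x - u x" and ?t = "\<phi>' j x - u' x"
      have "((\<phi> j x + \<phi>' j x) - (u x + u' x))\<^sup>2 = (?s + ?t)\<^sup>2" by (simp add: algebra_simps)
      also have "\<dots> \<le> 2 * (?s\<^sup>2 + ?t\<^sup>2)" using sum_squares_bound[of ?s ?t] by (simp add: power2_sum)
      finally have "ennreal (((\<phi> j x + \<phi>' j x) - (u x + u' x))\<^sup>2) \<le> ennreal (2 * (?s\<^sup>2 + ?t\<^sup>2))" by (rule ennreal_leI)
      then show "ennreal (((\<phi> j x + \<phi>' j x) - (u x + u' x))\<^sup>2) \<le> 2 * (ennreal (?s\<^sup>2) + ennreal (?t\<^sup>2))"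
        by (simp add: ennreal_mult)
    qed
    moreover have "(\<integral>\<^sup>+x. ennreal ((grad (\<lambda>x. \<phi> j x + \<phi>' j x) x - (g x + g' x)) \<bullet> (a x *v (grad (\<lambda>x. \<phi> j x + \<phi>' j x) x - (g x + g' x)))) \<partial>M) \<le>
        (\<integral>\<^sup>+x. 2 * (ennreal ((grad (\<phi> j) x - g x) \<bullet> (a x *v (grad (\<phi> j) x - g x))) +
           ennreal ((grad (\<phi>' j) x - g' x) \<bullet> (a x *v (grad (\<phi>' j) x - g' x)))) \<partial>M)"
    proof (intro nn_integral_mono)
      fix x assume "x \<in> space M"
      then have x: "x \<in> U" by simp
      let ?s = "grad (\<phi> j) x - g x" and ?t = "grad (\<phi>' j) x - g' x"
      have eq: "grad (\<lambda>x. \<phi> j x + \<phi>' j x) x - (g x + g' x) = ?s + ?t" by (simp add: grad_add \<phi> \<phi>')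
      have "(?s + ?t) \<bullet> (a x *v (?s + ?t)) \<le> 2 * (?s \<bullet> (a x *v ?s) + ?t \<bullet> (a x *v ?t))"
        unfolding psd_matrix_energy_add[OF psd[OF x]] using energy_polar(1)[OF x, of ?s ?t] by simp
      then have "ennreal ((?s + ?t) \<bullet> (a x *v (?s + ?t))) \<le> ennreal (2 * (?s \<bullet> (a x *v ?s) + ?t \<bullet> (a x *v ?t)))"
        by (rule ennreal_leI)
      also have "\<dots> = 2 * (ennreal (?s \<bullet> (a x *v ?s)) + ennreal (?t \<bullet> (a x *v ?t)))"
        using energy_nonneg[OF x] by (simp add: ennreal_mult)
      finally show "ennreal ((grad (\<lambda>x. \<phi> j x + \<phi>' j x) x - (g x + g' x)) \<bullet> (a x *v (grad (\<lambda>x. \<phi> j x + \<phi>' j x) x - (g x + g' x)))) \<le>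
         2 * (ennreal (?s \<bullet> (a x *v ?s)) + ennreal (?t \<bullet> (a x *v ?t)))" unfolding eq .
    qed
    ultimately have "?D (\<lambda>x. \<phi> j x + \<phi>' j x) (\<lambda>x. u x + u' x) (\<lambda>x. g x + g' x) \<le>
        (\<integral>\<^sup>+x. 2 * (ennreal ((\<phi> j x - u x)\<^sup>2) + ennreal ((\<phi>' j x - u' x)\<^sup>2)) \<partial>M) +
        (\<integral>\<^sup>+x. 2 * (ennreal ((grad (\<phi> j) x - g x) \<bullet> (a x *v (grad (\<phi> j) x - g x))) +
           ennreal ((grad (\<phi>' j) x - g' x) \<bullet> (a x *v (grad (\<phi>' j) x - g' x)))) \<partial>M)"
      by (rule add_mono)
    also have "\<dots> = 2 * (?D (\<phi> j) u g + ?D (\<phi>' j) u' g')"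
      unfolding nn_integral_cmult[OF borel_measurable_add[OF m1(1) m1(2)]] nn_integral_add[OF m1(1) m1(2)]
        nn_integral_cmult[OF borel_measurable_add[OF m2(1) m2(2)]] nn_integral_add[OF m2(1) m2(2)]
      by (simp only: distrib_left add_ac)
    finally show ?thesis .
  qed
  have lim2: "(\<lambda>j. 2 * (?D (\<phi> j) u g + ?D (\<phi>' j) u' g')) \<longlonglongrightarrow> 2 * (0 + 0)"
    by (intro ennreal_tendsto_cmult tendsto_add lim lim') auto
  have lim3: "(\<lambda>j. ?D (\<lambda>x. \<phi> j x + \<phi>' j x) (\<lambda>x. u x + u' x) (\<lambda>x. g x + g' x)) \<longlonglongrightarrow> 0"
  proof (rule tendsto_sandwich[OF _ _ tendsto_const])
    show "\<forall>\<^sub>F j in sequentially. ?D (\<lambda>x. \<phi> j x + \<phi>' j x) (\<lambda>x. u x + u' x) (\<lambda>x. g x + g' x) \<le>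
        2 * (?D (\<phi> j) u g + ?D (\<phi>' j) u' g')"
      by (intro always_eventually allI le)
    show "(\<lambda>j. 2 * (?D (\<phi> j) u g + ?D (\<phi>' j) u' g')) \<longlonglongrightarrow> 0" using lim2 by (simp only: add_0 mult_zero_right)
  qed (intro always_eventually allI zero_le)
  show ?thesis
    unfolding H1_def mem_Collect_eq prod.case
    by (intro conjI exI[of _ "\<lambda>j x. \<phi> j x + \<phi>' j x"] allI borel_measurable_add m smooth_add \<phi> \<phi>' lim3)
qed

lemma H1_scale:
  assumes "(u, g) \<in> H1 a U"
  shows "(\<lambda>x. c * u x, \<lambda>x. c *\<^sub>R g x) \<in> H1 a U"
proof -
  have m: "u \<in> borel_measurable M" "g \<in> borel_measurable M"
    using assms by (auto simp: H1_def)
  let ?D = "\<lambda>\<phi> u g. (\<integral>\<^sup>+x. ennreal ((\<phi> x - u x)\<^sup>2) \<partial>M) +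
      (\<integral>\<^sup>+x. ennreal ((grad \<phi> x - g x) \<bullet> (a x *v (grad \<phi> x - g x))) \<partial>M)"
  obtain \<phi> where \<phi>: "\<And>j. smooth (\<phi> j)" and lim: "(\<lambda>j. ?D (\<phi> j) u g) \<longlonglongrightarrow> 0"
    using assms(1) by (auto simp: H1_def)
  have eq: "?D (\<lambda>x. c * \<phi> j x) (\<lambda>x. c * u x) (\<lambda>x. c *\<^sub>R g x) = ennreal (c\<^sup>2) * ?D (\<phi> j) u g" for j
  proof -
    have m1: "(\<lambda>x. ennreal ((\<phi> j x - u x)\<^sup>2)) \<in> borel_measurable M"
      by (intro measurable_compose[OF _ measurable_ennreal] borel_measurable_power borel_measurable_diff m smooth_measurable(1) \<phi>)
    have m2: "(\<lambda>x. ennreal ((grad (\<phi> j) x - g x) \<bullet> (a x *v (grad (\<phi> j) x - g x)))) \<in> borel_measurable M"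
      by (intro nn_energy_measurable borel_measurable_diff m smooth_measurable(2) \<phi>)
    have "(\<integral>\<^sup>+x. ennreal ((c * \<phi> j x - c * u x)\<^sup>2) \<partial>M) = (\<integral>\<^sup>+x. ennreal (c\<^sup>2) * ennreal ((\<phi> j x - u x)\<^sup>2) \<partial>M)"
      by (simp add: right_diff_distrib[symmetric] power_mult_distrib ennreal_mult)
    moreover have "(\<integral>\<^sup>+x. ennreal ((grad (\<lambda>x. c * \<phi> j x) x - c *\<^sub>R g x) \<bullet> (a x *v (grad (\<lambda>x. c * \<phi> j x) x - c *\<^sub>R g x))) \<partial>M) =
      (\<integral>\<^sup>+x. ennreal (c\<^sup>2) * ennreal ((grad (\<phi> j) x - g x) \<bullet> (a x *v (grad (\<phi> j) x - g x))) \<partial>M)"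
    proof (rule nn_integral_cong)
      fix x assume "x \<in> space M"
      then have x: "x \<in> U" by simp
      have "grad (\<lambda>x. c * \<phi> j x) x - c *\<^sub>R g x = c *\<^sub>R (grad (\<phi> j) x - g x)"
        by (simp add: grad_cmult \<phi> scaleR_diff_right)
      then show "ennreal ((grad (\<lambda>x. c * \<phi> j x) x - c *\<^sub>R g x) \<bullet> (a x *v (grad (\<lambda>x. c * \<phi> j x) x - c *\<^sub>R g x))) =
         ennreal (c\<^sup>2) * ennreal ((grad (\<phi> j) x - g x) \<bullet> (a x *v (grad (\<phi> j) x - g x)))"
        by (simp only: psd_matrix_energy_scale ennreal_mult[OF zero_le_power2 energy_nonneg[OF x]])
    qed
    ultimately show ?thesis by (simp only: nn_integral_cmult[OF m1] nn_integral_cmult[OF m2] distrib_left)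
  qed
  have "(\<lambda>j. ennreal (c\<^sup>2) * ?D (\<phi> j) u g) \<longlonglongrightarrow> ennreal (c\<^sup>2) * 0"
    by (intro ennreal_tendsto_cmult lim) auto
  then have lim3: "(\<lambda>j. ?D (\<lambda>x. c * \<phi> j x) (\<lambda>x. c * u x) (\<lambda>x. c *\<^sub>R g x)) \<longlonglongrightarrow> 0"
    unfolding eq mult_zero_right .
  show ?thesis
    unfolding H1_def mem_Collect_eq prod.case
    by (intro conjI exI[of _ "\<lambda>j x. c * \<phi> j x"] allI borel_measurable_times borel_measurable_scaleR
        borel_measurable_const m smooth_cmult \<phi> lim3)
qed

lemma solutions_fin: "(u, g) \<in> solutions a U \<Longrightarrow> fin g"
  by (auto simp: solutions_def intro: H1_fin)

lemma solutions_add: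
  assumes "(u, g) \<in> solutions a U" "(u', g') \<in> solutions a U"
  shows "(\<lambda>x. u x + u' x, \<lambda>x. g x + g' x) \<in> solutions a U"
proof -
  have "(LINT x|M. grad \<psi> x \<bullet> (a x *v (g x + g' x))) = 0" if "test_function U \<psi>" for \<psi>
  proof -
    have "fin (grad \<psi>)" using that by (intro fin_grad) (simp add: test_function_def)
    from ip_add_right[OF this solutions_fin[OF assms(1)] solutions_fin[OF assms(2)]] show ?thesis
      using assms that by (simp add: solutions_def ip_def)
  qed
  then show ?thesis using assms H1_add by (auto simp: solutions_def)
qed

lemma solutions_scale:
  assumes "(u, g) \<in> solutions a U"
  shows "(\<lambda>x. c * u x, \<lambda>x. c *\<^sub>R g x) \<in> solutions a U"
  using assms H1_scale by (auto simp: solutions_def matrix_vector_mult_scaleR)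

lemma measure_U_pos: "0 < measure lebesgue U"
proof -
  have "\<not> negligible U" using U open_not_negligible by blast
  then have "measure lebesgue U \<noteq> 0" using U_lebesgue(2) negligible_iff_measure by blast
  then show ?thesis using measure_nonneg[of lebesgue U] by linarith
qed

section \<open>The variational quadratic form\<close>

definition Jfun :: "real^'n \<Rightarrow> (real^'n \<Rightarrow> real^'n) \<Rightarrow> real" where
  "Jfun q g = avg U (\<lambda>x. - (g x \<bullet> (a x *v g x)) + 2 * (q \<bullet> g x))"

text \<open>The form in the definition of \<open>a_star_inv\<close>, before a matrix is known to
  represent it.\<close>

definition Qfun :: "real^'n \<Rightarrow> real" where
  "Qfun q = (SUP (u, g) \<in> solutions a U. Jfun q g)"

lemma inner_integrable: "fin g \<Longrightarrow> integrable M (\<lambda>x. q \<bullet> g x)"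
  by (rule integrable_inner_right[OF fin_integrable])

lemma Jfun_eq: "fin g \<Longrightarrow> Jfun q g = (2 * (LINT x|M. q \<bullet> g x) - ip g g) / measure lebesgue U"
  using inner_integrable[of g q] energy_integrable[of g] by (simp add: Jfun_def avg_def ip_def)

text \<open>Keeps the supremum finite. With \<open>t = norm q\<close> in
  \<open>norm_integrable\<close> the energy cancels against the one in the functional.\<close>

lemma Jfun_le: 
  assumes "fin g"
  shows "Jfun q g \<le> W / measure lebesgue U * (norm q)\<^sup>2"
proof -
  have "2 * (LINT x|M. q \<bullet> g x) - ip g g \<le> W * (norm q)\<^sup>2"
  proof (cases "q = 0")
    case True
    then show ?thesis using energy_nonneg'[of g] by simp
  next
    case False
    have "(LINT x|M. q \<bullet> g x) \<le> (LINT x|M. norm q * norm (g x))"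
      by (intro integral_mono inner_integrable assms integrable_mult_right norm_integrable(1) norm_cauchy_schwarz)
    also have "\<dots> = norm q * (LINT x|M. norm (g x))" by simp
    finally have "2 * (LINT x|M. q \<bullet> g x) \<le> norm q * (2 * (LINT x|M. norm (g x)))" by simp
    also have "\<dots> \<le> norm q * (norm q * W + ip g g / norm q)"
      using False by (intro mult_left_mono norm_integrable(2) assms) auto
    also have "\<dots> = W * (norm q)\<^sup>2 + ip g g" using False by (simp add: field_simps power2_eq_square)
    finally show ?thesis by simp
  qed
  then have "(2 * (LINT x|M. q \<bullet> g x) - ip g g) / measure lebesgue U \<le> W * (norm q)\<^sup>2 / measure lebesgue U"
    using measure_U_pos by (intro divide_right_mono) auto
  then show ?thesis unfolding Jfun_eq[OF assms] by simp
qed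

lemma Jfun_le_Qfun:
  assumes "(u, g) \<in> solutions a U"
  shows "Jfun q g \<le> Qfun q"
  unfolding Qfun_def
proof (rule cSUP_upper2[OF _ assms])
  show "bdd_above ((\<lambda>(u, g). Jfun q g) ` solutions a U)"
    by (rule bdd_aboveI[of _ "W / measure lebesgue U * (norm q)\<^sup>2"]) (use Jfun_le[OF solutions_fin] in auto)
qed simp

lemma solutions_nonempty: "solutions a U \<noteq> {}"
  using harmonic_replacement[OF smooth_const[of 0]] by blast

lemma Qfun_le:
  assumes "\<And>u g. (u, g) \<in> solutions a U \<Longrightarrow> Jfun q g \<le> c"
  shows "Qfun q \<le> c"
  unfolding Qfun_def by (rule cSUP_least[OF solutions_nonempty]) (use assms in auto)

lemma Jfun_scale: "fin g \<Longrightarrow> Jfun (t *\<^sub>R q) (\<lambda>x. t *\<^sub>R g x) = t\<^sup>2 * Jfun q g"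
  by (simp add: Jfun_eq fin_scale energy_scale power2_eq_square algebra_simps diff_divide_distrib)

lemma Qfun_scale_le: "t\<^sup>2 * Qfun q \<le> Qfun (t *\<^sub>R q)" if "t \<noteq> 0"
proof -
  have "Qfun q \<le> Qfun (t *\<^sub>R q) / t\<^sup>2"
  proof (rule Qfun_le)
    fix u g assume g: "(u, g) \<in> solutions a U"
    show "Jfun q g \<le> Qfun (t *\<^sub>R q) / t\<^sup>2"
      using Jfun_le_Qfun[OF solutions_scale[OF g, of t], of "t *\<^sub>R q"] Jfun_scale[OF solutions_fin[OF g], of t q] that
      by (simp add: field_simps)
  qed
  then show ?thesis using that by (simp add: field_simps)
qed

lemma Qfun_nonneg: "0 \<le> Qfun q"
proof -
  obtain u g where g: "(u, g) \<in> solutions a U" using solutions_nonempty by fast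
  have "Jfun q (\<lambda>x. 0 *\<^sub>R g x) = 0"
    using solutions_fin[OF solutions_scale[OF g, of 0]] by (simp add: Jfun_def avg_def)
  then show ?thesis using Jfun_le_Qfun[OF solutions_scale[OF g, of 0], of q] by simp
qed

text \<open>\<open>Qfun_scale_le\<close> for \<open>t\<close> and for \<open>1 / t\<close> together
  give equality; for \<open>t = 0\<close> the upper bound on the form takes over.\<close>

lemma Qfun_scale: "Qfun (t *\<^sub>R q) = t\<^sup>2 * Qfun q"
proof (cases "t = 0")
  case True
  have "Qfun 0 \<le> W / measure lebesgue U * (norm (0::real^'n))\<^sup>2"
    by (rule Qfun_le) (rule Jfun_le[OF solutions_fin])
  then show ?thesis using Qfun_nonneg[of 0] True by simp
next
  case False
  have "(1 / t)\<^sup>2 * Qfun (t *\<^sub>R q) \<le> Qfun ((1 / t) *\<^sub>R t *\<^sub>R q)"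
    using False by (intro Qfun_scale_le) auto
  then have "Qfun (t *\<^sub>R q) \<le> t\<^sup>2 * Qfun q" using False by (simp add: field_simps)
  with Qfun_scale_le[OF False, of q] show ?thesis by simp
qed

text \<open>For candidates \<open>g\<close> at \<open>p\<close> and \<open>h\<close> at
  \<open>q\<close>, sum and difference are candidates at \<open>p + q\<close> and
  \<open>p - q\<close>; the energies obey the parallelogram law and the mixed linear terms
  cancel.\<close>

lemma Qfun_parallelogram: "2 * Qfun p + 2 * Qfun q \<le> Qfun (p + q) + Qfun (p - q)"
proof -
  have *: "2 * Jfun p g + 2 * Jfun q h \<le> Qfun (p + q) + Qfun (p - q)"
    if g: "(u, g) \<in> solutions a U" and h: "(w, h) \<in> solutions a U" for u g w h
  proof -
    have fg: "fin g" "fin h" "fin (\<lambda>x. (-1) *\<^sub>R h x)"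
      using solutions_fin g h fin_scale[of h "-1"] by auto
    have fgh: "fin (\<lambda>x. g x + h x)" "fin (\<lambda>x. g x + (-1) *\<^sub>R h x)" using fg fin_add by blast+
    have e: "ip (\<lambda>x. g x + h x) (\<lambda>x. g x + h x) + ip (\<lambda>x. g x + (-1) *\<^sub>R h x) (\<lambda>x. g x + (-1) *\<^sub>R h x) = 2 * ip g g + 2 * ip h h"
      unfolding energy_add[OF fg(1,2)] energy_add[OF fg(1,3)] energy_scale ip_scale_right by simp
    have l: "(LINT x|M. (p + q) \<bullet> (g x + h x)) + (LINT x|M. (p - q) \<bullet> (g x + (-1) *\<^sub>R h x)) =
        2 * (LINT x|M. p \<bullet> g x) + 2 * (LINT x|M. q \<bullet> h x)"
      using inner_integrable[OF fg(1)] inner_integrable[OF fg(2)]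
      by (simp add: inner_add_left inner_diff_left inner_add_right inner_diff_right)
    have "2 * Jfun p g + 2 * Jfun q h = Jfun (p + q) (\<lambda>x. g x + h x) + Jfun (p - q) (\<lambda>x. g x + (-1) *\<^sub>R h x)"
      unfolding Jfun_eq[OF fg(1)] Jfun_eq[OF fg(2)] Jfun_eq[OF fgh(1)] Jfun_eq[OF fgh(2)] times_divide_eq_right add_divide_distrib[symmetric]
      using e l by (intro arg_cong2[where f = "(/)"]) auto
    also have "\<dots> \<le> Qfun (p + q) + Qfun (p - q)"
      using Jfun_le_Qfun[OF solutions_add[OF g h]] Jfun_le_Qfun[OF solutions_add[OF g solutions_scale[OF h, of "-1"]]]
      by (rule add_mono)
    finally show ?thesis .
  qed
  have "Qfun p \<le> (Qfun (p + q) + Qfun (p - q)) / 2 - Qfun q"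
  proof (rule Qfun_le)
    fix u g assume g: "(u, g) \<in> solutions a U"
    have "Qfun q \<le> (Qfun (p + q) + Qfun (p - q)) / 2 - Jfun p g"
      by (rule Qfun_le) (use *[OF g] in \<open>simp add: field_simps\<close>)
    then show "Jfun p g \<le> (Qfun (p + q) + Qfun (p - q)) / 2 - Qfun q" by simp
  qed
  then show ?thesis by (simp add: field_simps)
qed

text \<open>The description by \<open>THE\<close> denotes a matrix with the required form because
  the supremum is a bounded quadratic form.\<close>

lemma a_star_inv_form: "q \<bullet> (a_star_inv a U *v q) = Qfun q"
proof -
  have "\<exists>!B. transpose B = B \<and> (\<forall>q. q \<bullet> (B *v q) = Qfun q)"
  proof (rule quadratic_form_matrix[OF Qfun_parallelogram Qfun_scale Qfun_nonneg])
    show "Qfun p \<le> W / measure lebesgue U * (norm p)\<^sup>2" for p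
      by (rule Qfun_le) (rule Jfun_le[OF solutions_fin])
  qed
  from theI'[OF this] show ?thesis
    unfolding a_star_inv_def Qfun_def Jfun_def by blast
qed

text \<open>The vector \<open>q\<close> in the variational definition is the mean gradient
  \<open>F\<close> itself, so that the linear term of the replaced solution is
  \<open>m (norm F)\<^sup>2\<close>; the multiple of the solution is then optimized.\<close>

lemma norm_avg_grad_le:
  assumes \<phi>: "smooth \<phi>"
  shows "(\<Sum>e\<in>UNIV. (avg U (partial_deriv e \<phi>))\<^sup>2) \<le>
    spectral_norm (a_star_inv a U) * avg U (\<lambda>x. grad \<phi> x \<bullet> (a x *v grad \<phi> x))"
proof -
  define m where "m = measure lebesgue U"
  have m: "0 < m" using measure_U_pos by (simp add: m_def)
  define F where "F = (\<chi> e. avg U (partial_deriv e \<phi>))"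
  define E where "E = ip (grad \<phi>) (grad \<phi>)"
  have E0: "0 \<le> E" by (simp add: E_def energy_nonneg')
  define B where "B = a_star_inv a U"
  define X where "X = m * (norm F)\<^sup>2"
  obtain v h where h: "(v, h) \<in> solutions a U" "fin h"
    "\<And>q. (LINT x|M. q \<bullet> h x) = (LINT x|M. q \<bullet> grad \<phi> x)" "ip h h \<le> E"
    using harmonic_replacement[OF \<phi>] unfolding E_def by metis
  have X: "(LINT x|M. F \<bullet> h x) = X"
  proof -
    have "integrable M (\<lambda>x. grad \<phi> x $ e)" for e
      by (rule fin_component_integrable[OF fin_grad[OF \<phi>]])
    then have "(LINT x|M. F \<bullet> grad \<phi> x) = (\<Sum>e\<in>UNIV. F $ e * (LINT x|M. partial_deriv e \<phi> x))"
      by (simp add: inner_vec_def grad_component)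
    also have "\<dots> = (\<Sum>e\<in>UNIV. F $ e * (m * F $ e))"
      using m by (intro sum.cong) (auto simp: F_def avg_def m_def)
    also have "\<dots> = X"
      by (simp add: X_def power2_norm_eq_inner inner_vec_def sum_distrib_left mult_ac)
    finally show ?thesis using h(3) by simp
  qed
  have FB: "F \<bullet> (B *v F) \<le> spectral_norm B * (norm F)\<^sup>2"
  proof -
    have "F \<bullet> (B *v F) \<le> norm F * norm (B *v F)" by (rule norm_cauchy_schwarz)
    also have "\<dots> \<le> norm F * (spectral_norm B * norm F)"
      unfolding spectral_norm_def by (intro mult_left_mono onorm matrix_vector_mul_bounded_linear) simp
    finally show ?thesis by (simp add: power2_eq_square mult_ac)
  qed
  have key: "2 * t * X \<le> t\<^sup>2 * E + m * (spectral_norm B * (norm F)\<^sup>2)" for t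
  proof -
    have "Jfun F (\<lambda>x. t *\<^sub>R h x) \<le> Qfun F" by (rule Jfun_le_Qfun[OF solutions_scale[OF h(1)]])
    also have "\<dots> \<le> spectral_norm B * (norm F)\<^sup>2" using FB a_star_inv_form[of F] by (simp add: B_def)
    finally have "2 * t * X - t\<^sup>2 * ip h h \<le> m * (spectral_norm B * (norm F)\<^sup>2)"
      using m X unfolding Jfun_eq[OF fin_scale[OF h(2)]] energy_scale by (simp add: m_def field_simps)
    moreover have "t\<^sup>2 * ip h h \<le> t\<^sup>2 * E" using h(4) by (intro mult_left_mono) auto
    ultimately show ?thesis by linarith
  qed
  have "(norm F)\<^sup>2 \<le> spectral_norm B * (E / m)"
  proof (cases "F = 0")
    case True
    have "0 \<le> spectral_norm B" unfolding spectral_norm_def by (rule onorm_pos_le) (rule matrix_vector_mul_bounded_linear)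
    then show ?thesis using True E0 m by simp
  next
    case False
    \<comment> \<open>With vanishing energy the left-hand side of \<open>key\<close> would be
      unbounded in \<open>t\<close>, the right-hand side not.\<close>
    have "E \<noteq> 0"
    proof
      assume "E = 0"
      then have "2 * t * X \<le> m * (spectral_norm B * (norm F)\<^sup>2)" for t using key[of t] by simp
      from this[of "(m * (spectral_norm B * (norm F)\<^sup>2) + 1) / (2 * X)"] show False
        using False m by (simp add: X_def)
    qed
    then have E: "0 < E" using E0 by simp
    \<comment> \<open>\<open>t = X / E\<close> maximizes \<open>2 t X - t\<^sup>2 E\<close>.\<close>
    have "2 * (X / E) * X \<le> (X / E)\<^sup>2 * E + m * (spectral_norm B * (norm F)\<^sup>2)" by (rule key)
    then have "X\<^sup>2 \<le> E * (m * (spectral_norm B * (norm F)\<^sup>2))"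
      using E by (simp add: field_simps power2_eq_square)
    then have "(m * (norm F)\<^sup>2) * (m * (norm F)\<^sup>2) \<le> (m * (norm F)\<^sup>2) * (E * spectral_norm B)"
      by (simp add: X_def power2_eq_square mult_ac)
    moreover have "0 < m * (norm F)\<^sup>2" using m False by simp
    ultimately have "m * (norm F)\<^sup>2 \<le> E * spectral_norm B" by (rule mult_left_le_imp_le)
    then show ?thesis using m by (simp add: field_simps)
  qed
  moreover have "(norm F)\<^sup>2 = (\<Sum>e\<in>UNIV. (avg U (partial_deriv e \<phi>))\<^sup>2)"
    unfolding power2_norm_eq_inner by (simp add: F_def inner_vec_def power2_eq_square)
  moreover have "E / m = avg U (\<lambda>x. grad \<phi> x \<bullet> (a x *v grad \<phi> x))"
    by (simp add: E_def m_def ip_def avg_def)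
  ultimately show ?thesis by (simp add: B_def)
qed

end

subsection \<open>The \<open>L\<^sup>1\<close> Poincare inequality on a box\<close>

lemma smooth_line_integral_vector:
  assumes \<phi>: "smooth \<phi>"
  shows "(\<integral>t. indicator {0..1} t * (grad \<phi> (x + t *\<^sub>R v) \<bullet> v) \<partial>lborel) = \<phi> (x + v) - \<phi> x"
proof -
  let ?F = "\<lambda>t. \<phi> (x + t *\<^sub>R v)" and ?f = "\<lambda>t. grad \<phi> (x + t *\<^sub>R v) \<bullet> v"
  have "(?F has_real_derivative ?f t) (at t)" for t
  proof -
    have "((\<lambda>t. \<phi> (x + t *\<^sub>R v)) has_derivative (\<lambda>h. grad \<phi> (x + t *\<^sub>R v) \<bullet> (h *\<^sub>R v))) (at t)"
      by (rule has_derivative_compose[OF _ smooth_has_derivative[OF \<phi>]]) (auto intro!: derivative_eq_intros)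
    then show ?thesis
      unfolding has_field_derivative_def
      by (rule has_derivative_eq_rhs) (auto simp: mult.commute)
  qed
  moreover have "continuous_on UNIV ?f"
    by (intro continuous_intros continuous_on_compose2[OF smooth_continuous_grad[OF \<phi>, of UNIV]]) auto
  then have "isCont ?f t" for t by (simp add: continuous_on_eq_continuous_at)
  ultimately have "(\<integral>t. ?f t * indicator {0..1} t \<partial>lborel) = ?F 1 - ?F 0"
    by (intro integral_FTC_Icc_real) auto
  then show ?thesis by (simp add: mult.commute)
qed

text \<open>If \<open>x\<close> and \<open>x + v\<close> lie in \<open>Q\<close>, so does the
  segment between them by convexity; hence the weight in \<open>translation_Fubini\<close> is at
  most the indicator of \<open>Q\<close>.\<close>

lemma translation_difference_L1:
  fixes Q :: "(real^'n) set"
  assumes \<phi>: "smooth \<phi>" and Q: "compact Q" "convex Q"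
  shows "(\<integral>x. indicator Q x * indicator Q (x + v) * \<bar>\<phi> (x + v) - \<phi> x\<bar> \<partial>lborel) \<le>
    norm v * (\<integral>x. indicator Q x * norm (grad \<phi> x) \<partial>lborel)"
proof -
  define g where "g = (\<lambda>x. norm (grad \<phi> x))"
  have cg: "continuous_on S g" for S
    unfolding g_def by (intro continuous_intros smooth_continuous_grad \<phi>)
  define P where "P = Q \<inter> (\<lambda>x. x - v) ` Q"
  have memP: "x \<in> P \<longleftrightarrow> x \<in> Q \<and> x + v \<in> Q" for x unfolding P_def by (force simp: image_iff)
  have P: "compact P"
    unfolding P_def using Q(1) by (intro compact_Int compact_continuous_image continuous_intros)
  let ?G = "\<lambda>x. \<integral>t. indicator {0..1} t * g (x + t *\<^sub>R v) \<partial>lborel"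
  let ?w = "\<lambda>x. \<integral>t. (indicator {0..1::real} t :: real) * indicator P (x - t *\<^sub>R v) \<partial>lborel"
  have intg: "integrable lborel (\<lambda>t. indicator {0..1} t * g (x + t *\<^sub>R v))" for x
    by (intro integral_indicator_lborel continuous_on_compose2[OF cg[of UNIV]] continuous_intros) auto
  have pt: "\<bar>\<phi> (x + v) - \<phi> x\<bar> \<le> norm v * ?G x" for x
  proof -
    have "\<bar>\<phi> (x + v) - \<phi> x\<bar> = \<bar>\<integral>t. indicator {0..1} t * (grad \<phi> (x + t *\<^sub>R v) \<bullet> v) \<partial>lborel\<bar>"
      by (simp add: smooth_line_integral_vector[OF \<phi>])
    also have "\<dots> \<le> (\<integral>t. norm (indicator {0..1} t * (grad \<phi> (x + t *\<^sub>R v) \<bullet> v)) \<partial>lborel)"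
      unfolding real_norm_def[symmetric] by (rule integral_norm_bound)
    also have "\<dots> \<le> (\<integral>t. norm v * (indicator {0..1} t * g (x + t *\<^sub>R v)) \<partial>lborel)"
    proof (rule integral_mono)
      show "integrable lborel (\<lambda>t. norm (indicator {0..1} t * (grad \<phi> (x + t *\<^sub>R v) \<bullet> v)))"
        by (intro integrable_norm integral_indicator_lborel continuous_intros
            continuous_on_compose2[OF smooth_continuous_grad[OF \<phi>, of UNIV]]) auto
      show "integrable lborel (\<lambda>t. norm v * (indicator {0..1} t * g (x + t *\<^sub>R v)))"
        by (intro integrable_mult_right intg)
      show "norm (indicator {0..1} t * (grad \<phi> (x + t *\<^sub>R v) \<bullet> v)) \<le> norm v * (indicator {0..1} t * g (x + t *\<^sub>R v))" for t
        using Cauchy_Schwarz_ineq2[of "grad \<phi> (x + t *\<^sub>R v)" v]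
        by (auto simp: g_def indicator_def mult.commute)
    qed
    also have "\<dots> = norm v * ?G x" by simp
    finally show ?thesis .
  qed
  have w: "0 \<le> ?w x" "?w x \<le> indicator Q x" for x
  proof -
    show "0 \<le> ?w x" by (rule integral_nonneg_AE) simp
    show "?w x \<le> indicator Q x"
    proof (cases "x \<in> Q")
      case True
      have "?w x \<le> (\<integral>t. (indicator {0..1::real} t :: real) \<partial>lborel)"
      proof (rule integral_mono')
        show "integrable lborel (indicator {0..1} :: real \<Rightarrow> real)"
          by (intro integrable_real_indicator) (auto simp: emeasure_lborel_Icc_eq)
      qed (auto simp: indicator_def)
      then show ?thesis using True by simp
    next
      case False
      have "x - t *\<^sub>R v \<notin> P" if "t \<in> {0..1}" for t
      proof
        assume "x - t *\<^sub>R v \<in> P"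
        then have "x - t *\<^sub>R v \<in> Q" "x - t *\<^sub>R v + v \<in> Q" by (auto simp: memP)
        then have "(1 - t) *\<^sub>R (x - t *\<^sub>R v) + t *\<^sub>R (x - t *\<^sub>R v + v) \<in> Q"
          using that by (intro convexD[OF Q(2)]) auto
        moreover have "(1 - t) *\<^sub>R (x - t *\<^sub>R v) + t *\<^sub>R (x - t *\<^sub>R v + v) = x"
          by (simp add: algebra_simps)
        ultimately show False using False by simp
      qed
      then have "?w x = (\<integral>t. (0::real) \<partial>(lborel :: real measure))"
        by (intro Bochner_Integration.integral_cong) (auto simp: indicator_def)
      then show ?thesis by simp
    qed
  qed
  have [measurable]: "g \<in> borel_measurable borel" "P \<in> sets borel" "Q \<in> sets borel"
    using cg P Q by (auto intro: borel_measurable_continuous_onI borel_compact)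
  have Qg: "integrable lborel (\<lambda>x. indicator Q x * g x)" by (intro integral_indicator_lborel cg Q)
  have pw: "0 \<le> g x * ?w x" "g x * ?w x \<le> indicator Q x * g x" for x
    using mult_nonneg_nonneg[of "g x" "?w x"] mult_left_mono[OF w(2), of "g x" x] w(1)
    by (auto simp: g_def mult.commute)
  have gw: "integrable lborel (\<lambda>x. g x * ?w x)"
  proof (rule Bochner_Integration.integrable_bound[OF Qg])
    show "(\<lambda>x. g x * ?w x) \<in> borel_measurable lborel" by measurable
    show "AE x in lborel. norm (g x * ?w x) \<le> norm (indicator Q x * g x)"
    proof (rule AE_I2)
      fix x
      show "norm (g x * ?w x) \<le> norm (indicator Q x * g x)"
        unfolding real_norm_def using pw[of x] by linarith
    qed
  qed
  have Gint: "integrable lborel (\<lambda>x. indicator P x * ?G x)"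
  proof -
    have "continuous_on P ?G"
    proof -
      have eq: "?G x = integral (cbox 0 1) (\<lambda>t. g (x + t *\<^sub>R v))" for x
        using integral_indicator_lborel(1)[of "{0..1}" "\<lambda>t. g (x + t *\<^sub>R v)"]
        by (simp add: continuous_on_compose2[OF cg[of UNIV]] continuous_intros)
      show ?thesis
        unfolding eq
        by (rule integral_continuous_on_param)
           (auto simp: split_def intro!: continuous_on_compose2[OF cg[of UNIV]] continuous_intros)
    qed
    then show ?thesis by (intro integral_indicator_lborel P)
  qed
  have "(\<integral>x. indicator Q x * indicator Q (x + v) * \<bar>\<phi> (x + v) - \<phi> x\<bar> \<partial>lborel) =
      (\<integral>x. indicator P x * \<bar>\<phi> (x + v) - \<phi> x\<bar> \<partial>lborel)"
    by (rule Bochner_Integration.integral_cong) (auto simp: indicator_def memP)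
  also have "\<dots> \<le> (\<integral>x. norm v * (indicator P x * ?G x) \<partial>lborel)"
  proof (rule integral_mono)
    show "integrable lborel (\<lambda>x. indicator P x * \<bar>\<phi> (x + v) - \<phi> x\<bar>)"
      by (intro integral_indicator_lborel P continuous_intros smooth_continuous \<phi>
          continuous_on_compose2[OF smooth_continuous[OF \<phi>, of UNIV]]) auto
    show "integrable lborel (\<lambda>x. norm v * (indicator P x * ?G x))" by (intro integrable_mult_right Gint)
    show "indicator P x * \<bar>\<phi> (x + v) - \<phi> x\<bar> \<le> norm v * (indicator P x * ?G x)" for x
      using pt[of x] by (auto simp: indicator_def)
  qed
  also have "\<dots> = norm v * (\<integral>x. indicator P x * ?G x \<partial>lborel)" by simp
  also have "(\<integral>x. indicator P x * ?G x \<partial>lborel) = (\<integral>x. g x * ?w x \<partial>lborel)"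
    by (rule translation_Fubini[OF cg P])
  also have "norm v * (\<integral>x. g x * ?w x \<partial>lborel) \<le> norm v * (\<integral>x. indicator Q x * g x \<partial>lborel)"
    by (intro mult_left_mono integral_mono gw Qg pw) simp
  finally show ?thesis by (simp add: g_def)
qed

text \<open>With \<open>y = x + v\<close> the double integral becomes the integral over
  \<open>v\<close> of the translation estimate, restricted to a ball that contains all differences
  of points of \<open>Q\<close>. The constant is not tracked, as the gradient tends to 0 in the
  application.\<close>

lemma smooth_Poincare_L1:
  fixes Q :: "(real^'n) set"
  assumes Q: "compact Q" "convex Q"
  obtains K where "0 \<le> K" "\<And>\<phi>. smooth \<phi> \<Longrightarrow>
    (\<integral>x. indicator Q x * (\<integral>y. indicator Q y * \<bar>\<phi> y - \<phi> x\<bar> \<partial>lborel) \<partial>lborel) \<le>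
      K * (\<integral>x. indicator Q x * norm (grad \<phi> x) \<partial>lborel)"
proof -
  obtain b where b: "0 < b" "\<And>x. x \<in> Q \<Longrightarrow> norm x \<le> b"
    using compact_imp_bounded[OF Q(1)] unfolding bounded_pos by blast
  define R where "R = 2 * b"
  define B where "B = cball (0::real^'n) R"
  have vB: "v \<in> B" if "x \<in> Q" "x + v \<in> Q" for x v
    using norm_triangle_ineq4[of "x + v" x] b(2)[OF that(1)] b(2)[OF that(2)] by (simp add: B_def R_def)
  have "(\<integral>x. indicator Q x * (\<integral>y. indicator Q y * \<bar>\<phi> y - \<phi> x\<bar> \<partial>lborel) \<partial>lborel) \<le>
      (measure lborel B * R) * (\<integral>x. indicator Q x * norm (grad \<phi> x) \<partial>lborel)"
    if \<phi>: "smooth \<phi>" for \<phi>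
  proof -
    define D where "D = (\<integral>x. indicator Q x * norm (grad \<phi> x) \<partial>lborel)"
    have D0: "0 \<le> D" unfolding D_def by (rule integral_nonneg_AE) simp
    have Qm: "Q \<in> sets borel" using Q(1) by (rule borel_compact)
    have \<phi>m: "\<phi> \<in> borel_measurable borel" by (intro borel_measurable_continuous_onI smooth_continuous \<phi>)
    note [measurable] = Qm \<phi>m
    have comm: "compact ((\<lambda>z. (snd z - fst z, fst z)) ` (Q \<times> Q))"
      using Q(1) by (intro compact_continuous_image compact_Times continuous_intros)
    let ?f = "\<lambda>v x. indicator Q x * indicator Q (x + v) * \<bar>\<phi> (x + v) - \<phi> x\<bar>"
    have int: "integrable (lborel \<Otimes>\<^sub>M lborel) (\<lambda>(v, x). ?f v x)"
    proof -
      let ?S = "(\<lambda>z. (snd z - fst z, fst z)) ` (Q \<times> Q)"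
      have S: "(v, x) \<in> ?S \<longleftrightarrow> x \<in> Q \<and> x + v \<in> Q" for v x
        by (force simp: image_iff)
      have "integrable lborel (\<lambda>z. indicator ?S z *\<^sub>R \<bar>\<phi> (snd z + fst z) - \<phi> (snd z)\<bar>)"
        by (intro borel_integrable_compact comm continuous_intros
            continuous_on_compose2[OF smooth_continuous[OF \<phi>, of UNIV]]) auto
      then show ?thesis
        unfolding lborel_prod by (rule Bochner_Integration.integrable_cong[THEN iffD1, rotated 2])
          (auto simp: indicator_def S simp del: image_iff split: if_splits)
    qed
    have "(\<integral>x. indicator Q x * (\<integral>y. indicator Q y * \<bar>\<phi> y - \<phi> x\<bar> \<partial>lborel) \<partial>lborel) =
        (\<integral>x. (\<integral>v. ?f v x \<partial>lborel) \<partial>lborel)"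
    proof (rule Bochner_Integration.integral_cong[OF refl])
      fix x
      have "(\<integral>y. indicator Q y * \<bar>\<phi> y - \<phi> x\<bar> \<partial>distr lborel borel ((+) x)) =
          (\<integral>v. indicator Q (x + v) * \<bar>\<phi> (x + v) - \<phi> x\<bar> \<partial>lborel)"
        by (rule integral_distr) measurable
      then show "indicator Q x * (\<integral>y. indicator Q y * \<bar>\<phi> y - \<phi> x\<bar> \<partial>lborel) = (\<integral>v. ?f v x \<partial>lborel)"
        by (simp add: lborel_distr_plus mult.assoc)
    qed
    also have "\<dots> = (\<integral>v. (\<integral>x. ?f v x \<partial>lborel) \<partial>lborel)"
      by (rule lborel_pair.Fubini_integral[OF int])
    also have "\<dots> \<le> (\<integral>v. indicator B v * (R * D) \<partial>lborel)"
    proof (rule integral_mono)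
      show "integrable lborel (\<lambda>v. \<integral>x. ?f v x \<partial>lborel)"
        using lborel_pair.integrable_fst[OF int] by simp
      show "integrable lborel (\<lambda>v. indicator B v * (R * D))"
        by (intro integral_indicator_lborel) (auto simp: B_def)
      fix v :: "real^'n"
      show "(\<integral>x. ?f v x \<partial>lborel) \<le> indicator B v * (R * D)"
      proof (cases "v \<in> B")
        case True
        have "(\<integral>x. ?f v x \<partial>lborel) \<le> norm v * D"
          unfolding D_def by (rule translation_difference_L1[OF \<phi> Q])
        also have "\<dots> \<le> R * D" using True D0 by (intro mult_right_mono) (auto simp: B_def)
        finally show ?thesis using True by simp
      next
        case False
        then have "(\<lambda>x. ?f v x) = (\<lambda>x. 0)" using vB by (auto simp: indicator_def fun_eq_iff)
        then show ?thesis using False by simp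
      qed
    qed
    also have "\<dots> = measure lborel B * R * D" by (simp add: mult.assoc)
    finally show ?thesis by (simp add: D_def)
  qed
  then show thesis using that[of "measure lborel B * R"] b by (simp add: R_def)
qed

subsection \<open>Triadic cubes\<close>

lemma powi3_div_power: "(3::real) powi n / 3 ^ N = 3 powi (n - int N)"
  by (simp add: power_int_diff)

lemma translated_cube:
  "(\<lambda>x. z + x) ` cube k = box (\<chi> i. z $ i - 3 powi k / 2) (\<chi> i. z $ i + 3 powi k / 2)"
proof -
  have "y \<in> (\<lambda>x. z + x) ` cube k \<longleftrightarrow> y - z \<in> cube k" for y
    by (metis (no_types, lifting) add_diff_cancel_left' diff_add_cancel add.commute image_iff)
  then show ?thesis by (auto simp: set_eq_iff mem_box_cart cube_def field_simps)
qed

lemma tbox_cbox: "tbox z (\<lambda>_. 3 powi k) = cbox (\<chi> i. z $ i - 3 powi k / 2) (\<chi> i. z $ i + 3 powi k / 2)"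
  by (simp add: tbox_def)

lemma cube_facts:
  "open ((\<lambda>x. z + x) ` cube k :: (real^'n) set)" "bounded ((\<lambda>x. z + x) ` cube k :: (real^'n) set)"
  "(\<lambda>x. z + x) ` cube k \<noteq> ({} :: (real^'n) set)" "(\<lambda>x. z + x) ` cube k \<in> sets lebesgue"
proof -
  have "z \<in> box (\<chi> i. z $ i - 3 powi k / 2) (\<chi> i. z $ i + 3 powi k / 2)"
    by (simp add: mem_box_cart)
  then show "(\<lambda>x. z + x) ` cube k \<noteq> {}" unfolding translated_cube by blast
qed (simp_all add: translated_cube open_box bounded_box)

lemma measure_translated_cube:
  "measure lebesgue ((\<lambda>x. z + x) ` cube k) = (\<Prod>i\<in>(UNIV::'n set). (3::real) powi k)" for z :: "real^'n"
proof -
  have le: "\<forall>b\<in>Basis. (\<chi> i. z $ i - 3 powi k / 2) \<bullet> b \<le> (\<chi> i. z $ i + 3 powi k / 2) \<bullet> b"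
    by (auto simp: Basis_vec_def inner_axis)
  have "measure lborel (box (\<chi> i. z $ i - 3 powi k / 2) (\<chi> i. z $ i + 3 powi k / 2)) =
      measure lborel (tbox z (\<lambda>_. 3 powi k))"
    unfolding tbox_cbox measure_lborel_box_eq measure_lborel_cbox_eq ..
  also have "\<dots> = (\<Prod>i\<in>(UNIV::'n set). (3::real) powi k)" by (rule content_tbox) simp
  finally show ?thesis unfolding translated_cube by simp
qed

text \<open>Matches averages over open cubes, as in the definitions, with averages over closed
  boxes, as in the multiscale argument; the boundary is negligible.\<close>

lemma avg_eq_bavg:
  fixes z :: "real^'n"
  assumes "integrable (lebesgue_on ((\<lambda>x. z + x) ` cube k)) f"
  shows "avg ((\<lambda>x. z + x) ` cube k) f = bavg z (\<lambda>_. 3 powi k) f" "f integrable_on tbox z (\<lambda>_. 3 powi k)"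
proof -
  have "(LINT x|lebesgue_on ((\<lambda>x. z + x) ` cube k). f x) = integral ((\<lambda>x. z + x) ` cube k) f"
    by (rule lebesgue_integral_eq_integral[OF assms cube_facts(4)])
  also have "\<dots> = integral (tbox z (\<lambda>_. 3 powi k)) f"
    unfolding translated_cube tbox_cbox by (rule integral_open_interval)
  finally show "avg ((\<lambda>x. z + x) ` cube k) f = bavg z (\<lambda>_. 3 powi k) f"
    unfolding avg_def bavg_def measure_translated_cube by (rule arg_cong)
  have "f integrable_on ((\<lambda>x. z + x) ` cube k)"
    using integrable_on_lebesgue_on[OF assms cube_facts(4)] .
  then show "f integrable_on tbox z (\<lambda>_. 3 powi k)"
    unfolding translated_cube tbox_cbox integrable_on_open_interval .
qed

lemma integrable_lebesgue_on_subset: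
  fixes f :: "'a::euclidean_space \<Rightarrow> 'b::{banach, second_countable_topology}"
  assumes "integrable (lebesgue_on S) f" "T \<subseteq> S" "S \<in> sets lebesgue" "T \<in> sets lebesgue"
  shows "integrable (lebesgue_on T) f"
proof -
  have "set_integrable lebesgue S f"
    using assms by (simp add: set_integrable_def integrable_restrict_space)
  then have "set_integrable lebesgue T f"
    by (rule set_integrable_subset) (use assms in auto)
  then show ?thesis using assms by (simp add: set_integrable_def integrable_restrict_space)
qed

lemma coefficient_field_subset:
  assumes "coefficient_field S a" "T \<subseteq> S" "S \<in> sets lebesgue" "T \<in> sets lebesgue"
  shows "coefficient_field T a"
proof -
  have "AE x in lebesgue. x \<in> S \<longrightarrow> invertible (a x)"
    using assms by (simp add: coefficient_field_def AE_restrict_space_iff)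
  then have "AE x in lebesgue. x \<in> T \<longrightarrow> invertible (a x)"
    by eventually_elim (use assms(2) in auto)
  then have "AE x in lebesgue_on T. invertible (a x)"
    using assms(4) by (simp add: AE_restrict_space_iff)
  moreover have "a \<in> borel_measurable (lebesgue_on T)"
    using assms(1,2) measurable_restrict_mono unfolding coefficient_field_def by blast
  ultimately show ?thesis
    using assms integrable_lebesgue_on_subset[OF _ assms(2-4)] unfolding coefficient_field_def by blast
qed

text \<open>Makes the \<open>MAX\<close> in \<open>lambda_s\<close> a genuine maximum.\<close>

lemma finite_scaled_lattice_cube: "finite (scaled_lattice k \<inter> cube n :: (real^'n) set)"
proof -
  define K where "K = \<lceil>(3::real) powi n / 3 powi k\<rceil>"
  define S where "S = (\<lambda>m::int. (3::real) powi k * of_int m) ` {-K..K}"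
  have "z $ i \<in> S" if z: "z \<in> scaled_lattice k \<inter> cube n" for z :: "real^'n" and i
  proof -
    obtain m :: int where m: "z $ i = 3 powi k * of_int m" using z by (auto simp: scaled_lattice_def)
    have "\<bar>z $ i\<bar> \<le> 3 powi n"
    proof -
      have "- (1/2) * 3 powi n < z $ i" "z $ i < 1/2 * 3 powi n" using z by (auto simp: cube_def)
      then have "\<bar>z $ i\<bar> < 1/2 * 3 powi n" by (auto simp: abs_less_iff)
      also have "\<dots> \<le> 3 powi n" by simp
      finally show ?thesis by simp
    qed
    then have "\<bar>of_int m :: real\<bar> \<le> 3 powi n / 3 powi k"
      unfolding m by (simp add: abs_mult field_simps)
    then have "of_int \<bar>m\<bar> \<le> (3 powi n / 3 powi k :: real)" by simp
    then have "\<bar>m\<bar> \<le> K" unfolding K_def by (metis ceiling_mono ceiling_of_int)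
    then have "m \<in> {-K..K}" by (auto simp: abs_le_iff)
    then show ?thesis unfolding S_def m by blast
  qed
  then have "vec_nth ` (scaled_lattice k \<inter> cube n :: (real^'n) set) \<subseteq> (\<Pi>\<^sub>E i\<in>UNIV. S)" by (auto simp: PiE_UNIV_domain)
  moreover have "finite (\<Pi>\<^sub>E i\<in>(UNIV :: 'n set). S)" by (intro finite_PiE) (auto simp: S_def)
  ultimately have "finite (vec_nth ` (scaled_lattice k \<inter> cube n :: (real^'n) set))" by (rule finite_subset)
  then show ?thesis by (rule finite_imageD) (auto simp: inj_on_def vec_nth_inject)
qed

lemma zero_in_scaled_lattice_cube: "0 \<in> (scaled_lattice k \<inter> cube n :: (real^'n) set)"
  by (auto simp: scaled_lattice_def cube_def intro!: exI[of _ 0])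

definition max_norm :: "(real^'n \<Rightarrow> real^'n^'n) \<Rightarrow> int \<Rightarrow> int \<Rightarrow> real" where
  "max_norm a n k = (MAX z \<in> scaled_lattice k \<inter> cube n. sqrt (spectral_norm (a_star_inv a ((\<lambda>x. z + x) ` cube k))))"

lemma spectral_norm_nonneg: "0 \<le> spectral_norm B" for B :: "real^'n^'n"
  unfolding spectral_norm_def by (rule onorm_pos_le) (rule matrix_vector_mul_bounded_linear)

lemma spectral_norm_le_max_norm:
  assumes "z \<in> scaled_lattice k \<inter> cube n"
  shows "spectral_norm (a_star_inv a ((\<lambda>x. z + x) ` cube k)) \<le> (max_norm a n k)\<^sup>2"
proof -
  have "sqrt (spectral_norm (a_star_inv a ((\<lambda>x. z + x) ` cube k))) \<le> max_norm a n k"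
    unfolding max_norm_def using finite_scaled_lattice_cube assms by (intro Max_ge) auto
  then have "(sqrt (spectral_norm (a_star_inv a ((\<lambda>x. z + x) ` cube k))))\<^sup>2 \<le> (max_norm a n k)\<^sup>2"
    by (rule power_mono) (simp add: spectral_norm_nonneg)
  then show ?thesis by (simp add: spectral_norm_nonneg)
qed

lemma max_norm_nonneg: "0 \<le> max_norm a n k"
proof -
  have "sqrt (spectral_norm (a_star_inv a ((\<lambda>x. 0 + x) ` cube k))) \<le> max_norm a n k"
    unfolding max_norm_def using finite_scaled_lattice_cube zero_in_scaled_lattice_cube by (intro Max_ge) blast+
  then show ?thesis using spectral_norm_nonneg real_sqrt_ge_zero order_trans by metis
qed

section \<open>Descendant cubes and the scaled lattices\<close>

context triadic_smooth
begin

text \<open>Odd subdivision keeps the centres on lattices: a centre with coordinate \<open>m\<close>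
  in units of the side has children with coordinate \<open>3 m + d\<close> in units of theirs,
  \<open>d\<close> being the digit.\<close>

lemma C_scaled_lattice:
  assumes "c0 = 0" "L = 3 powi n"
  shows "ds \<in> digits (length (levels bs N)) \<Longrightarrow> C N ds \<in> scaled_lattice (n - int N)"
proof (induction N arbitrary: ds)
  case 0
  have "C 0 ds = c0" by (simp add: C_def)
  then show ?case unfolding assms(1) by (auto simp: scaled_lattice_def intro!: exI[of _ 0])
next
  case (Suc N)
  define xs where "xs = take (length (levels bs N)) ds"
  define ys where "ys = drop (length (levels bs N)) ds"
  have ds: "ds = xs @ ys" by (simp add: xs_def ys_def)
  have xs: "xs \<in> digits (length (levels bs N))"
    using Suc.prems set_take_subset[of _ ds] unfolding digits_def xs_def by fastforce
  have len: "length ys = length bs" "length xs = length (levels bs N)"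
    using Suc.prems xs by (auto simp: digits_def ys_def)
  have half: "(3::real) powi (n - int N) = 3 * 3 powi (n - int (Suc N))"
    using power_int_add_1'[of "3::real" "n - int (Suc N)"] by (simp add: algebra_simps)
  have LN: "L / 3 ^ N = 3 powi (n - int N)" by (simp add: assms power_int_diff)
  have "\<exists>m::int. C (Suc N) ds $ e = 3 powi (n - int (Suc N)) * of_int m" for e
  proof -
    obtain i where i: "i < length bs" "bs ! i = e" using bs(2) by (metis in_set_conv_nth iso_tuple_UNIV_I)
    obtain m :: int where "C N xs $ e = 3 powi (n - int N) * of_int m"
      using Suc.IH[OF xs] by (auto simp: scaled_lattice_def)
    then have "C (Suc N) ds $ e = 3 powi (n - int (Suc N)) * of_int (3 * m + ys ! i)"
      using subc_component[OF bs(1) len(1) i(1), of "C N xs" "r N"] i len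
      unfolding ds by (simp add: C_append r_def LN half algebra_simps)
    then show ?thesis by blast
  qed
  then show ?case by (simp add: scaled_lattice_def)
qed

text \<open>An open set inside the closed cube lies in its interior, which is the open cube.\<close>

lemma C_cube:
  assumes "c0 = 0" "L = 3 powi n" "ds \<in> digits (length (levels bs N))"
  shows "C N ds \<in> cube n" "(\<lambda>x. C N ds + x) ` cube (n - int N) \<subseteq> cube n"
proof -
  have LN: "L / 3 ^ N = 3 powi (n - int N)" by (simp add: assms power_int_diff)
  have rN: "r N = (\<lambda>_. 3 powi (n - int N))" by (simp add: r_def LN)
  have t: "tbox c0 (\<lambda>_. L) = tbox 0 (\<lambda>_. 3 powi n)" using assms(1,2) by (simp only:)
  have sub: "tbox (C N ds) (\<lambda>_. 3 powi (n - int N)) \<subseteq> tbox 0 (\<lambda>_. 3 powi n)"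
    using C_box_subset[OF assms(3)] unfolding rN t .
  have "open ((\<lambda>x. C N ds + x) ` cube (n - int N))" by (rule cube_facts)
  moreover have "(\<lambda>x. C N ds + x) ` cube (n - int N) \<subseteq> tbox 0 (\<lambda>_. 3 powi n)"
    using sub unfolding translated_cube tbox_cbox using box_subset_cbox by blast
  ultimately have "(\<lambda>x. C N ds + x) ` cube (n - int N) \<subseteq> interior (tbox 0 (\<lambda>_. 3 powi n))"
    by (rule interior_maximal[rotated])
  also have "\<dots> = (\<lambda>x. 0 + x) ` cube n" unfolding translated_cube tbox_cbox by (rule interior_cbox)
  finally show *: "(\<lambda>x. C N ds + x) ` cube (n - int N) \<subseteq> cube n" by simp
  have "C N ds + 0 \<in> (\<lambda>x. C N ds + x) ` cube (n - int N)" by (rule imageI) (simp add: cube_def)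
  with * show "C N ds \<in> cube n" by auto
qed

end

text \<open>The mean energies over the cubes of one scale average to that of the whole cube, so the
  mean square of the mean gradients is bounded with only the maximum of the coarse-grained norms as
  a factor. This is the input \<open>B\<close> of \<open>bavg_powr_le\<close>.\<close>

lemma smooth_multiscale_estimate:
  fixes a :: "real^'n \<Rightarrow> real^'n^'n" and n :: int
  assumes cf: "coefficient_field (cube n) a" and \<phi>: "smooth \<phi>"
    and p: "2 \<le> p" "CARD('n) * (1/2 - 1/p) = 1 - s" and s: "0 < s"
    and S: "\<And>N. (\<Sum>k=1..N. 3 powr (- s * real k) * max_norm a n (n - int k)) \<le> S"
    and \<delta>: "0 < \<delta>"
  shows "bavg 0 (\<lambda>_. 3 powi n) (\<lambda>x. \<bar>\<phi> x - bavg 0 (\<lambda>_. 3 powi n) \<phi>\<bar> powr p) \<le>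
    ((2 + 4 * CARD('n) * 3 ^ CARD('n)) * 3 powi n * (S * sqrt (avg (cube n) (\<lambda>x. grad \<phi> x \<bullet> (a x *v grad \<phi> x)))) + \<delta>) powr p"
proof -
  define L where "L = (3::real) powi n"
  obtain bs :: "'n list" where bs: "set bs = UNIV" "distinct bs" using finite_distinct_list[of "UNIV :: 'n set"] by auto
  interpret T: triadic_smooth \<phi> bs 0 L
    by unfold_locales (auto simp: \<phi> bs L_def)
  define K where "K = 2 + 4 * real CARD('n) * 3 ^ CARD('n)"
  have K: "0 < K" by (simp add: K_def add_pos_nonneg)
  let ?e = "\<lambda>x. grad \<phi> x \<bullet> (a x *v grad \<phi> x)"
  have cube: "open (cube n :: (real^'n) set)" "bounded (cube n :: (real^'n) set)" "cube n \<noteq> ({} :: (real^'n) set)"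
    "(cube n :: (real^'n) set) \<in> sets lebesgue"
    using cube_facts[of "0 :: real^'n" n] by auto
  interpret D: coefficient_domain "cube n" a by unfold_locales (rule cf cube)+
  have eint: "integrable (lebesgue_on (cube n)) ?e" by (intro D.energy_integrable D.fin_grad \<phi>)
  define E where "E = avg (cube n) ?e"
  have E: "E = bavg 0 (\<lambda>_. L) ?e" "?e integrable_on tbox 0 (\<lambda>_. L)"
    using avg_eq_bavg[of 0 n ?e] eint by (simp_all add: E_def L_def)
  have E0: "0 \<le> E"
    unfolding E_def avg_def using D.energy_nonneg'[of "grad \<phi>", unfolded D.ip_def]
    by (rule divide_nonneg_nonneg) simp
  define \<epsilon> where "\<epsilon> = \<delta> / (2 * K * L)"
  have L: "0 < L" by (simp add: L_def)
  have \<epsilon>: "0 < \<epsilon>" using K L \<delta> by (simp add: \<epsilon>_def)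
  \<comment> \<open>The summable second term keeps \<open>B\<close> positive even if the norms or
    the energy vanish; by the choice of \<open>\<epsilon>\<close> it contributes at most
    \<open>\<delta> / 2\<close> in the end.\<close>
  define B where "B = (\<lambda>k. max_norm a n (n - int k) * sqrt E + \<epsilon> * (1/2) ^ k)"
  have Bpos: "0 < B k" for k
    unfolding B_def using max_norm_nonneg E0 \<epsilon> by (intro add_nonneg_pos mult_nonneg_nonneg) auto
  have BF: "dmean (levels bs (Suc N)) (\<lambda>ds. \<Sum>e\<in>UNIV. (T.F (Suc N) e ds)\<^sup>2) \<le> (B (Suc N))\<^sup>2" for N
  proof -
    let ?k = "n - int (Suc N)" and ?lv = "levels bs (Suc N)"
    have rk: "T.r (Suc N) = (\<lambda>_. 3 powi ?k)" 
    proof -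
      have "L / 3 ^ Suc N = 3 powi ?k" unfolding L_def by (rule powi3_div_power)
      then show ?thesis unfolding T.r_def by (simp only:)
    qed
    have "dmean ?lv (\<lambda>ds. \<Sum>e\<in>UNIV. (T.F (Suc N) e ds)\<^sup>2) \<le>
        dmean ?lv (\<lambda>ds. (max_norm a n ?k)\<^sup>2 * bavg (T.C (Suc N) ds) (T.r (Suc N)) ?e)"
    proof (rule dmean_mono)
      fix ds assume ds: "ds \<in> digits (length ?lv)"
      define z where "z = T.C (Suc N) ds"
      have z: "z \<in> scaled_lattice ?k \<inter> cube n" and sub: "(\<lambda>x. z + x) ` cube ?k \<subseteq> cube n"
        using T.C_scaled_lattice[OF refl L_def ds] T.C_cube[OF refl L_def ds] by (auto simp: z_def)
      interpret Z: coefficient_domain "(\<lambda>x. z + x) ` cube ?k" a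
        by unfold_locales (rule cube_facts coefficient_field_subset[OF cf sub cube(4) cube_facts(4)])+
      have "(\<Sum>e\<in>UNIV. (T.F (Suc N) e ds)\<^sup>2) = (\<Sum>e\<in>UNIV. (avg ((\<lambda>x. z + x) ` cube ?k) (partial_deriv e \<phi>))\<^sup>2)"
      proof (rule sum.cong[OF refl])
        fix e
        have "integrable (lebesgue_on ((\<lambda>x. z + x) ` cube ?k)) (partial_deriv e \<phi>)"
          using Z.fin_component_integrable[OF Z.fin_grad[OF \<phi>], of e] by (simp add: grad_component)
        from avg_eq_bavg(1)[OF this] show "(T.F (Suc N) e ds)\<^sup>2 = (avg ((\<lambda>x. z + x) ` cube ?k) (partial_deriv e \<phi>))\<^sup>2"
          by (simp add: T.F_def rk z_def)
      qed
      also have "\<dots> \<le> spectral_norm (a_star_inv a ((\<lambda>x. z + x) ` cube ?k)) * avg ((\<lambda>x. z + x) ` cube ?k) ?e"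
        by (rule Z.norm_avg_grad_le[OF \<phi>])
      also have "\<dots> \<le> (max_norm a n ?k)\<^sup>2 * avg ((\<lambda>x. z + x) ` cube ?k) ?e"
      proof (rule mult_right_mono[OF spectral_norm_le_max_norm[OF z]])
        show "0 \<le> avg ((\<lambda>x. z + x) ` cube ?k) ?e"
          unfolding avg_def using Z.energy_nonneg'[of "grad \<phi>", unfolded Z.ip_def]
          by (rule divide_nonneg_nonneg) simp
      qed
      also have "avg ((\<lambda>x. z + x) ` cube ?k) ?e = bavg z (\<lambda>_. 3 powi ?k) ?e"
        by (intro avg_eq_bavg(1) Z.energy_integrable Z.fin_grad \<phi>)
      finally show "(\<Sum>e\<in>UNIV. (T.F (Suc N) e ds)\<^sup>2) \<le> (max_norm a n ?k)\<^sup>2 * bavg (T.C (Suc N) ds) (T.r (Suc N)) ?e"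
        unfolding rk z_def .
    qed
    also have "\<dots> = (max_norm a n ?k)\<^sup>2 * dmean ?lv (\<lambda>ds. bavg (T.C (Suc N) ds) (T.r (Suc N)) ?e)"
      by (rule dmean_cmult)
    also have "dmean ?lv (\<lambda>ds. bavg (T.C (Suc N) ds) (T.r (Suc N)) ?e) = E"
      unfolding T.C_def T.subr_levels[symmetric] E(1) by (rule bavg_subdivide) (auto simp: L E(2))
    also have "(max_norm a n ?k)\<^sup>2 * E = (max_norm a n ?k * sqrt E)\<^sup>2" using E0 by (simp add: power_mult_distrib)
    also have "\<dots> \<le> (B (Suc N))\<^sup>2"
      unfolding B_def using max_norm_nonneg E0 \<epsilon> by (intro power_mono mult_nonneg_nonneg) auto
    finally show ?thesis .
  qed
  have SB: "(\<Sum>k=1..N. 3 powr (- s * real k) * B k) \<le> S * sqrt E + \<epsilon>" for N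
  proof -
    have "(\<Sum>k=1..N. 3 powr (- s * real k) * B k) \<le>
        (\<Sum>k=1..N. 3 powr (- s * real k) * max_norm a n (n - int k) * sqrt E + \<epsilon> * (1/2) ^ k)"
    proof (rule sum_mono)
      fix k
      have "(3::real) powr (- s * real k) \<le> 1" using powr_mono[of "- s * real k" 0 3] s by simp
      then have "3 powr (- s * real k) * (\<epsilon> * (1/2) ^ k) \<le> 1 * (\<epsilon> * (1/2) ^ k)"
        using \<epsilon> by (intro mult_right_mono) auto
      then show "3 powr (- s * real k) * B k \<le> 3 powr (- s * real k) * max_norm a n (n - int k) * sqrt E + \<epsilon> * (1/2) ^ k"
        by (simp add: B_def distrib_left mult.assoc)
    qed
    also have "\<dots> = (\<Sum>k=1..N. 3 powr (- s * real k) * max_norm a n (n - int k)) * sqrt E + \<epsilon> * (\<Sum>k=1..N. (1/2) ^ k)"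
      by (simp add: sum.distrib sum_distrib_left sum_distrib_right)
    also have "\<dots> \<le> S * sqrt E + \<epsilon> * 1"
    proof (intro add_mono mult_right_mono mult_left_mono S)
      have "(\<Sum>k=1..N. (1/2::real) ^ k) = 1 - (1/2) ^ N" by (induction N) auto
      then show "(\<Sum>k=1..N. (1/2::real) ^ k) \<le> 1" by simp
    qed (use E0 \<epsilon> in auto)
    finally show ?thesis by simp
  qed
  have "bavg 0 (\<lambda>_. L) (\<lambda>x. \<bar>\<phi> x - bavg 0 (\<lambda>_. L) \<phi>\<bar> powr p) \<le> (T.K0 * L * (S * sqrt E + \<epsilon>) + \<delta> / 2) powr p"
    by (rule T.bavg_powr_le[OF p s Bpos BF SB]) (use \<delta> in simp)
  also have "T.K0 * L * (S * sqrt E + \<epsilon>) + \<delta> / 2 = K * L * (S * sqrt E) + \<delta>"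
    using K L by (simp add: T.K0_def K_def[symmetric] \<epsilon>_def distrib_left)
  finally show ?thesis by (simp add: L_def E_def K_def)
qed

subsection \<open>Passage to the limit\<close>

lemma epowr_le:
  assumes "x \<le> ennreal y" "0 \<le> y" "0 \<le> q"
  shows "epowr x q \<le> ennreal (y powr q)"
proof -
  have "x \<noteq> \<infinity>" using assms(1) by (auto simp: top_unique)
  moreover have "enn2real x \<le> y" using enn2real_mono[OF assms(1)] assms(2) by simp
  ultimately show ?thesis
    unfolding epowr_def using assms(3) by (auto intro!: ennreal_leI powr_mono2)
qed

text \<open>The powers in \<open>lambda_s\<close> and in the estimate cancel to the plain sum; the
  values 0 and \<open>\<infinity>\<close> are covered by the conventions for \<open>inverse\<close>
  and \<open>epowr\<close>.\<close>

lemma inverse_epowr_inverse_square: "inverse (epowr (inverse (T\<^sup>2)) (1/2)) = T"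
proof (cases "T = 0 \<or> T = \<infinity>")
  case True
  then show ?thesis by (auto simp: epowr_def power2_eq_square ennreal_top_mult)
next
  case False
  then obtain t where t: "T = ennreal t" "0 < t" by (cases T) (auto simp: less_le)
  then have "inverse (T\<^sup>2) = ennreal (inverse (t\<^sup>2))"
    by (simp add: ennreal_power inverse_ennreal)
  then have "epowr (inverse (T\<^sup>2)) (1/2) = ennreal (inverse t)"
    using t by (simp add: epowr_def powr_half_sqrt real_sqrt_inverse)
  then show ?thesis using t by (simp add: inverse_ennreal)
qed

text \<open>With \<open>t\<close> close to the square root of \<open>E j\<close>, an additive
  Cauchy-Schwarz bound becomes convergence.\<close>

lemma tendsto_zero_of_interpolation:
  fixes x E :: "nat \<Rightarrow> real"
  assumes E: "E \<longlonglongrightarrow> 0" "\<And>j. 0 \<le> E j" and x: "\<And>j. 0 \<le> x j"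
    and le: "\<And>j t. 0 < t \<Longrightarrow> x j \<le> t * A + E j / t"
  shows "x \<longlonglongrightarrow> 0"
proof -
  \<comment> \<open>The summand \<open>1 / (j + 1)\<close> keeps \<open>t j\<close> positive where
    \<open>E j = 0\<close>.\<close>
  define t where "t = (\<lambda>j. sqrt (E j + 1 / real (Suc j)))"
  have t: "0 < t j" for j using E(2)[of j] by (simp add: t_def add_nonneg_pos)
  have "(\<lambda>j. E j + 1 / real (Suc j)) \<longlonglongrightarrow> 0 + 0"
    using LIMSEQ_inverse_real_of_nat by (intro tendsto_add E) (simp add: inverse_eq_divide)
  then have "t \<longlonglongrightarrow> sqrt (0 + 0)" unfolding t_def by (rule tendsto_real_sqrt)
  then have lim: "(\<lambda>j. t j * A + t j) \<longlonglongrightarrow> 0 * A + 0" by (intro tendsto_add tendsto_mult tendsto_const) simp_all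
  have "x j \<le> t j * A + t j" for j
  proof -
    have "E j \<le> (t j)\<^sup>2" using E(2)[of j] by (simp add: t_def)
    then have "E j / t j \<le> t j" using t[of j] by (simp add: divide_le_eq power2_eq_square)
    with le[OF t[of j], of j] show ?thesis by simp
  qed
  then have up: "\<forall>\<^sub>F j in sequentially. x j \<le> t j * A + t j" by (intro always_eventually allI)
  have low: "\<forall>\<^sub>F j in sequentially. 0 \<le> x j" by (intro always_eventually allI x)
  have "(\<lambda>j. t j * A + t j) \<longlonglongrightarrow> 0" using lim by simp
  from tendsto_sandwich[OF low up tendsto_const this] show ?thesis .
qed

section \<open>Approximation in \<open>H1\<close> by smooth functions\<close>

context coefficient_domain
begin

lemma continuous_integrable:
  fixes f :: "real^'n \<Rightarrow> real"
  assumes "continuous_on UNIV f"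
  shows "integrable M f"
proof -
  obtain B where "\<And>x. x \<in> U \<Longrightarrow> norm (f x) \<le> B" using continuous_bounded[OF assms] by metis
  then show ?thesis
    by (intro finite_measure.integrable_const_bound[OF finite_M, of _ B] continuous_measurable[OF assms])
       (auto intro!: AE_I2)
qed

lemma emeasure_M: "emeasure lebesgue U = ennreal (measure lebesgue U)" "emeasure M U = ennreal (measure lebesgue U)"
proof -
  show "emeasure lebesgue U = ennreal (measure lebesgue U)"
    using U_lebesgue by (intro emeasure_eq_measure2)
  then show "emeasure M U = ennreal (measure lebesgue U)"
    using U_lebesgue by (simp add: emeasure_restrict_space)
qed

lemma integral_const_M: "(LINT x|M. c) = measure lebesgue U * (c::real)"
  using emeasure_M by (simp add: lebesgue_integral_const measure_def)

lemma energy_tendsto_zero_imp_L1: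
  assumes "\<And>j. fin (f j)" "(\<lambda>j. ip (f j) (f j)) \<longlonglongrightarrow> 0"
  shows "(\<lambda>j. LINT x|M. norm (f j x)) \<longlonglongrightarrow> 0"
proof (rule tendsto_zero_of_interpolation[OF assms(2) energy_nonneg', of _ W])
  show n: "0 \<le> (LINT x|M. norm (f j x))" for j by (rule integral_nonneg_AE) simp
  show "(LINT x|M. norm (f j x)) \<le> t * W + ip (f j) (f j) / t" if "0 < t" for j t
  proof -
    have "(LINT x|M. norm (f j x)) \<le> 2 * (LINT x|M. norm (f j x))" using n[of j] by simp
    also have "\<dots> \<le> t * W + ip (f j) (f j) / t" by (rule norm_integrable(2)[OF assms(1)[of j] that])
    finally show ?thesis .
  qed
qed

text \<open>The finitely many approximants at infinite distance are dropped. On the bounded domain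
  \<open>L^2\<close> convergence gives \<open>L^1\<close> convergence and, for a subsequence,
  convergence almost everywhere; the energies converge because \<open>ip_bound\<close> makes the
  mixed term vanish.\<close>

lemma H1_approximation:
  assumes "(u, g) \<in> H1 a U"
  obtains \<phi> where "\<And>j. smooth (\<phi> j)" "integrable M u"
    "(\<lambda>j. LINT x|M. \<bar>\<phi> j x - u x\<bar>) \<longlonglongrightarrow> 0" "AE x in M. (\<lambda>j. \<phi> j x) \<longlonglongrightarrow> u x"
    "(\<lambda>j. ip (grad (\<phi> j)) (grad (\<phi> j))) \<longlonglongrightarrow> ip g g"
proof -
  let ?a = "\<lambda>\<phi>. \<integral>\<^sup>+x. ennreal ((\<phi> x - u x)\<^sup>2) \<partial>M"
  let ?b = "\<lambda>\<phi>. \<integral>\<^sup>+x. ennreal ((grad \<phi> x - g x) \<bullet> (a x *v (grad \<phi> x - g x))) \<partial>M"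
  have mu: "u \<in> borel_measurable M" and mg: "g \<in> borel_measurable M" using assms by (auto simp: H1_def)
  obtain \<phi>0 where \<phi>0: "\<And>j. smooth (\<phi>0 j)" and lim0: "(\<lambda>j. ?a (\<phi>0 j) + ?b (\<phi>0 j)) \<longlonglongrightarrow> 0"
    using assms by (auto simp: H1_def)
  have "eventually (\<lambda>j. ?a (\<phi>0 j) + ?b (\<phi>0 j) < \<infinity>) sequentially"
    using order_tendstoD(2)[OF lim0, of \<infinity>] by simp
  then obtain J where J: "\<And>j. J \<le> j \<Longrightarrow> ?a (\<phi>0 j) + ?b (\<phi>0 j) < \<infinity>"
    unfolding eventually_sequentially by blast
  define \<phi> where "\<phi> = (\<lambda>j. \<phi>0 (j + J))"
  have \<phi>: "smooth (\<phi> j)" for j by (simp add: \<phi>_def \<phi>0)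
  have lim: "(\<lambda>j. ?a (\<phi> j) + ?b (\<phi> j)) \<longlonglongrightarrow> 0"
    unfolding \<phi>_def by (rule LIMSEQ_ignore_initial_segment[OF lim0])
  have fina: "?a (\<phi> j) < \<infinity>" and finb: "?b (\<phi> j) < \<infinity>" for j
    using J[of "j + J"] by (auto simp: \<phi>_def)
  have m\<phi>: "\<phi> j \<in> borel_measurable M" "grad (\<phi> j) \<in> borel_measurable M" for j
    using smooth_measurable[OF \<phi>] by auto
  have int2: "integrable M (\<lambda>x. (\<phi> j x - u x)\<^sup>2)" for j
    using fina[of j] m\<phi>(1)[of j] mu by (intro integrableI_nonneg borel_measurable_power borel_measurable_diff) auto
  have findiff: "fin (\<lambda>x. grad (\<phi> j) x - g x)" for j
    by (rule finI[OF borel_measurable_diff[OF m\<phi>(2) mg] finb])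
  define d where "d = (\<lambda>j. LINT x|M. (\<phi> j x - u x)\<^sup>2)"
  define e where "e = (\<lambda>j. ip (\<lambda>x. grad (\<phi> j) x - g x) (\<lambda>x. grad (\<phi> j) x - g x))"
  have d0: "0 \<le> d j" for j unfolding d_def by (rule integral_nonneg_AE) simp
  have e0: "0 \<le> e j" for j unfolding e_def by (rule energy_nonneg')
  have ab: "?a (\<phi> j) = ennreal (d j)" "?b (\<phi> j) = ennreal (e j)" for j
    using int2[of j] findiff[of j] by (simp_all add: d_def e_def nn_integral_eq_integral nn_energy)
  have de: "(\<lambda>j. d j + e j) \<longlonglongrightarrow> 0"
    using lim unfolding ab using d0 e0 by (simp add: ennreal_plus[symmetric] tendsto_ennreal_iff[of _ _ 0, simplified] del: ennreal_plus)
  have d: "d \<longlonglongrightarrow> 0"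
    by (rule tendsto_sandwich[OF _ _ tendsto_const de]) (auto simp: d0 e0)
  have e: "e \<longlonglongrightarrow> 0"
    by (rule tendsto_sandwich[OF _ _ tendsto_const de]) (auto simp: d0 e0)
  have intabs: "integrable M (\<lambda>x. \<phi> j x - u x)" for j
  proof (rule Bochner_Integration.integrable_bound)
    show "integrable M (\<lambda>x. 1 + (\<phi> j x - u x)\<^sup>2)"
      using int2 finite_measure.integrable_const[OF finite_M] by (intro Bochner_Integration.integrable_add) auto
    show "(\<lambda>x. \<phi> j x - u x) \<in> borel_measurable M" using m\<phi>(1) mu by (rule borel_measurable_diff)
    have "norm y \<le> norm (1 + y\<^sup>2)" for y :: real
    proof -
      have "0 \<le> (1 - \<bar>y\<bar>)\<^sup>2" by simp
      also have "\<dots> = 1 - 2 * \<bar>y\<bar> + y\<^sup>2" by (simp add: power2_diff)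
      finally have "\<bar>y\<bar> \<le> 1 + y\<^sup>2" using abs_ge_zero[of y] by linarith
      then show ?thesis by simp
    qed
    then show "AE x in M. norm (\<phi> j x - u x) \<le> norm (1 + (\<phi> j x - u x)\<^sup>2)" by (intro AE_I2)
  qed
  have intu: "integrable M u"
    using Bochner_Integration.integrable_diff[OF continuous_integrable[OF smooth_continuous[OF \<phi>[of 0]]] intabs[of 0]] by simp
  have L1: "(\<lambda>j. LINT x|M. \<bar>\<phi> j x - u x\<bar>) \<longlonglongrightarrow> 0"
  proof (rule tendsto_zero_of_interpolation[OF d d0, of _ "measure lebesgue U"])
    show "0 \<le> (LINT x|M. \<bar>\<phi> j x - u x\<bar>)" for j by (rule integral_nonneg_AE) simp
    show "(LINT x|M. \<bar>\<phi> j x - u x\<bar>) \<le> t * measure lebesgue U + d j / t" if t: "0 < t" for j t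
    proof -
      have int3: "integrable M (\<lambda>x. t + (\<phi> j x - u x)\<^sup>2 / t)"
        using int2 finite_measure.integrable_const[OF finite_M] by (intro Bochner_Integration.integrable_add) auto
      have "\<bar>y\<bar> \<le> t + y\<^sup>2 / t" for y
      proof -
        have "t * \<bar>y\<bar> \<le> t * t + y\<^sup>2"
        proof -
          have "t * \<bar>y\<bar> \<le> 2 * t * \<bar>y\<bar>" using mult_nonneg_nonneg[of t "\<bar>y\<bar>"] t by linarith
          also have "\<dots> \<le> t\<^sup>2 + \<bar>y\<bar>\<^sup>2" by (rule sum_squares_bound)
          finally show ?thesis by (simp add: power2_eq_square)
        qed
        then show ?thesis using t by (simp add: field_simps)
      qed
      then have "(LINT x|M. \<bar>\<phi> j x - u x\<bar>) \<le> (LINT x|M. t + (\<phi> j x - u x)\<^sup>2 / t)"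
        using intabs by (intro integral_mono int3) auto
      also have "\<dots> = (LINT x|M. t) + (LINT x|M. (\<phi> j x - u x)\<^sup>2 / t)"
        using int2 finite_measure.integrable_const[OF finite_M] by (intro Bochner_Integration.integral_add) auto
      also have "\<dots> = t * measure lebesgue U + d j / t" by (simp only: integral_const_M) (simp add: d_def)
      finally show ?thesis .
    qed
  qed
  have fing: "fin g" by (rule H1_fin[OF assms])
  have E: "(\<lambda>j. ip (grad (\<phi> j)) (grad (\<phi> j))) \<longlonglongrightarrow> ip g g"
  proof -
    let ?h = "\<lambda>j x. grad (\<phi> j) x - g x"
    have cross: "(\<lambda>j. \<bar>ip g (?h j)\<bar>) \<longlonglongrightarrow> 0"
    proof (rule tendsto_zero_of_interpolation[OF e e0, of _ "ip g g"])
      show "\<bar>ip g (?h j)\<bar> \<le> t * ip g g + e j / t" if "0 < t" for j t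
        using ip_bound[OF fing findiff that, of j] unfolding e_def by linarith
    qed simp
    have "ip (grad (\<phi> j)) (grad (\<phi> j)) = ip g g + 2 * ip g (?h j) + e j" for j
      using energy_add[OF fing findiff, of j] by (simp add: e_def)
    moreover have "(\<lambda>j. ip g g + 2 * ip g (?h j) + e j) \<longlonglongrightarrow> ip g g + 2 * 0 + 0"
      by (intro tendsto_add tendsto_mult tendsto_const e tendsto_rabs_zero_cancel[OF cross])
    ultimately show ?thesis by simp
  qed
  obtain r where r: "strict_mono r" "AE x in M. (\<lambda>n. \<phi> (r n) x - u x) \<longlonglongrightarrow> 0"
    using tendsto_L1_AE_subseq[of M "\<lambda>j x. \<phi> j x - u x"] intabs L1 by auto
  show thesis
  proof (rule that[of "\<lambda>j. \<phi> (r j)"])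
    show "smooth (\<phi> (r j))" for j by (rule \<phi>)
    show "(\<lambda>j. LINT x|M. \<bar>\<phi> (r j) x - u x\<bar>) \<longlonglongrightarrow> 0"
      using LIMSEQ_subseq_LIMSEQ[OF L1 r(1)] by (simp add: o_def)
    show "(\<lambda>j. ip (grad (\<phi> (r j))) (grad (\<phi> (r j)))) \<longlonglongrightarrow> ip g g"
      using LIMSEQ_subseq_LIMSEQ[OF E r(1)] by (simp add: o_def)
    show "AE x in M. (\<lambda>j. \<phi> (r j) x) \<longlonglongrightarrow> u x"
      using r(2) by eventually_elim (simp add: LIM_zero_iff)
  qed (rule intu)
qed

lemma avg_tendsto:
  assumes "\<And>j. integrable M (f j)" "integrable M u" "(\<lambda>j. LINT x|M. \<bar>f j x - u x\<bar>) \<longlonglongrightarrow> 0"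
  shows "(\<lambda>j. avg U (f j)) \<longlonglongrightarrow> avg U u"
proof -
  have "(\<lambda>j. LINT x|M. f j x) \<longlonglongrightarrow> (LINT x|M. u x)"
  proof (rule LIM_zero_cancel, rule tendsto_rabs_zero_cancel, rule tendsto_sandwich[OF _ _ tendsto_const assms(3)])
    show "\<forall>\<^sub>F j in sequentially. \<bar>(LINT x|M. f j x) - (LINT x|M. u x)\<bar> \<le> (LINT x|M. \<bar>f j x - u x\<bar>)"
      using integral_norm_bound[of M "\<lambda>x. f _ x - u x"] assms(1,2) by (intro always_eventually allI) simp
  qed simp
  then show ?thesis unfolding avg_def using measure_U_pos by (intro tendsto_divide tendsto_const) auto
qed

lemma energy_avg_Lp_norm:
  assumes "fin g"
  shows "avg_Lp_norm 2 U (\<lambda>x. matrix_sqrt (a x) *v g x) = ennreal (sqrt (ip g g / measure lebesgue U))"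
proof -
  have "(\<integral>\<^sup>+x. ennreal (norm (matrix_sqrt (a x) *v g x) powr 2) \<partial>M) = (\<integral>\<^sup>+x. ennreal (g x \<bullet> (a x *v g x)) \<partial>M)"
    by (rule nn_integral_cong) (simp add: norm_matrix_sqrt_squared[OF psd])
  also have "\<dots> = ennreal (ip g g)" by (rule nn_energy[OF assms])
  finally show ?thesis
    unfolding avg_Lp_norm_def emeasure_M
    using measure_U_pos energy_nonneg'[of g] by (simp add: divide_ennreal epowr_def powr_half_sqrt)
qed

end

section \<open>The case of vanishing energy\<close>

lemma integral_cube_eq:
  fixes f :: "real^'n \<Rightarrow> real"
  assumes "continuous_on UNIV f"
  shows "(\<integral>x. indicator (tbox 0 (\<lambda>_. 3 powi n)) x * f x \<partial>lborel) = (LINT x|lebesgue_on (cube n). f x)"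
    "integrable (lebesgue_on (cube n)) f"
proof -
  have sub: "cube n \<subseteq> tbox (0::real^'n) (\<lambda>_. 3 powi n)"
    using translated_cube[of "0::real^'n" n] box_subset_cbox unfolding tbox_cbox by auto
  have "integrable (lebesgue_on (tbox 0 (\<lambda>_. 3 powi n))) f"
    unfolding tbox_def by (intro continuous_imp_integrable) (rule continuous_on_subset[OF assms subset_UNIV])
  then show int: "integrable (lebesgue_on (cube n)) f"
    by (rule integrable_lebesgue_on_subset[OF _ sub])
       (use cube_facts(4)[of "0::real^'n" n] in \<open>simp_all add: tbox_def\<close>)
  have "(\<integral>x. indicator (tbox 0 (\<lambda>_. 3 powi n)) x * f x \<partial>lborel) = integral (tbox 0 (\<lambda>_. 3 powi n)) f"
    by (intro integral_indicator_lborel continuous_on_subset[OF assms]) (auto simp: tbox_def)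
  also have "\<dots> = integral ((\<lambda>x. 0 + x) ` cube n) f"
    unfolding translated_cube tbox_cbox by (rule integral_open_interval[symmetric])
  also have "\<dots> = (LINT x|lebesgue_on (cube n). f x)"
    using lebesgue_integral_eq_integral[OF int] cube_facts(4)[of "0::real^'n" n] by simp
  finally show "(\<integral>x. indicator (tbox 0 (\<lambda>_. 3 powi n)) x * f x \<partial>lborel) = (LINT x|lebesgue_on (cube n). f x)" .
qed

text \<open>The volume \<open>m\<close> times the deviation of \<open>\<phi> x\<close> from the mean
  is at most the integral of \<open>\<bar>\<phi> y - \<phi> x\<bar>\<close> over
  \<open>y\<close>.\<close>

lemma cube_Poincare_L1:
  fixes n :: int
  obtains K where "0 \<le> K" "\<And>\<phi> :: real^'n \<Rightarrow> real. smooth \<phi> \<Longrightarrow>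
    (LINT x|lebesgue_on (cube n). \<bar>\<phi> x - avg (cube n) \<phi>\<bar>) \<le> K * (LINT x|lebesgue_on (cube n). norm (grad \<phi> x))"
proof -
  let ?Q = "tbox (0::real^'n) (\<lambda>_. 3 powi n)"
  define m where "m = measure lebesgue (cube n :: (real^'n) set)"
  have m: "0 < m" using measure_translated_cube[of "0::real^'n" n] by (simp add: m_def)
  have Q: "compact ?Q" "convex ?Q" by (simp_all add: tbox_def)
  obtain K where K: "0 \<le> K" "\<And>\<phi>. smooth \<phi> \<Longrightarrow>
    (\<integral>x. indicator ?Q x * (\<integral>y. indicator ?Q y * \<bar>\<phi> y - \<phi> x\<bar> \<partial>lborel) \<partial>lborel) \<le>
      K * (\<integral>x. indicator ?Q x * norm (grad \<phi> x) \<partial>lborel)"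
    by (rule smooth_Poincare_L1[OF Q]) blast
  have "(LINT x|lebesgue_on (cube n). \<bar>\<phi> x - avg (cube n) \<phi>\<bar>) \<le> K / m * (LINT x|lebesgue_on (cube n). norm (grad \<phi> x))"
    if \<phi>: "smooth \<phi>" for \<phi> :: "real^'n \<Rightarrow> real"
  proof -
    have c\<phi>: "continuous_on S \<phi>" for S by (rule smooth_continuous[OF \<phi>])
    let ?I = "\<lambda>x. \<integral>y. indicator ?Q y * \<bar>\<phi> y - \<phi> x\<bar> \<partial>lborel"
    have eqI: "?I x = (LINT y|lebesgue_on (cube n). \<bar>\<phi> y - \<phi> x\<bar>)" for x
      by (rule integral_cube_eq(1)) (intro continuous_intros c\<phi>)
    have pt: "m * \<bar>\<phi> x - avg (cube n) \<phi>\<bar> \<le> ?I x" for x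
    proof -
      have int: "integrable (lebesgue_on (cube n)) \<phi>" "integrable (lebesgue_on (cube n)) (\<lambda>y. \<phi> x)"
        by (intro integral_cube_eq c\<phi> continuous_on_const)+
      have "m * (avg (cube n) \<phi> - \<phi> x) = (LINT y|lebesgue_on (cube n). \<phi> y - \<phi> x)"
        unfolding Bochner_Integration.integral_diff[OF int] using m cube_facts(4)[of "0::real^'n" n]
        by (simp add: avg_def m_def right_diff_distrib lebesgue_integral_const measure_restrict_space)
      then have "m * \<bar>avg (cube n) \<phi> - \<phi> x\<bar> = \<bar>LINT y|lebesgue_on (cube n). \<phi> y - \<phi> x\<bar>"
        using m by (metis abs_mult abs_of_pos)
      also have "\<dots> \<le> ?I x"
        unfolding eqI using integral_norm_bound[of "lebesgue_on (cube n)" "\<lambda>y. \<phi> y - \<phi> x"] by simp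
      finally show ?thesis by (simp add: abs_minus_commute)
    qed
    have intI: "integrable lborel (\<lambda>x. indicator ?Q x * ?I x)"
    proof -
      have "continuous_on ?Q ?I"
      proof -
        have eq: "?I x = integral ?Q (\<lambda>y. \<bar>\<phi> y - \<phi> x\<bar>)" for x
          by (intro integral_indicator_lborel Q continuous_intros c\<phi>)
        show ?thesis
          unfolding eq unfolding tbox_def
          by (rule integral_continuous_on_param)
             (auto simp: split_def intro!: continuous_on_compose2[OF c\<phi>[of UNIV]] continuous_intros)
      qed
      then show ?thesis by (intro integral_indicator_lborel Q)
    qed
    have "m * (LINT x|lebesgue_on (cube n). \<bar>\<phi> x - avg (cube n) \<phi>\<bar>) = (\<integral>x. indicator ?Q x * (m * \<bar>\<phi> x - avg (cube n) \<phi>\<bar>) \<partial>lborel)"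
      by (subst integral_cube_eq(1)) (auto intro!: continuous_intros c\<phi>)
    also have "\<dots> \<le> (\<integral>x. indicator ?Q x * ?I x \<partial>lborel)"
    proof (rule integral_mono[OF _ intI])
      show "integrable lborel (\<lambda>x. indicator ?Q x * (m * \<bar>\<phi> x - avg (cube n) \<phi>\<bar>))"
        by (intro integral_indicator_lborel Q continuous_intros c\<phi>)
      show "indicator ?Q x * (m * \<bar>\<phi> x - avg (cube n) \<phi>\<bar>) \<le> indicator ?Q x * ?I x" for x
        using pt[of x] by (auto simp: indicator_def)
    qed
    also have "\<dots> \<le> K * (\<integral>x. indicator ?Q x * norm (grad \<phi> x) \<partial>lborel)" by (rule K(2)[OF \<phi>])
    also have "(\<integral>x. indicator ?Q x * norm (grad \<phi> x) \<partial>lborel) = (LINT x|lebesgue_on (cube n). norm (grad \<phi> x))"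
      by (rule integral_cube_eq(1)) (intro continuous_intros smooth_continuous_grad \<phi>)
    finally show ?thesis using m by (simp add: field_simps)
  qed
  then show thesis using that[of "K / m"] K(1) m by simp
qed

text \<open>The energies of the approximants tend to 0, hence so do their gradients in
  \<open>L^1\<close>, hence their \<open>L^1\<close> distances from their means.\<close>

lemma zero_energy_imp_constant:
  fixes a :: "real^'n \<Rightarrow> real^'n^'n"
  assumes cf: "coefficient_field (cube n) a" and u: "(u, g) \<in> H1 a (cube n)"
    and zero: "(LINT x|lebesgue_on (cube n). g x \<bullet> (a x *v g x)) = 0"
  shows "AE x in lebesgue_on (cube n). u x = avg (cube n) u"
proof -
  have cube: "open (cube n :: (real^'n) set)" "bounded (cube n :: (real^'n) set)" "cube n \<noteq> ({} :: (real^'n) set)"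
    using cube_facts[of "0 :: real^'n" n] by auto
  interpret D: coefficient_domain "cube n" a by unfold_locales (rule cf cube)+
  obtain \<phi> where \<phi>: "\<And>j. smooth (\<phi> j)" and intu: "integrable D.M u" and
    L1: "(\<lambda>j. LINT x|D.M. \<bar>\<phi> j x - u x\<bar>) \<longlonglongrightarrow> 0" and
    E: "(\<lambda>j. D.ip (grad (\<phi> j)) (grad (\<phi> j))) \<longlonglongrightarrow> D.ip g g"
    by (rule D.H1_approximation[OF u]) blast
  obtain K where K: "0 \<le> K" "\<And>\<phi> :: real^'n \<Rightarrow> real. smooth \<phi> \<Longrightarrow>
    (LINT x|D.M. \<bar>\<phi> x - avg (cube n) \<phi>\<bar>) \<le> K * (LINT x|D.M. norm (grad \<phi> x))"
    by (rule cube_Poincare_L1[where ?'n = 'n and n = n]) blast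
  have int\<phi>: "integrable D.M (\<phi> j)" for j by (intro D.continuous_integrable smooth_continuous \<phi>)
  have c: "integrable D.M (\<lambda>x. b)" for b :: real by (intro D.continuous_integrable continuous_on_const)
  have "(\<lambda>j. D.ip (grad (\<phi> j)) (grad (\<phi> j))) \<longlonglongrightarrow> 0" using E zero by (simp add: D.ip_def)
  then have G: "(\<lambda>j. LINT x|D.M. norm (grad (\<phi> j) x)) \<longlonglongrightarrow> 0"
    by (intro D.energy_tendsto_zero_imp_L1 D.fin_grad \<phi>)
  have av: "(\<lambda>j. avg (cube n) (\<phi> j)) \<longlonglongrightarrow> avg (cube n) u" by (rule D.avg_tendsto[OF int\<phi> intu L1])
  let ?m = "measure lebesgue (cube n :: (real^'n) set)"
  have le: "(LINT x|D.M. \<bar>u x - avg (cube n) u\<bar>) \<le> (LINT x|D.M. \<bar>\<phi> j x - u x\<bar>) + K * (LINT x|D.M. norm (grad (\<phi> j) x)) +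
      ?m * \<bar>avg (cube n) (\<phi> j) - avg (cube n) u\<bar>" for j
  proof -
    have "(LINT x|D.M. \<bar>u x - avg (cube n) u\<bar>) \<le>
        (LINT x|D.M. \<bar>\<phi> j x - u x\<bar> + \<bar>\<phi> j x - avg (cube n) (\<phi> j)\<bar> + \<bar>avg (cube n) (\<phi> j) - avg (cube n) u\<bar>)"
      using int\<phi>[of j] intu c by (intro integral_mono) auto
    also have "\<dots> = (LINT x|D.M. \<bar>\<phi> j x - u x\<bar>) + (LINT x|D.M. \<bar>\<phi> j x - avg (cube n) (\<phi> j)\<bar>) +
        (LINT x|D.M. \<bar>avg (cube n) (\<phi> j) - avg (cube n) u\<bar>)"
      using int\<phi>[of j] intu c by simp
    finally show ?thesis using K(2)[OF \<phi>[of j]] unfolding D.integral_const_M by linarith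
  qed
  have "(\<lambda>j. (LINT x|D.M. \<bar>\<phi> j x - u x\<bar>) + K * (LINT x|D.M. norm (grad (\<phi> j) x)) +
      ?m * \<bar>avg (cube n) (\<phi> j) - avg (cube n) u\<bar>) \<longlonglongrightarrow> 0 + K * 0 + ?m * \<bar>avg (cube n) u - avg (cube n) u\<bar>"
    by (intro tendsto_add tendsto_mult tendsto_const L1 G tendsto_rabs tendsto_diff av)
  then have "(LINT x|D.M. \<bar>u x - avg (cube n) u\<bar>) \<le> 0"
    using le by (intro LIMSEQ_le_const[of _ 0]) auto
  then have "(LINT x|D.M. \<bar>u x - avg (cube n) u\<bar>) = 0"
    by (intro antisym) (simp_all add: integral_nonneg_AE)
  then have "AE x in D.M. \<bar>u x - avg (cube n) u\<bar> = 0"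
    using intu c by (subst (asm) integral_nonneg_eq_0_iff_AE) auto
  then show ?thesis by eventually_elim simp
qed

section \<open>Exponents, constants and conclusion\<close>

lemma sobolev_exponent_conv:
  assumes "2 \<le> d" "0 < s" "s \<le> 1"
  shows "2 \<le> sobolev_exponent d s" "d * (1/2 - 1 / sobolev_exponent d s) = 1 - s"
proof -
  have "d - 2 * (1 - s) = (d - 2) + 2 * s" by (simp add: algebra_simps)
  then have D: "0 < d - 2 * (1 - s)" using assms by (simp add: add_nonneg_pos)
  then show "2 \<le> sobolev_exponent d s"
    using assms unfolding sobolev_exponent_def by (subst pos_le_divide_eq) auto
  have "1 / sobolev_exponent d s = (d - 2 * (1 - s)) / (2 * d)" by (simp add: sobolev_exponent_def)
  then show "d * (1/2 - 1 / sobolev_exponent d s) = 1 - s" using assms by (simp add: field_simps)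
qed

text \<open>As \<open>ln 3 \<ge> 1\<close>, \<open>3 powr s\<close> is at least
  \<open>1 + s\<close>, and \<open>1 - 1 / (1 + s) = s / (1 + s) \<ge> s / 2\<close>. The bound
  trades the normalizing factor in \<open>lambda_s\<close> for the \<open>1 / s\<close> of the
  estimate.\<close>

lemma one_minus_powr_ge:
  assumes "0 < s" "s \<le> (1::real)"
  shows "s / 2 \<le> 1 - 3 powr (- s)"
proof -
  have "1 \<le> ln (3::real)" using exp_le by (subst ln_ge_iff) auto
  then have "1 + s \<le> 1 + s * ln 3" using assms by simp
  also have "\<dots> \<le> exp (s * ln 3)" by (rule exp_ge_add_one_self)
  also have "\<dots> = 3 powr s" by (simp add: powr_def)
  finally have le: "1 + s \<le> 3 powr s" .
  have "s / 2 \<le> 1 - 1 / (1 + s)" using assms by (simp add: field_simps)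
  also have "\<dots> \<le> 1 - 1 / 3 powr s" using le assms by (intro diff_left_mono divide_left_mono) auto
  also have "\<dots> = 1 - 3 powr (- s)" by (simp add: powr_minus_divide)
  finally show ?thesis .
qed

text \<open>Fatou's lemma carries the estimate from the smooth approximants to \<open>u\<close>:
  they converge almost everywhere, and so do their means and energies as numbers.\<close>

lemma Sobolev_Poincare_of_multiscale_bound:
  fixes a :: "real^'n \<Rightarrow> real^'n^'n" and n :: int
  assumes cf: "coefficient_field (cube n) a" and u: "(u, g) \<in> H1 a (cube n)"
    and p: "2 \<le> p" "CARD('n) * (1/2 - 1/p) = 1 - s" and s: "0 < s"
    and S: "\<And>N. (\<Sum>k=1..N. 3 powr (- s * real k) * max_norm a n (n - int k)) \<le> S"
  shows "avg_Lp_norm p (cube n) (\<lambda>x. u x - avg (cube n) u) \<le>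
    ennreal ((2 + 4 * real CARD('n) * 3 ^ CARD('n)) * 3 powi n * (S * sqrt (avg (cube n) (\<lambda>x. g x \<bullet> (a x *v g x)))))"
proof -
  have cube: "open (cube n :: (real^'n) set)" "bounded (cube n :: (real^'n) set)" "cube n \<noteq> ({} :: (real^'n) set)"
    using cube_facts[of "0 :: real^'n" n] by auto
  interpret D: coefficient_domain "cube n" a by unfold_locales (rule cf cube)+
  obtain \<phi> where \<phi>: "\<And>j. smooth (\<phi> j)" and intu: "integrable D.M u" and
    L1: "(\<lambda>j. LINT x|D.M. \<bar>\<phi> j x - u x\<bar>) \<longlonglongrightarrow> 0" and
    ae: "AE x in D.M. (\<lambda>j. \<phi> j x) \<longlonglongrightarrow> u x" and
    E: "(\<lambda>j. D.ip (grad (\<phi> j)) (grad (\<phi> j))) \<longlonglongrightarrow> D.ip g g"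
    by (rule D.H1_approximation[OF u]) blast
  define m where "m = measure lebesgue (cube n :: (real^'n) set)"
  have m: "0 < m" unfolding m_def by (rule D.measure_U_pos)
  define K where "K = 2 + 4 * real CARD('n) * 3 ^ CARD('n)"
  have K: "0 \<le> K" by (simp add: K_def)
  define X where "X = (\<lambda>h :: real^'n \<Rightarrow> real^'n. K * 3 powi n * (S * sqrt (D.ip h h / m)))"
  have avgX: "K * 3 powi n * (S * sqrt (avg (cube n) (\<lambda>x. h x \<bullet> (a x *v h x)))) = X h" for h
    by (simp add: X_def avg_def D.ip_def m_def)
  have S0: "0 \<le> S" using S[of 0] by simp
  have X0: "0 \<le> X h" for h
    unfolding X_def using K S0 m D.energy_nonneg'[of h] by (intro mult_nonneg_nonneg real_sqrt_ge_zero divide_nonneg_pos) auto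
  have limX: "(\<lambda>j. X (grad (\<phi> j))) \<longlonglongrightarrow> X g"
    unfolding X_def using m by (intro tendsto_mult tendsto_const tendsto_real_sqrt tendsto_divide E) auto
  have int\<phi>: "integrable D.M (\<phi> j)" for j by (intro D.continuous_integrable smooth_continuous \<phi>)
  have av: "(\<lambda>j. avg (cube n) (\<phi> j)) \<longlonglongrightarrow> avg (cube n) u" by (rule D.avg_tendsto[OF int\<phi> intu L1])
  let ?f = "\<lambda>w x. ennreal (norm (w x - avg (cube n) w) powr p)"
  have smooth_case: "(\<integral>\<^sup>+x. ?f (\<phi> j) x \<partial>D.M) \<le> ennreal (m * (X (grad (\<phi> j)) + \<delta>) powr p)" if "0 < \<delta>" for j \<delta>
  proof -
    let ?h = "\<lambda>x. \<bar>\<phi> j x - avg (cube n) (\<phi> j)\<bar> powr p"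
    have "integrable D.M ?h"
      using p(1) by (intro D.continuous_integrable continuous_on_powr' continuous_intros smooth_continuous \<phi>) auto
    moreover have "avg (cube n) (\<phi> j) = bavg 0 (\<lambda>_. 3 powi n) (\<phi> j)"
      using avg_eq_bavg(1)[of "0::real^'n" n "\<phi> j"] int\<phi> by simp
    moreover have "avg (cube n) ?h = bavg 0 (\<lambda>_. 3 powi n) ?h"
      using avg_eq_bavg(1)[of "0::real^'n" n ?h] calculation(1) by simp
    ultimately have "avg (cube n) ?h \<le> (X (grad (\<phi> j)) + \<delta>) powr p"
      using smooth_multiscale_estimate[OF cf \<phi>[of j] p s S that] unfolding avgX[symmetric] K_def by simp
    then have "(LINT x|D.M. ?h x) \<le> m * (X (grad (\<phi> j)) + \<delta>) powr p"
      using m unfolding avg_def m_def[symmetric] by (simp add: pos_divide_le_eq mult.commute)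
    moreover have "(\<integral>\<^sup>+x. ?f (\<phi> j) x \<partial>D.M) = ennreal (LINT x|D.M. ?h x)"
      using \<open>integrable D.M ?h\<close> by (subst nn_integral_eq_integral[symmetric]) auto
    ultimately show ?thesis by (simp add: ennreal_leI)
  qed
  have bound: "(\<integral>\<^sup>+x. ?f u x \<partial>D.M) \<le> ennreal (m * (X g + \<delta>) powr p)" if \<delta>: "0 < \<delta>" for \<delta>
  proof -
    have "AE x in D.M. ?f u x = liminf (\<lambda>j. ?f (\<phi> j) x)"
      using ae
    proof eventually_elim
      case (elim x)
      have "(\<lambda>j. ?f (\<phi> j) x) \<longlonglongrightarrow> ?f u x"
        using p(1) by (intro tendsto_ennrealI tendsto_powr' tendsto_norm tendsto_diff elim av tendsto_const) auto
      then show ?case by (intro lim_imp_Liminf[symmetric]) auto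
    qed
    then have "(\<integral>\<^sup>+x. ?f u x \<partial>D.M) = (\<integral>\<^sup>+x. liminf (\<lambda>j. ?f (\<phi> j) x) \<partial>D.M)"
      by (rule nn_integral_cong_AE)
    also have "\<dots> \<le> liminf (\<lambda>j. \<integral>\<^sup>+x. ?f (\<phi> j) x \<partial>D.M)"
      using borel_measurable_integrable[OF int\<phi>] by (intro nn_integral_liminf) measurable
    also have "\<dots> \<le> ennreal (m * (X g + \<delta>) powr p)"
    proof (rule Liminf_le)
      \<comment> \<open>Half of the slack \<open>\<delta>\<close> absorbs the difference of the
        energies, the other half is spent in \<open>smooth_case\<close>.\<close>
      have "\<forall>\<^sub>F j in sequentially. X (grad (\<phi> j)) < X g + \<delta> / 2"
        using order_tendstoD(2)[OF limX, of "X g + \<delta> / 2"] \<delta> by simp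
      then show "\<forall>\<^sub>F j in sequentially. (\<integral>\<^sup>+x. ?f (\<phi> j) x \<partial>D.M) \<le> ennreal (m * (X g + \<delta>) powr p)"
      proof eventually_elim
        case (elim j)
        have "(\<integral>\<^sup>+x. ?f (\<phi> j) x \<partial>D.M) \<le> ennreal (m * (X (grad (\<phi> j)) + \<delta> / 2) powr p)"
          using \<delta> by (intro smooth_case) simp
        also have "\<dots> \<le> ennreal (m * (X g + \<delta>) powr p)"
          using elim X0[of "grad (\<phi> j)"] m p(1) \<delta> by (intro ennreal_leI mult_left_mono powr_mono2) auto
        finally show ?case .
      qed
    qed simp
    finally show ?thesis .
  qed
  show ?thesis unfolding K_def[symmetric] avgX
  proof (rule ennreal_le_epsilon)
    fix \<delta> :: real assume \<delta>: "0 < \<delta>"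
    have "(\<integral>\<^sup>+x. ?f u x \<partial>D.M) / emeasure lebesgue (cube n :: (real^'n) set) \<le> ennreal (m * (X g + \<delta>) powr p) / ennreal m"
      unfolding D.emeasure_M m_def[symmetric] by (intro divide_right_mono_ennreal bound \<delta>)
    also have "\<dots> = ennreal ((X g + \<delta>) powr p)" using m by (simp add: divide_ennreal)
    finally have "avg_Lp_norm p (cube n) (\<lambda>x. u x - avg (cube n) u) \<le> ennreal (((X g + \<delta>) powr p) powr (1 / p))"
      unfolding avg_Lp_norm_def using p(1) by (intro epowr_le) auto
    also have "((X g + \<delta>) powr p) powr (1 / p) = X g + \<delta>"
      using X0[of g] \<delta> p(1) by (simp add: powr_powr)
    also have "ennreal (X g + \<delta>) = ennreal (X g) + ennreal \<delta>" using X0[of g] \<delta> by (simp add: ennreal_plus)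
    finally show "avg_Lp_norm p (cube n) (\<lambda>x. u x - avg (cube n) u) \<le> ennreal (X g) + ennreal \<delta>" .
  qed
qed

text \<open>Reindexing by depth: on the left \<open>k\<close> counts the scales below
  \<open>n\<close>.\<close>

lemma sum_le_infsum_max_norm:
  assumes T: "(\<Sum>\<^sub>\<infinity>k\<in>{..n}. ennreal (3 powr (- s * of_int (n - k)) * max_norm a n k)) = ennreal S" and S: "0 \<le> S"
  shows "(\<Sum>k=1..N. 3 powr (- s * real k) * max_norm a n (n - int k)) \<le> S"
proof -
  let ?f = "\<lambda>k. ennreal (3 powr (- s * of_int (n - k)) * max_norm a n k)"
  let ?F = "(\<lambda>k. n - int k) ` {1..N}"
  have "ennreal (\<Sum>k=1..N. 3 powr (- s * real k) * max_norm a n (n - int k)) =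
      (\<Sum>k=1..N. ennreal (3 powr (- s * real k) * max_norm a n (n - int k)))"
    by (intro sum_ennreal[symmetric]) (simp add: max_norm_nonneg)
  also have "\<dots> = sum ?f ?F" by (subst sum.reindex) (auto simp: inj_on_def)
  also have "\<dots> \<le> (SUP F\<in>{F. finite F \<and> F \<subseteq> {..n}}. sum ?f F)" by (rule SUP_upper) auto
  also have "\<dots> = infsum ?f {..n}" by (rule nonneg_infsum_complete[symmetric]) simp
  finally show ?thesis unfolding T using S by simp
qed

theorem proposition3p1:
  assumes "CARD('n::finite) \<ge> 2"
  shows "\<exists>C::real. C > 0 \<and>
    (\<forall>(s::real) (n::int) (a :: real^'n \<Rightarrow> real^'n^'n) u g.
       0 < s \<longrightarrow> s \<le> 1 \<longrightarrow> coefficient_field (cube n) a \<longrightarrow> (u, g) \<in> H1 a (cube n) \<longrightarrow>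
       ennreal (3 powi (- n)) *
         avg_Lp_norm (sobolev_exponent (real CARD('n)) s) (cube n) (\<lambda>x. u x - avg (cube n) u)
       \<le> ennreal (C * inverse s) * inverse (epowr (lambda_s a s n) (1/2)) *
         avg_Lp_norm 2 (cube n) (\<lambda>x. matrix_sqrt (a x) *v g x))"
proof -
  define K where "K = 2 + 4 * real CARD('n) * 3 ^ CARD('n)"
  have K: "0 < K" by (simp add: K_def add_pos_nonneg)
  have "ennreal (3 powi (- n)) *
         avg_Lp_norm (sobolev_exponent (real CARD('n)) s) (cube n) (\<lambda>x. u x - avg (cube n) u)
       \<le> ennreal (2 * K * inverse s) * inverse (epowr (lambda_s a s n) (1/2)) *
         avg_Lp_norm 2 (cube n) (\<lambda>x. matrix_sqrt (a x) *v g x)"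
    if s: "0 < s" "s \<le> 1" and cf: "coefficient_field (cube n) a" and u: "(u, g) \<in> H1 a (cube n)"
    for s :: real and n :: int and a :: "real^'n \<Rightarrow> real^'n^'n" and u g
  proof -
    have cube: "open (cube n :: (real^'n) set)" "bounded (cube n :: (real^'n) set)" "cube n \<noteq> ({} :: (real^'n) set)"
      using cube_facts[of "0 :: real^'n" n] by auto
    interpret D: coefficient_domain "cube n" a by unfold_locales (rule cf cube)+
    define p where "p = sobolev_exponent (real CARD('n)) s"
    have p: "2 \<le> p" "CARD('n) * (1/2 - 1/p) = 1 - s"
      unfolding p_def using assms s by (intro sobolev_exponent_conv; simp)+
    define e where "e = sqrt (avg (cube n) (\<lambda>x. g x \<bullet> (a x *v g x)))"
    have e0: "0 \<le> e" and norm_e: "avg_Lp_norm 2 (cube n) (\<lambda>x. matrix_sqrt (a x) *v g x) = ennreal e"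
      using D.energy_nonneg'[of g] D.measure_U_pos D.energy_avg_Lp_norm[OF D.H1_fin[OF u]]
      by (auto simp: e_def avg_def D.ip_def)
    define c where "c = 1 - 3 powr (- s)"
    have c: "s / 2 \<le> c" unfolding c_def by (rule one_minus_powr_ge[OF s])
    then have c0: "0 < c" using s by linarith
    define T where "T = (\<Sum>\<^sub>\<infinity>k\<in>{..n}. ennreal (3 powr (- s * of_int (n - k)) * max_norm a n k))"
    have lam: "inverse (epowr (lambda_s a s n) (1/2)) = ennreal c * T"
      unfolding lambda_s_def max_norm_def[symmetric] T_def[symmetric] c_def[symmetric]
      by (rule inverse_epowr_inverse_square)
    show ?thesis unfolding norm_e lam p_def[symmetric]
    proof (cases T)
      case (real S)
      have "avg_Lp_norm p (cube n) (\<lambda>x. u x - avg (cube n) u) \<le> ennreal (K * 3 powi n * (S * e))"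
        unfolding K_def e_def
        by (rule Sobolev_Poincare_of_multiscale_bound[OF cf u p s(1)], rule sum_le_infsum_max_norm)
           (use real in \<open>simp_all add: T_def\<close>)
      then have "ennreal (3 powi (- n)) * avg_Lp_norm p (cube n) (\<lambda>x. u x - avg (cube n) u) \<le>
          ennreal (3 powi (- n)) * ennreal (K * 3 powi n * (S * e))"
        by (rule mult_left_mono) simp
      also have "\<dots> = ennreal (3 powi (- n) * (K * 3 powi n * (S * e)))"
        by (simp add: ennreal_mult')
      also have "3 powi (- n) * (K * 3 powi n * (S * e)) = K * (S * e)"
        by (simp add: power_int_minus)
      also have "ennreal (K * (S * e)) \<le> ennreal (2 * K * inverse s * (c * S) * e)"
      proof (rule ennreal_leI)
        \<comment> \<open>Origin of the factor \<open>2 / s\<close>: the normalizing factor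
          \<open>c\<close> is inserted in place of the smaller \<open>s / 2\<close>.\<close>
        have "K * (S * e) = 2 * K * inverse s * ((s / 2) * S) * e" using s by (simp add: field_simps)
        also have "\<dots> \<le> 2 * K * inverse s * (c * S) * e"
          using c s K real e0 by (intro mult_right_mono mult_left_mono) auto
        finally show "K * (S * e) \<le> 2 * K * inverse s * (c * S) * e" .
      qed
      also have "\<dots> = ennreal (2 * K * inverse s) * (ennreal c * T) * ennreal e"
        using c0 s K e0 real by (simp add: ennreal_mult')
      finally show "ennreal (3 powi (- n)) * avg_Lp_norm p (cube n) (\<lambda>x. u x - avg (cube n) u) \<le>
          ennreal (2 * K * inverse s) * (ennreal c * T) * ennreal e" .
    next
      case top
      show "ennreal (3 powi (- n)) * avg_Lp_norm p (cube n) (\<lambda>x. u x - avg (cube n) u) \<le>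
          ennreal (2 * K * inverse s) * (ennreal c * T) * ennreal e"
      \<comment> \<open>In \<open>ennreal\<close> the product \<open>\<infinity> * 0\<close> is 0,
        so for vanishing energy the left-hand side has to vanish as well.\<close>
      proof (cases "e = 0")
        case True
        then have "(LINT x|D.M. g x \<bullet> (a x *v g x)) = 0"
          using D.measure_U_pos by (simp add: e_def avg_def)
        from zero_energy_imp_constant[OF cf u this]
        have "AE x in D.M. ennreal (norm (u x - avg (cube n) u) powr p) = 0" by eventually_elim simp
        then have "(\<integral>\<^sup>+x. ennreal (norm (u x - avg (cube n) u) powr p) \<partial>D.M) = (\<integral>\<^sup>+x. 0 \<partial>D.M)"
          by (rule nn_integral_cong_AE)
        then show ?thesis by (simp add: avg_Lp_norm_def epowr_def)
      next
        case False
        have "0 < 2 * K * inverse s" using K s by simp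
        then have "ennreal (2 * K * inverse s) * (ennreal c * T) * ennreal e = top"
          using c0 e0 False top K s by (simp add: ennreal_mult_top ennreal_top_mult ennreal_mult_eq_top_iff)
        then show ?thesis by simp
      qed
    qed
  qed
  then show ?thesis using K by (intro exI[of _ "2 * K"]) simp
qed

end
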